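(* Let $T\ge 2\pi$. Then: (a) The norm $\Vert\xi\Vert=\Vert\xi\Vert_T$ on dual vectors $\xi=(\xi_0,\xi_1)$ is equivalent to the Sobolev-type norm $\Vert\xi\Vert'=\Vert\xi_1\Vert_1+\Vert\eta\Vert_1$, where $\Vert g\Vert_1=\int_{-T/2}^{T/2}|g|\,dt$ and $\eta(t)=\int_0^t\xi_0(x)\,dx$. In particular, the equivalence class of the norm $\Vert\xi\Vert_T$ does not depend on $T$, provided that $T\ge 2\pi$. (b) The dual space to the Banach space with norm $\Vert\xi\Vert_T$ coincides with the space of pairs $\mathfrak f=(f_0,f_1)$ such that $\frac{\partial f_0}{\partial x}\in L_\infty$ and $f_1\in L_\infty$. (c) Thus, if the initial state $\mathfrak f=(f_0,f_1)$ of the string satisfies $\frac{\partial f_0}{\partial x}\in L_\infty$ and $f_1\in L_\infty$, it is possible to damp the string by a bounded load applied to a fixed point. Here damping means the complete stop: not just oscillations, but also the displacement of the string as a whole is forbidden, i.e. the target state is $(0,0)$.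
   Context: $\mathcal T=\mathbb R/2\pi\mathbb Z$ is the one-dimensional torus and $S$ is the space of pairs $\mathfrak f=(f_0,f_1)$ of even real distributions on $\mathcal T$. The controlled closed string is $\frac{\partial^2 f}{\partial t^2}=\frac{\partial^2 f}{\partial x^2}+u(t)\delta$, where $\delta$ is the Dirac delta at $0\in\mathcal T$, $f_0=f$, $f_1=\frac{\partial f}{\partial t}$, and $u$ is the load. Equivalently, $\frac{\partial\mathfrak f}{\partial t}=A\mathfrak f+Bu$ with $A=\begin{pmatrix}0&1\\ \Delta&0\end{pmatrix}$, $\Delta=\frac{\partial^2}{\partial x^2}$, $B=\begin{pmatrix}0\\ \delta\end{pmatrix}$. In (c), "bounded load" means that $u$ is bounded by some constant, not necessarily by $1$. Dual vectors are pairs $\xi=(\xi_0,\xi_1)$ of even real functions on $\mathcal T$ (identified with $2\pi$-periodic functions on $\mathbb R$), paired with states by $\langle\mathfrak f,\xi\rangle=\int_{\mathcal T}(f_0\xi_0+f_1\xi_1)\,dx$. For $T>0$, put $\Vert\xi\Vert_T=\int_0^T|\xi_1(0,t)|\,dt$, where $(\xi_0(x,t),\xi_1(x,t))$ solves $\frac{\partial\xi}{\partial t}=-A^*\xi$, $\xi(T)=\xi$, with $A^*=\begin{pmatrix}0&\Delta\\ 1&0\end{pmatrix}$. This is the support function of the set $D(T)$ of states reachable from zero in time $T$ with controls $|u|\le 1$. Explicitly, if $\xi_1(x)=\sum_{n\in\mathbb Z}\psi_n e^{inx}$ and $\xi_0(x)=\sum_{n\in\mathbb Z}\phi_n e^{inx}$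 (the coefficients are real and even in $n$), then $$\Vert\xi\Vert_T=\int_0^T\Big|\sum_{n\ne 0}\Big(\psi_n\cos nt+\frac{\phi_n}{n}\sin nt\Big)+\psi_0+\phi_0 t\Big|\,dt.$$
   Formalization: The formal statement assumes T > 2π instead of T ≥ 2π (also in the independence-of-T clause): at T = 2π the claims fail, e.g. for ξ₁ = −π and ξ₀ tending to 2πδ the norm ‖ξ‖_T tends to 0 while ‖ξ‖' stays at least 2π². *)

theory Defs
  imports "HOL-Analysis.Analysis"
begin

section \<open>Test functions and distributions on the torus\<close>

text \<open>Functions on the torus are \<open>2\<pi>\<close>-periodic functions on the real line.\<close>

definition smooth :: "(real \<Rightarrow> real) \<Rightarrow> bool" where
  "smooth f \<longleftrightarrow> (\<forall>n x. ((deriv ^^ n) f) field_differentiable at x)"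

definition periodic_2pi :: "(real \<Rightarrow> real) \<Rightarrow> bool" where
  "periodic_2pi f \<longleftrightarrow> (\<forall>x. f (x + 2 * pi) = f x)"

definition even_fun :: "(real \<Rightarrow> real) \<Rightarrow> bool" where
  "even_fun f \<longleftrightarrow> (\<forall>x. f (- x) = f x)"

definition test_funs :: "(real \<Rightarrow> real) set" where
  "test_funs = {\<phi>. smooth \<phi> \<and> periodic_2pi \<phi>}"

type_synonym dist = "(real \<Rightarrow> real) \<Rightarrow> real"

text \<open>A distribution is a linear functional on test functions that is continuous for the
  \<open>C\<^sup>\<infinity>\<close> topology. Its values outside \<^const>\<open>test_funs\<close> are fixed by
  \<^const>\<open>extensional\<close>, so that equality of distributions is equality in HOL.\<close>

definition torus_dists :: "dist set" where
  "torus_dists = {f \<in> extensional test_funs.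
     (\<forall>\<phi>\<in>test_funs. \<forall>\<psi>\<in>test_funs. f (\<lambda>x. \<phi> x + \<psi> x) = f \<phi> + f \<psi>) \<and>
     (\<forall>c. \<forall>\<phi>\<in>test_funs. f (\<lambda>x. c * \<phi> x) = c * f \<phi>) \<and>
     (\<exists>N K. \<forall>\<phi>\<in>test_funs. \<bar>f \<phi>\<bar> \<le> K * (\<Sum>k\<le>(N::nat). SUP x. \<bar>(deriv ^^ k) \<phi> x\<bar>))}"

definition even_dist :: "dist \<Rightarrow> bool" where
  "even_dist f \<longleftrightarrow> (\<forall>\<phi>\<in>test_funs. f (\<lambda>x. \<phi> (- x)) = f \<phi>)"

definition dist_deriv :: "dist \<Rightarrow> dist" where
  "dist_deriv f = (\<lambda>\<phi>\<in>test_funs. - f (deriv \<phi>))"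

definition dirac :: dist where
  "dirac = (\<lambda>\<phi>\<in>test_funs. \<phi> 0)"

definition zero_dist :: dist where
  "zero_dist = (\<lambda>\<phi>\<in>test_funs. 0)"

definition dist_of_fun :: "(real \<Rightarrow> real) \<Rightarrow> dist" where
  "dist_of_fun g = (\<lambda>\<phi>\<in>test_funs. LINT x:{-pi..pi}|lborel. g x * \<phi> x)"

definition Linfty_torus :: "(real \<Rightarrow> real) set" where
  "Linfty_torus = {g \<in> borel_measurable borel. periodic_2pi g \<and>
     (\<exists>K. AE x in lborel. \<bar>g x\<bar> \<le> K)}"

definition Linfty_dists :: "dist set" where
  "Linfty_dists = dist_of_fun ` Linfty_torus"


section \<open>States and dual vectors\<close>

definition states :: "(dist \<times> dist) set" where
  "states = {(f0, f1). f0 \<in> torus_dists \<and> even_dist f0 \<and> f1 \<in> torus_dists \<and> even_dist f1}"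

definition Linfty_states :: "(dist \<times> dist) set" where
  "Linfty_states =
     {(f0, f1) \<in> states. dist_deriv f0 \<in> Linfty_dists \<and> f1 \<in> Linfty_dists}"

type_synonym dual_vec = "(real \<Rightarrow> real) \<times> (real \<Rightarrow> real)"

text \<open>Dual vectors are paired with arbitrary distributions, hence they are smooth.\<close>

definition dual_vecs :: "dual_vec set" where
  "dual_vecs =
     {(\<xi>0, \<xi>1). \<xi>0 \<in> test_funs \<and> even_fun \<xi>0 \<and> \<xi>1 \<in> test_funs \<and> even_fun \<xi>1}"

definition dv_add :: "dual_vec \<Rightarrow> dual_vec \<Rightarrow> dual_vec" where
  "dv_add \<xi> \<zeta> = ((\<lambda>x. fst \<xi> x + fst \<zeta> x), (\<lambda>x. snd \<xi> x + snd \<zeta> x))"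

definition dv_scale :: "real \<Rightarrow> dual_vec \<Rightarrow> dual_vec" where
  "dv_scale c \<xi> = ((\<lambda>x. c * fst \<xi> x), (\<lambda>x. c * snd \<xi> x))"

definition pairing :: "dist \<times> dist \<Rightarrow> dual_vec \<Rightarrow> real" where
  "pairing f \<xi> = fst f (fst \<xi>) + snd f (snd \<xi>)"


section \<open>The norms\<close>

text \<open>\<open>X t = (\<xi>\<^sub>0(\<cdot>,t), \<xi>\<^sub>1(\<cdot>,t))\<close> is a classical solution of
  \<open>\<partial>\<xi>/\<partial>t = - A\<^sup>* \<xi>\<close>, \<open>\<xi>(T) = \<xi>\<close>, that is, \<open>\<partial>\<xi>\<^sub>0/\<partial>t = - \<Delta>\<xi>\<^sub>1\<close> and
  \<open>\<partial>\<xi>\<^sub>1/\<partial>t = - \<xi>\<^sub>0\<close>. Joint continuity of the \<open>x\<close>-derivatives says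
  that \<open>X\<close> is a continuous curve in the space of smooth functions; it makes
  the solution unique on \<open>[0,T]\<close>.\<close>

definition adjoint_solution :: "real \<Rightarrow> dual_vec \<Rightarrow> (real \<Rightarrow> dual_vec) \<Rightarrow> bool" where
  "adjoint_solution T \<xi> X \<longleftrightarrow>
     (\<forall>t\<in>{0..T}. X t \<in> dual_vecs) \<and>
     (\<forall>k. continuous_on ({0..T} \<times> UNIV) (\<lambda>(t, x). (deriv ^^ k) (fst (X t)) x)) \<and>
     (\<forall>k. continuous_on ({0..T} \<times> UNIV) (\<lambda>(t, x). (deriv ^^ k) (snd (X t)) x)) \<and>
     (\<forall>t\<in>{0..T}. \<forall>x.
        ((\<lambda>s. fst (X s) x) has_real_derivative - deriv (deriv (snd (X t))) x) (at t within {0..T}) \<and>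
        ((\<lambda>s. snd (X s) x) has_real_derivative - fst (X t) x) (at t within {0..T})) \<and>
     X T = \<xi>"

definition dual_norm :: "real \<Rightarrow> dual_vec \<Rightarrow> real" where
  "dual_norm T \<xi> =
     (THE r. \<exists>X. adjoint_solution T \<xi> X \<and> r = (LINT t:{0..T}|lborel. \<bar>snd (X t) 0\<bar>))"

definition L1_norm_sym :: "real \<Rightarrow> (real \<Rightarrow> real) \<Rightarrow> real" where
  "L1_norm_sym T g = (LINT t:{-(T/2)..T/2}|lborel. \<bar>g t\<bar>)"

definition sobolev_norm :: "real \<Rightarrow> dual_vec \<Rightarrow> real" where
  "sobolev_norm T \<xi> =
     L1_norm_sym T (snd \<xi>) + L1_norm_sym T (\<lambda>t. LBINT x=0..t. fst \<xi> x)"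

definition norm_on_dual_vecs :: "(dual_vec \<Rightarrow> real) \<Rightarrow> bool" where
  "norm_on_dual_vecs p \<longleftrightarrow>
     (\<forall>\<xi>\<in>dual_vecs. 0 \<le> p \<xi> \<and> (p \<xi> = 0 \<longleftrightarrow> \<xi> = ((\<lambda>_. 0), (\<lambda>_. 0)))) \<and>
     (\<forall>\<xi>\<in>dual_vecs. \<forall>c. p (dv_scale c \<xi>) = \<bar>c\<bar> * p \<xi>) \<and>
     (\<forall>\<xi>\<in>dual_vecs. \<forall>\<zeta>\<in>dual_vecs. p (dv_add \<xi> \<zeta>) \<le> p \<xi> + p \<zeta>)"

definition equivalent_norms :: "(dual_vec \<Rightarrow> real) \<Rightarrow> (dual_vec \<Rightarrow> real) \<Rightarrow> bool" where
  "equivalent_norms p q \<longleftrightarrow> norm_on_dual_vecs p \<and> norm_on_dual_vecs q \<and>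
     (\<exists>c>0. \<exists>C>0. \<forall>\<xi>\<in>dual_vecs. c * q \<xi> \<le> p \<xi> \<and> p \<xi> \<le> C * q \<xi>)"


section \<open>The Banach space with a given norm and its dual\<close>

text \<open>\<open>\<iota>\<close> is a linear isometric embedding of the dual vectors, normed by \<open>p\<close>, into some
  Banach space; the closure of its range is the completion, unique up to isometry.
  For \<open>p = dual_norm T\<close> an embedding into the dual of the space of bounded continuous
  functions sends \<open>\<xi>\<close> to \<open>h \<mapsto> \<integral>\<^sub>0\<^sup>T h(t) \<xi>\<^sub>1(0,t) dt\<close>.\<close>

definition isometric_embedding ::
  "(dual_vec \<Rightarrow> real) \<Rightarrow> (dual_vec \<Rightarrow> 'b::banach) \<Rightarrow> bool" where
  "isometric_embedding p \<iota> \<longleftrightarrow>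
     (\<forall>\<xi>\<in>dual_vecs. \<forall>\<zeta>\<in>dual_vecs. \<iota> (dv_add \<xi> \<zeta>) = \<iota> \<xi> + \<iota> \<zeta>) \<and>
     (\<forall>c. \<forall>\<xi>\<in>dual_vecs. \<iota> (dv_scale c \<xi>) = c *\<^sub>R \<iota> \<xi>) \<and>
     (\<forall>\<xi>\<in>dual_vecs. norm (\<iota> \<xi>) = p \<xi>)"

definition completion :: "(dual_vec \<Rightarrow> 'b::banach) \<Rightarrow> 'b set" where
  "completion \<iota> = closure (\<iota> ` dual_vecs)"

definition dual_space :: "'b::real_normed_vector set \<Rightarrow> ('b \<Rightarrow> real) set" where
  "dual_space V = {F \<in> extensional V.
     (\<forall>a\<in>V. \<forall>b\<in>V. F (a + b) = F a + F b) \<and>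
     (\<forall>c. \<forall>a\<in>V. F (c *\<^sub>R a) = c * F a) \<and>
     (\<exists>K. \<forall>a\<in>V. \<bar>F a\<bar> \<le> K * norm a)}"

definition represents ::
  "(dual_vec \<Rightarrow> 'b::banach) \<Rightarrow> dist \<times> dist \<Rightarrow> ('b \<Rightarrow> real) \<Rightarrow> bool" where
  "represents \<iota> f F \<longleftrightarrow> (\<forall>\<xi>\<in>dual_vecs. F (\<iota> \<xi>) = pairing f \<xi>)"

text \<open>The dual of the completion coincides with the set \<open>W\<close> of states: the pairing matches
  the bounded functionals one-to-one with the elements of \<open>W\<close>, and a state outside \<open>W\<close>
  does not induce a bounded functional.\<close>

definition dual_coincides_with ::
  "(dual_vec \<Rightarrow> 'b::banach) \<Rightarrow> (dist \<times> dist) set \<Rightarrow> bool" where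
  "dual_coincides_with \<iota> W \<longleftrightarrow>
     (\<forall>f\<in>W. \<exists>!F. F \<in> dual_space (completion \<iota>) \<and> represents \<iota> f F) \<and>
     (\<forall>F\<in>dual_space (completion \<iota>). \<exists>!f. f \<in> states \<and> represents \<iota> f F) \<and>
     (\<forall>F\<in>dual_space (completion \<iota>). \<forall>f\<in>states. represents \<iota> f F \<longrightarrow> f \<in> W)"


section \<open>The controlled string\<close>

text \<open>Since the load \<open>u\<close> is only measurable, \<open>\<partial>f/\<partial>t = A f + B u\<close> is understood, as usual, in
  the integrated form, tested against every test function.\<close>

definition controlled_string ::
  "real \<Rightarrow> (real \<Rightarrow> real) \<Rightarrow> (real \<Rightarrow> dist \<times> dist) \<Rightarrow> bool" where
  "controlled_string T u f \<longleftrightarrow>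
     (\<forall>t\<in>{0..T}. f t \<in> states) \<and>
     (\<forall>\<phi>\<in>test_funs.
        set_integrable lborel {0..T} (\<lambda>s. snd (f s) \<phi>) \<and>
        set_integrable lborel {0..T}
          (\<lambda>s. dist_deriv (dist_deriv (fst (f s))) \<phi> + u s * dirac \<phi>) \<and>
        (\<forall>t\<in>{0..T}.
           fst (f t) \<phi> = fst (f 0) \<phi> + (LINT s:{0..t}|lborel. snd (f s) \<phi>) \<and>
           snd (f t) \<phi> = snd (f 0) \<phi> +
             (LINT s:{0..t}|lborel. dist_deriv (dist_deriv (fst (f s))) \<phi> + u s * dirac \<phi>)))"

definition bounded_load :: "real \<Rightarrow> (real \<Rightarrow> real) \<Rightarrow> bool" where
  "bounded_load T u \<longleftrightarrow> u \<in> borel_measurable borel \<and> (\<exists>M. \<forall>t\<in>{0..T}. \<bar>u t\<bar> \<le> M)"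

definition can_be_damped :: "real \<Rightarrow> dist \<times> dist \<Rightarrow> bool" where
  "can_be_damped T f \<longleftrightarrow>
     (\<exists>u g. bounded_load T u \<and> controlled_string T u g \<and> g 0 = f \<and> g T = (zero_dist, zero_dist))"

end

theory Submission
  imports Defs
begin

text \<open>
  A dual vector \<open>\<xi> = (\<xi>\<^sub>0, \<xi>\<^sub>1)\<close> is encoded by the single function
  \<open>h(s) = \<xi>\<^sub>1(s) + \<integral>\<^sub>0\<^sup>s \<xi>\<^sub>0\<close>, called its profile. Its even part is \<open>\<xi>\<^sub>1\<close> and its odd part is the
  primitive \<open>\<eta>\<close> of \<open>\<xi>\<^sub>0\<close>, so \<open>\<xi>\<close> can be recovered, and the profiles are exactly the smooth functions
  for which \<open>h(s + 2\<pi>) - h(s)\<close> is a constant, the slope. By d'Alembert's formula the solution with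
  terminal value \<open>\<xi>\<close> has \<open>\<xi>\<^sub>1(0, T - s) = h(s)\<close>, and going back in time translates the profile.
  Thus \<open>\<parallel>\<xi>\<parallel>\<^sub>T\<close> is the \<open>L\<^sub>1\<close> norm of \<open>h\<close> on \<open>[0,T]\<close> (lemma \<open>dual_norm_eq\<close>).

  (a) If an interval is longer than \<open>2\<pi>\<close>, comparing \<open>h(s)\<close> with \<open>h(s + 2\<pi>)\<close> bounds the slope by the
  \<open>L\<^sub>1\<close> norm of \<open>h\<close> on it; translates by multiples of \<open>2\<pi>\<close> then bound \<open>h\<close> on every other interval
  (\<open>L1_Icc_compare\<close>). So \<open>\<parallel>\<cdot>\<parallel>\<^sub>T\<close> is equivalent to the \<open>L\<^sub>1\<close> norm of \<open>h\<close> on \<open>[-T/2, T/2]\<close>, and on a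
  symmetric interval this is equivalent to the sum of the norms of the even and the odd part. On an
  interval of length exactly \<open>2\<pi>\<close> the slope is not controlled: for \<open>\<xi>\<^sub>1 = -\<pi>\<close> and \<open>\<xi>\<^sub>0\<close> close to \<open>2\<pi>\<delta>\<close>
  the profile is small in mean on \<open>[0, 2\<pi>]\<close>, but its slope is \<open>2\<pi>\<close>.

  (b) A state that is bounded for \<open>\<parallel>\<cdot>\<parallel>\<^sub>T\<close> makes \<open>f\<^sub>1\<close> and \<open>f\<^sub>0'\<close> functionals on test functions that are
  bounded in the \<open>L\<^sub>1\<close> norm, and those are given by \<open>L\<^sub>\<infinity>\<close> densities (\<open>Linfty_distsI\<close>). That lemma is
  proved by extending the functional to indicators of intervals, which yields a Lipschitz primitive,
  and differentiating the latter by means of the Radon-Nikodym theorem. Conversely, for \<open>L\<^sub>\<infinity>\<close> data the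
  pairing equals \<open>\<integral> v h + c \<cdot> slope h\<close> with a bounded periodic \<open>v\<close> (\<open>pairing_profile_density\<close>).

  (c) In terms of profiles the controlled evolution started at \<open>f\<close> is explicit: the state at time \<open>t\<close>
  pairs with \<open>\<xi>\<close> to \<open>\<langle>f, h(\<cdot> + t)\<rangle> + \<integral>\<^sub>0\<^sup>t u(s) h(t - s) ds\<close>. It vanishes at time \<open>T\<close> for all \<open>h\<close> if \<open>u\<close>
  is read off from \<open>v\<close> moved into \<open>[T - 2\<pi>, T]\<close>, the slope being expressed through the values
  of \<open>h\<close> on \<open>[0,T]\<close>; the latter is possible because \<open>T > 2\<pi>\<close> (\<open>exists_steering_control\<close>).
\<close>

section \<open>Smooth functions\<close>

text \<open>Smoothness is the largest class of differentiable functions closed under differentiation, so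
  membership in any such class proves it.\<close>

lemma smooth_coinduct:
  assumes "f \<in> A"
    and step: "\<And>f. f \<in> A \<Longrightarrow> \<exists>g\<in>A. \<forall>x. (f has_real_derivative g x) (at x)"
  shows "smooth f"
proof -
  have *: "(deriv ^^ n) f \<in> A" for n
  proof (induction n)
    case (Suc n)
    obtain g where g: "g \<in> A" "\<forall>x. ((deriv ^^ n) f has_real_derivative g x) (at x)"
      using step[OF Suc] by blast
    then have "deriv ((deriv ^^ n) f) = g"
      by (auto intro!: DERIV_imp_deriv)
    then show ?case using g by simp
  qed (use assms in simp)
  show ?thesis
    unfolding smooth_def field_differentiable_def using * step by meson
qed

lemma smooth_DERIV: "smooth f \<Longrightarrow> (f has_real_derivative deriv f x) (at x)"
  unfolding smooth_def using DERIV_deriv_iff_field_differentiable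
  by (metis funpow_0)

lemma smooth_deriv: "smooth f \<Longrightarrow> smooth (deriv f)"
  unfolding smooth_def
  by (metis funpow_Suc_right o_apply)

lemma smooth_deriv_n: "smooth f \<Longrightarrow> smooth ((deriv ^^ n) f)"
  by (induction n) (auto intro: smooth_deriv)

lemma smooth_has_smooth_deriv:
  assumes "\<And>x. (f has_real_derivative g x) (at x)" "smooth g"
  shows "smooth f"
proof (rule smooth_coinduct)
  show "f \<in> insert f (Collect smooth)" by simp
  fix k assume "k \<in> insert f (Collect smooth)"
  then show "\<exists>g\<in>insert f (Collect smooth). \<forall>x. (k has_real_derivative g x) (at x)"
    using assms smooth_DERIV smooth_deriv by blast
qed

lemma smooth_continuous_on: "smooth f \<Longrightarrow> continuous_on S f"
  by (meson DERIV_continuous_on smooth_DERIV has_field_derivative_at_within)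

lemma smooth_const: "smooth (\<lambda>_. c)"
proof (rule smooth_coinduct)
  show "(\<lambda>_. c) \<in> range (\<lambda>c _. c)" by simp
qed (auto intro!: bexI[of _ "\<lambda>_. 0"] derivative_eq_intros)

lemma smooth_add:
  assumes "smooth f" "smooth g"
  shows "smooth (\<lambda>x. f x + g x)"
proof (rule smooth_coinduct)
  let ?A = "{\<lambda>x. f x + g x |f g. smooth f \<and> smooth g}"
  show "(\<lambda>x. f x + g x) \<in> ?A" using assms by blast
  fix k assume "k \<in> ?A"
  then obtain f g where k: "k = (\<lambda>x. f x + g x)" "smooth f" "smooth g" by blast
  then have "\<forall>x. (k has_real_derivative (deriv f x + deriv g x)) (at x)"
    by (auto intro!: DERIV_add smooth_DERIV)
  then show "\<exists>g\<in>?A. \<forall>x. (k has_real_derivative g x) (at x)"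
    using smooth_deriv k by (intro bexI[of _ "\<lambda>x. deriv f x + deriv g x"]) auto
qed

lemma smooth_affine:
  assumes "smooth f"
  shows "smooth (\<lambda>x. c * f (a * x + b))"
proof (rule smooth_coinduct)
  let ?A = "{\<lambda>x. c * f (a * x + b) |c f. smooth f}"
  show "(\<lambda>x. c * f (a * x + b)) \<in> ?A" using assms by blast
  fix k assume "k \<in> ?A"
  then obtain c f where k: "k = (\<lambda>x. c * f (a * x + b))" "smooth f" by blast
  have "\<forall>x. (k has_real_derivative (c * a) * deriv f (a * x + b)) (at x)"
    unfolding k by (auto intro!: derivative_eq_intros DERIV_chain'[OF _ smooth_DERIV] simp: k)
  then show "\<exists>g\<in>?A. \<forall>x. (k has_real_derivative g x) (at x)"
    using smooth_deriv k by (intro bexI[of _ "\<lambda>x. (c * a) * deriv f (a * x + b)"]) auto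
qed

lemma smooth_cmult: "smooth f \<Longrightarrow> smooth (\<lambda>x. c * f x)"
  using smooth_affine[of f c 1 0] by simp

lemma smooth_uminus: "smooth f \<Longrightarrow> smooth (\<lambda>x. - f x)"
  using smooth_affine[of f "-1" 1 0] by simp

lemma smooth_diff: "smooth f \<Longrightarrow> smooth g \<Longrightarrow> smooth (\<lambda>x. f x - g x)"
  using smooth_add[of f "\<lambda>x. - g x"] smooth_uminus[of g] by simp

lemma smooth_shift: "smooth f \<Longrightarrow> smooth (\<lambda>x. f (x + b))"
  using smooth_affine[of f 1 1 b] by simp

lemma smooth_reflect: "smooth f \<Longrightarrow> smooth (\<lambda>x. f (- x))"
  using smooth_affine[of f 1 "-1" 0] by simp

lemma smooth_id: "smooth (\<lambda>x. x)"
  by (rule smooth_has_smooth_deriv[OF _ smooth_const[of 1]]) (auto intro!: derivative_eq_intros)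

lemmas smooth_intros = smooth_const smooth_add smooth_cmult smooth_uminus smooth_diff smooth_shift
  smooth_reflect smooth_id

lemma deriv_affine_n:
  assumes "smooth f"
  shows "(deriv ^^ n) (\<lambda>x. c * f (a * x + b)) = (\<lambda>x. c * a ^ n * (deriv ^^ n) f (a * x + b))"
proof (induction n)
  case (Suc n)
  have "((\<lambda>x. c * a ^ n * (deriv ^^ n) f (a * x + b)) has_real_derivative
      c * a ^ Suc n * (deriv ^^ Suc n) f (a * x + b)) (at x)" for x
    by (auto intro!: derivative_eq_intros DERIV_chain'[OF _ smooth_DERIV] smooth_deriv_n assms)
  then show ?case
    by (auto simp: Suc intro!: ext DERIV_imp_deriv)
qed simp

lemma deriv_add_n:
  assumes "smooth f" "smooth g"
  shows "(deriv ^^ n) (\<lambda>x. f x + g x) = (\<lambda>x. (deriv ^^ n) f x + (deriv ^^ n) g x)"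
proof (induction n)
  case (Suc n)
  have "((\<lambda>x. (deriv ^^ n) f x + (deriv ^^ n) g x) has_real_derivative
      (deriv ^^ Suc n) f x + (deriv ^^ Suc n) g x) (at x)" for x
    by (auto intro!: DERIV_add smooth_DERIV smooth_deriv_n assms)
  then show ?case
    by (auto simp: Suc intro!: ext DERIV_imp_deriv)
qed simp

section \<open>Periodic functions\<close>

lemma quasiperiodic_shift:
  fixes f :: "real \<Rightarrow> real"
  assumes "\<And>x. f (x + 2 * pi) = f x + c"
  shows "f (x + 2 * pi * of_int k) = f x + of_int k * c"
proof (induction k rule: int_induct[where k=0])
  case (step1 i)
  then show ?case using assms[of "x + 2 * pi * of_int i"] by (simp add: algebra_simps)
next
  case (step2 i)
  then show ?case using assms[of "x + 2 * pi * of_int (i - 1)"] by (simp add: algebra_simps)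
qed simp

lemma periodic_imp_bounded:
  assumes "periodic_2pi f" "continuous_on UNIV f"
  obtains K where "K \<ge> 0" "\<And>x. \<bar>f x\<bar> \<le> K"
proof -
  have "compact (f ` {0..2*pi})"
    using assms by (intro compact_continuous_image) (auto intro: continuous_on_subset)
  then obtain K where K: "\<And>x. x \<in> {0..2*pi} \<Longrightarrow> \<bar>f x\<bar> \<le> K"
    by (metis bounded_iff compact_imp_bounded image_eqI real_norm_def)
  have "f (x + 2 * pi * of_int k) = f x" for x k
    using quasiperiodic_shift[of f 0] assms(1) by (simp add: periodic_2pi_def)
  moreover have "x + 2 * pi * of_int (- \<lfloor>x/(2*pi)\<rfloor>) \<in> {0..2*pi}" for x
    using floor_divide_lower[of "2*pi" x] floor_divide_upper[of "2*pi" x]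
    by (auto simp: algebra_simps)
  ultimately have "\<bar>f x\<bar> \<le> K" for x
    using K by metis
  then show ?thesis using that[of K]
    by (metis abs_ge_zero order_trans)
qed

lemma periodic_deriv:
  assumes "smooth f" "periodic_2pi f"
  shows "periodic_2pi (deriv f)"
  unfolding periodic_2pi_def
proof
  fix x
  have "((\<lambda>x. f (x + 2*pi)) has_real_derivative deriv f (x + 2*pi)) (at x)"
    using smooth_DERIV[OF assms(1)] DERIV_shift by blast
  moreover have "(\<lambda>x. f (x + 2*pi)) = f" using assms by (auto simp: periodic_2pi_def)
  ultimately show "deriv f (x + 2*pi) = deriv f x"
    by (metis DERIV_imp_deriv)
qed

lemma test_funs_deriv: "\<phi> \<in> test_funs \<Longrightarrow> deriv \<phi> \<in> test_funs"
  by (auto simp: test_funs_def smooth_deriv periodic_deriv)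

lemma test_funs_const: "(\<lambda>_. c) \<in> test_funs"
  by (auto simp: test_funs_def periodic_2pi_def smooth_intros)

lemma test_funs_add: "\<phi> \<in> test_funs \<Longrightarrow> \<psi> \<in> test_funs \<Longrightarrow> (\<lambda>x. \<phi> x + \<psi> x) \<in> test_funs"
  by (auto simp: test_funs_def periodic_2pi_def smooth_intros)

lemma test_funs_cmult: "\<phi> \<in> test_funs \<Longrightarrow> (\<lambda>x. c * \<phi> x) \<in> test_funs"
  by (auto simp: test_funs_def periodic_2pi_def smooth_intros)

lemma test_funs_diff: "\<phi> \<in> test_funs \<Longrightarrow> \<psi> \<in> test_funs \<Longrightarrow> (\<lambda>x. \<phi> x - \<psi> x) \<in> test_funs"
  by (auto simp: test_funs_def periodic_2pi_def smooth_intros)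

lemma test_funs_reflect: "\<phi> \<in> test_funs \<Longrightarrow> (\<lambda>x. \<phi> (- x)) \<in> test_funs"
  unfolding test_funs_def periodic_2pi_def
  by (auto simp: smooth_intros)
     (metis add.commute add_diff_cancel_left' minus_add_distrib uminus_add_conv_diff diff_minus_eq_add)

lemma test_funs_bounded:
  assumes "\<phi> \<in> test_funs"
  obtains K where "K \<ge> 0" "\<And>x. \<bar>\<phi> x\<bar> \<le> K"
  using periodic_imp_bounded assms smooth_continuous_on
  unfolding test_funs_def by blast

lemma test_funs_le_SUP:
  assumes "\<phi> \<in> test_funs"
  shows "\<bar>\<phi> x\<bar> \<le> (SUP x. \<bar>\<phi> x\<bar>)"
proof -
  obtain K where "\<And>x. \<bar>\<phi> x\<bar> \<le> K" using test_funs_bounded[OF assms] by blast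
  then show ?thesis by (intro cSUP_upper bdd_aboveI2) auto
qed

lemma test_funs_DERIV: "\<phi> \<in> test_funs \<Longrightarrow> (\<phi> has_real_derivative deriv \<phi> x) (at x)"
  by (simp add: test_funs_def smooth_DERIV)

section \<open>Profiles\<close>

text \<open>The trace at \<open>x = 0\<close> of the adjoint solution, as a function of the time left until the
  terminal time.\<close>

definition profile :: "dual_vec \<Rightarrow> real \<Rightarrow> real" where
  "profile \<xi> = (\<lambda>x. snd \<xi> x + (LBINT y=0..x. fst \<xi> y))"

definition profiles :: "(real \<Rightarrow> real) set" where
  "profiles = {h. smooth h \<and> (\<exists>c. \<forall>x. h (x + 2 * pi) = h x + c)}"

definition slope :: "(real \<Rightarrow> real) \<Rightarrow> real" where
  "slope h = h (2 * pi) - h 0"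

definition dual_vec_of :: "(real \<Rightarrow> real) \<Rightarrow> dual_vec" where
  "dual_vec_of h = ((\<lambda>x. (deriv h x + deriv h (- x)) / 2), (\<lambda>x. (h x + h (- x)) / 2))"

lemma DERIV_LBINT:
  fixes f :: "real \<Rightarrow> real"
  assumes "continuous_on UNIV f"
  shows "((\<lambda>x. LBINT y=0..x. f y) has_real_derivative f x) (at x)"
proof -
  define a b where "a = min 0 x - 1" and "b = max 0 x + 1"
  have "((\<lambda>u. LBINT y=ereal 0..ereal u. f y) has_vector_derivative f x) (at x within {a..b})"
    by (rule interval_integral_FTC2)
       (auto simp: a_def b_def intro: continuous_on_subset[OF assms])
  moreover have "at x within {a..b} = at x"
    by (rule at_within_Icc_at) (auto simp: a_def b_def)
  ultimately show ?thesis
    by (simp add: has_real_derivative_iff_has_vector_derivative zero_ereal_def)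
qed

lemma LBINT_eq_primitive:
  fixes f :: "real \<Rightarrow> real"
  assumes "continuous_on UNIV f" "\<And>x. (F has_real_derivative f x) (at x)"
  shows "(LBINT y=0..x. f y) = F x - F 0"
proof -
  have "((\<lambda>x. (LBINT y=0..x. f y) - F x) has_real_derivative 0) (at x)" for x
    using DERIV_diff[OF DERIV_LBINT[OF assms(1)] assms(2)] by simp
  then have "(LBINT y=0..x. f y) - F x = (LBINT y=0..ereal 0. f y) - F 0"
    using DERIV_isconst_all by blast
  then show ?thesis by (simp add: zero_ereal_def)
qed

lemma LBINT_zero [simp]: "(LBINT y=0..ereal 0. f y) = (0::real)"
  by (simp add: zero_ereal_def)

lemma profile_0: "profile \<xi> 0 = snd \<xi> 0"
  by (simp add: profile_def)

lemma even_funD: "even_fun f \<Longrightarrow> f (- x) = f x"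
  by (simp add: even_fun_def)

lemma periodic_2piD: "periodic_2pi f \<Longrightarrow> f (x + 2 * pi) = f x"
  by (simp add: periodic_2pi_def)

lemma dual_vecsD:
  assumes "\<xi> \<in> dual_vecs"
  shows "fst \<xi> \<in> test_funs" "snd \<xi> \<in> test_funs" "even_fun (fst \<xi>)" "even_fun (snd \<xi>)"
    "smooth (fst \<xi>)" "smooth (snd \<xi>)" "periodic_2pi (fst \<xi>)" "periodic_2pi (snd \<xi>)"
  using assms by (auto simp: dual_vecs_def test_funs_def)

lemma deriv_even:
  assumes "smooth f" "even_fun f"
  shows "deriv f (- x) = - deriv f x"
proof -
  have "((\<lambda>x. f (- x)) has_real_derivative - deriv f (- x)) (at x)"
    using DERIV_chain'[OF DERIV_minus[OF DERIV_ident] smooth_DERIV[OF assms(1)]] by simp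
  moreover have "(\<lambda>x. f (- x)) = f" using assms by (auto simp: even_fun_def)
  ultimately show ?thesis using smooth_DERIV[OF assms(1)] DERIV_unique
    by (metis minus_equation_iff)
qed

lemma profile_DERIV:
  assumes "\<xi> \<in> dual_vecs"
  shows "(profile \<xi> has_real_derivative deriv (snd \<xi>) x + fst \<xi> x) (at x)"
  unfolding profile_def
  by (intro DERIV_add DERIV_LBINT smooth_DERIV smooth_continuous_on dual_vecsD assms)

lemma odd_primitive:
  assumes "\<xi> \<in> dual_vecs"
  shows "(LBINT y=0..ereal (- x). fst \<xi> y) = - (LBINT y=0..x. fst \<xi> y)"
proof -
  have "(LBINT y=0..x. fst \<xi> y) = - (LBINT y=0..ereal (- x). fst \<xi> y) - - (LBINT y=0..ereal (- 0). fst \<xi> y)"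
  proof (rule LBINT_eq_primitive)
    have *: "((\<lambda>u. LBINT y=0..u. fst \<xi> y) has_real_derivative fst \<xi> x) (at x)" for x
      by (intro DERIV_LBINT smooth_continuous_on dual_vecsD assms)
    show "((\<lambda>x. - (LBINT y=0..ereal (- x). fst \<xi> y)) has_real_derivative fst \<xi> x) (at x)" for x
      using DERIV_minus[OF DERIV_chain'[OF DERIV_minus[OF DERIV_ident] *[of "- x"]]]
        even_funD[OF dual_vecsD(3)[OF assms]] by simp
  qed (intro smooth_continuous_on dual_vecsD assms)
  then show ?thesis by simp
qed

lemma profile_in_profiles:
  assumes "\<xi> \<in> dual_vecs"
  shows "profile \<xi> \<in> profiles"
proof -
  have sm: "smooth (profile \<xi>)"
    by (rule smooth_has_smooth_deriv[OF profile_DERIV])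
       (intro smooth_intros smooth_deriv dual_vecsD assms)+
  have "((\<lambda>x. profile \<xi> (x + 2 * pi) - profile \<xi> x) has_real_derivative
      (deriv (snd \<xi>) (x + 2 * pi) + fst \<xi> (x + 2 * pi)) - (deriv (snd \<xi>) x + fst \<xi> x)) (at x)" for x
    by (rule DERIV_diff)
       (use profile_DERIV[OF assms] DERIV_shift in blast)+
  then have "((\<lambda>x. profile \<xi> (x + 2 * pi) - profile \<xi> x) has_real_derivative 0) (at x)" for x
    using periodic_2piD[OF periodic_deriv[of "snd \<xi>"]] periodic_2piD[of "fst \<xi>"] dual_vecsD[OF assms]
    by simp
  then have "profile \<xi> (x + 2 * pi) - profile \<xi> x = profile \<xi> (0 + 2 * pi) - profile \<xi> 0" for x
    using DERIV_isconst_all by blast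
  then have "\<forall>x. profile \<xi> (x + 2 * pi) = profile \<xi> x + (profile \<xi> (0 + 2 * pi) - profile \<xi> 0)"
    by (metis add.commute diff_add_cancel)
  then show ?thesis unfolding profiles_def using sm by blast
qed

lemma even_part_profile:
  assumes "\<xi> \<in> dual_vecs"
  shows "(profile \<xi> x + profile \<xi> (- x)) / 2 = snd \<xi> x"
    and "(profile \<xi> x - profile \<xi> (- x)) / 2 = (LBINT y=0..x. fst \<xi> y)"
  using odd_primitive[OF assms, of x] even_funD[OF dual_vecsD(4)[OF assms], of x]
  by (simp_all add: profile_def)

lemma dual_vec_of_profile:
  assumes "\<xi> \<in> dual_vecs"
  shows "dual_vec_of (profile \<xi>) = \<xi>"
proof -
  have d: "deriv (profile \<xi>) = (\<lambda>x. deriv (snd \<xi>) x + fst \<xi> x)"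
    by (intro ext DERIV_imp_deriv profile_DERIV assms)
  have "(deriv (profile \<xi>) x + deriv (profile \<xi>) (- x)) / 2 = fst \<xi> x" for x
    unfolding d using deriv_even[of "snd \<xi>"] even_funD[of "fst \<xi>"] dual_vecsD[OF assms]
    by simp
  then show ?thesis
    unfolding dual_vec_of_def using even_part_profile(1)[OF assms] by simp
qed

lemma profiles_smooth: "h \<in> profiles \<Longrightarrow> smooth h"
  by (simp add: profiles_def)

lemma profiles_period:
  assumes "h \<in> profiles"
  shows "h (x + 2 * pi) = h x + slope h"
proof -
  obtain c where "\<And>x. h (x + 2 * pi) = h x + c" using assms by (auto simp: profiles_def)
  from this[of x] this[of 0] show ?thesis by (simp add: slope_def)
qed

lemma profiles_deriv_test_fun:
  assumes "h \<in> profiles"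
  shows "deriv h \<in> test_funs"
proof -
  have "deriv h (x + 2 * pi) = deriv h x" for x
  proof -
    have "((\<lambda>x. h (x + 2*pi)) has_real_derivative deriv h (x + 2*pi)) (at x)"
      using smooth_DERIV[OF profiles_smooth[OF assms]] DERIV_shift by blast
    moreover have "((\<lambda>x. h (x + 2*pi)) has_real_derivative deriv h x) (at x)"
      unfolding profiles_period[OF assms]
      using DERIV_add[OF smooth_DERIV[OF profiles_smooth[OF assms]] DERIV_const] by simp
    ultimately show ?thesis using DERIV_unique by blast
  qed
  then show ?thesis
    using assms smooth_deriv by (auto simp: test_funs_def periodic_2pi_def profiles_def)
qed

lemma test_funs_in_profiles: "\<phi> \<in> test_funs \<Longrightarrow> \<phi> \<in> profiles"
  by (auto simp: test_funs_def profiles_def periodic_2pi_def intro!: exI[of _ 0])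

lemma profiles_shift: "h \<in> profiles \<Longrightarrow> (\<lambda>x. h (x + t)) \<in> profiles"
  unfolding profiles_def
  by (auto simp: smooth_intros) (metis add.assoc add.commute)

lemma profiles_add: "h \<in> profiles \<Longrightarrow> k \<in> profiles \<Longrightarrow> (\<lambda>x. h x + k x) \<in> profiles"
  by (auto simp: profiles_def smooth_intros)

lemma profiles_cmult: "h \<in> profiles \<Longrightarrow> (\<lambda>x. c * h x) \<in> profiles"
  by (auto simp: profiles_def smooth_intros) (metis distrib_left)

lemma reflect_profiles:
  assumes "h \<in> profiles"
  shows "h (- (x + 2 * pi)) = h (- x) - slope h"
  using profiles_period[OF assms, of "- (x + 2 * pi)"] by simp

lemma dual_vec_of_in:
  assumes "h \<in> profiles"
  shows "dual_vec_of h \<in> dual_vecs"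
proof -
  have 1: "(\<lambda>x. (1/2) * (deriv h x + deriv h (- x))) \<in> test_funs"
    by (intro test_funs_cmult test_funs_add test_funs_reflect profiles_deriv_test_fun assms)
  have 2: "smooth (\<lambda>x. (1/2) * (h x + h (- x)))"
    by (intro smooth_intros profiles_smooth assms)
  show ?thesis
    using 1 2 reflect_profiles[OF assms] profiles_period[OF assms]
    by (auto simp: dual_vec_of_def dual_vecs_def even_fun_def test_funs_def periodic_2pi_def)
qed

lemma profile_dual_vec_of:
  assumes "h \<in> profiles"
  shows "profile (dual_vec_of h) = h"
proof
  fix x :: real
  note D = smooth_DERIV[OF profiles_smooth[OF assms]]
  have "(LBINT y=0..x. fst (dual_vec_of h) y) = (h x - h (- x)) / 2 - (h 0 - h (- 0)) / 2"
  proof (rule LBINT_eq_primitive)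
    show "continuous_on UNIV (fst (dual_vec_of h))"
      by (intro smooth_continuous_on dual_vecsD dual_vec_of_in assms)
    show "((\<lambda>x. (h x - h (- x)) / 2) has_real_derivative fst (dual_vec_of h) x) (at x)" for x
      by (auto intro!: derivative_eq_intros D DERIV_chain'[OF _ D] simp: dual_vec_of_def)
  qed
  then show "profile (dual_vec_of h) x = h x"
    by (simp add: profile_def dual_vec_of_def field_simps)
qed

lemma profile_add:
  assumes "\<xi> \<in> dual_vecs" "\<zeta> \<in> dual_vecs"
  shows "profile (dv_add \<xi> \<zeta>) = (\<lambda>x. profile \<xi> x + profile \<zeta> x)"
proof
  fix x :: real
  have "(LBINT y=0..x. fst \<xi> y + fst \<zeta> y) = ((LBINT y=0..x. fst \<xi> y) + (LBINT y=0..x. fst \<zeta> y))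
      - ((LBINT y=0..ereal 0. fst \<xi> y) + (LBINT y=0..ereal 0. fst \<zeta> y))"
    by (rule LBINT_eq_primitive[where F="\<lambda>x. (LBINT y=0..ereal x. fst \<xi> y) + (LBINT y=0..ereal x. fst \<zeta> y)"])
       (intro DERIV_add DERIV_LBINT continuous_intros smooth_continuous_on dual_vecsD assms)+
  then show "profile (dv_add \<xi> \<zeta>) x = profile \<xi> x + profile \<zeta> x"
    by (simp add: profile_def dv_add_def)
qed

lemma profile_scale:
  assumes "\<xi> \<in> dual_vecs"
  shows "profile (dv_scale c \<xi>) = (\<lambda>x. c * profile \<xi> x)"
proof
  fix x :: real
  have "(LBINT y=0..x. c * fst \<xi> y) = c * (LBINT y=0..x. fst \<xi> y) - c * (LBINT y=0..ereal 0. fst \<xi> y)"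
    by (rule LBINT_eq_primitive[where F="\<lambda>x. c * (LBINT y=0..ereal x. fst \<xi> y)"])
       (intro DERIV_cmult DERIV_LBINT continuous_intros smooth_continuous_on dual_vecsD assms)+
  then show "profile (dv_scale c \<xi>) x = c * profile \<xi> x"
    by (simp add: profile_def dv_scale_def algebra_simps)
qed

lemma dv_add_in: "\<xi> \<in> dual_vecs \<Longrightarrow> \<zeta> \<in> dual_vecs \<Longrightarrow> dv_add \<xi> \<zeta> \<in> dual_vecs"
  by (auto simp: dual_vecs_def dv_add_def even_fun_def intro: test_funs_add)

lemma dv_scale_in: "\<xi> \<in> dual_vecs \<Longrightarrow> dv_scale c \<xi> \<in> dual_vecs"
  by (auto simp: dual_vecs_def dv_scale_def even_fun_def intro: test_funs_cmult)

section \<open>The dual norm is the norm of the profile\<close>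

text \<open>d'Alembert's solution: its profile at time \<open>t\<close> is the translate of \<open>h\<close> by \<open>T - t\<close>, so that
  \<open>\<xi>\<^sub>1(x,t)\<close> is the even part of \<open>x \<mapsto> h(x + T - t)\<close> and \<open>\<xi>\<^sub>0(x,t)\<close> the even part of its derivative.\<close>

lemma adjoint_solution_exists:
  assumes \<xi>: "\<xi> \<in> dual_vecs"
  shows "adjoint_solution T \<xi> (\<lambda>t. dual_vec_of (\<lambda>x. profile \<xi> (x + (T - t))))"
proof -
  define h where "h = profile \<xi>"
  have h: "h \<in> profiles" unfolding h_def by (rule profile_in_profiles[OF \<xi>])
  note sm = profiles_smooth[OF h]
  note D = smooth_DERIV[OF sm]
  note D' = smooth_DERIV[OF smooth_deriv[OF sm]]
  have shift: "deriv (\<lambda>x. h (x + s)) = (\<lambda>x. deriv h (x + s))" for s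
    by (intro ext DERIV_imp_deriv) (use D DERIV_shift in blast)
  have X0: "fst (dual_vec_of (\<lambda>x. h (x + s))) =
        (\<lambda>x. (1/2) * deriv h (1 * x + s) + (1/2) * deriv h ((-1) * x + s))"
    and X1: "snd (dual_vec_of (\<lambda>x. h (x + s))) =
        (\<lambda>x. (1/2) * h (1 * x + s) + (1/2) * h ((-1) * x + s))" for s
    by (auto simp: dual_vec_of_def shift field_simps)
  have derivs: "(deriv ^^ n) (\<lambda>x. (1/2) * k (1 * x + s) + (1/2) * k ((-1) * x + s)) =
      (\<lambda>x. (1/2) * 1 ^ n * (deriv ^^ n) k (1 * x + s) + (1/2) * (-1) ^ n * (deriv ^^ n) k ((-1) * x + s))"
    if "smooth k" for k n s
    using deriv_add_n[OF smooth_affine[OF that, of "1/2" 1 s] smooth_affine[OF that, of "1/2" "-1" s], of n]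
    unfolding deriv_affine_n[OF that, of n "1/2" 1 s] deriv_affine_n[OF that, of n "1/2" "-1" s] .
  have cont: "continuous_on S (\<lambda>(t, x). (1/2) * 1 ^ n * (deriv ^^ n) k (1 * x + (T - t))
        + (1/2) * (-1) ^ n * (deriv ^^ n) k ((-1) * x + (T - t)))"
    if "smooth k" for k n and S :: "(real \<times> real) set"
    unfolding case_prod_beta
    by (intro continuous_intros continuous_on_compose2[OF smooth_continuous_on[OF smooth_deriv_n[OF that]]]) auto
  show ?thesis
    unfolding adjoint_solution_def h_def[symmetric]
  proof (intro conjI ballI allI)
    show "dual_vec_of (\<lambda>x. h (x + (T - t))) \<in> dual_vecs" for t
      by (intro dual_vec_of_in profiles_shift h)
    show "continuous_on ({0..T} \<times> UNIV) (\<lambda>(t, x). (deriv ^^ k) (fst (dual_vec_of (\<lambda>x. h (x + (T - t))))) x)" for k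
      unfolding X0 derivs[OF smooth_deriv[OF sm]] by (rule cont[OF smooth_deriv[OF sm]])
    show "continuous_on ({0..T} \<times> UNIV) (\<lambda>(t, x). (deriv ^^ k) (snd (dual_vec_of (\<lambda>x. h (x + (T - t))))) x)" for k
      unfolding X1 derivs[OF sm] by (rule cont[OF sm])
    show "dual_vec_of (\<lambda>x. h (x + (T - T))) = \<xi>"
      using dual_vec_of_profile[OF \<xi>] by (simp add: h_def)
    fix t x
    have 2: "deriv (deriv (snd (dual_vec_of (\<lambda>x. h (x + (T - t)))))) x =
        (1/2) * deriv (deriv h) (x + (T - t)) + (1/2) * deriv (deriv h) (- x + (T - t))"
      using fun_cong[OF derivs[OF sm, of 2 "T - t"]] unfolding X1 by (simp add: numeral_2_eq_2)
    show "((\<lambda>s. fst (dual_vec_of (\<lambda>x. h (x + (T - s)))) x) has_real_derivative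
       - deriv (deriv (snd (dual_vec_of (\<lambda>x. h (x + (T - t)))))) x) (at t within {0..T})"
      unfolding 2 X0
      by (rule has_field_derivative_at_within)
         (auto intro!: derivative_eq_intros DERIV_chain'[OF _ D'])
    show "((\<lambda>s. snd (dual_vec_of (\<lambda>x. h (x + (T - s)))) x) has_real_derivative
       - fst (dual_vec_of (\<lambda>x. h (x + (T - t)))) x) (at t within {0..T})"
      unfolding X0 X1
      by (rule has_field_derivative_at_within)
         (auto intro!: derivative_eq_intros DERIV_chain'[OF _ D])
  qed
qed

text \<open>Let \<open>w(t,x)\<close> be the profile of the solution at time \<open>t\<close>. Integrating
  \<open>\<partial>\<xi>\<^sub>0/\<partial>t = - \<Delta>\<xi>\<^sub>1\<close> over \<open>[0,x]\<close>, where the boundary term at \<open>0\<close> vanishes because \<open>\<xi>\<^sub>1\<close> is even, shows that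
  \<open>w\<close> solves the transport equation \<open>\<partial>w/\<partial>t = - \<partial>w/\<partial>x\<close>; hence it is constant on the
  characteristic from \<open>(t\<^sub>0, 0)\<close> to \<open>(T, T - t\<^sub>0)\<close>. This gives uniqueness at once with the formula.\<close>

lemma adjoint_solution_at_0:
  assumes X: "adjoint_solution T \<xi> X" and "\<xi> \<in> dual_vecs" and t0: "t0 \<in> {0..T}"
  shows "snd (X t0) 0 = profile \<xi> (T - t0)"
proof -
  have vec: "X t \<in> dual_vecs" if "t \<in> {0..T}" for t
    using X that by (auto simp: adjoint_solution_def)
  have c0: "continuous_on ({0..T} \<times> UNIV) (\<lambda>(t, x). (deriv ^^ k) (fst (X t)) x)"
    and c1: "continuous_on ({0..T} \<times> UNIV) (\<lambda>(t, x). (deriv ^^ k) (snd (X t)) x)" for k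
    using X by (auto simp: adjoint_solution_def)
  have d0: "((\<lambda>s. fst (X s) x) has_real_derivative - deriv (deriv (snd (X t))) x) (at t within {0..T})"
    and d1: "((\<lambda>s. snd (X s) x) has_real_derivative - fst (X t) x) (at t within {0..T})"
    if "t \<in> {0..T}" for t x
    using X that by (auto simp: adjoint_solution_def)
  define w where "w t x = profile (X t) x" for t x
  define wx where "wx t x = deriv (snd (X t)) x + fst (X t) x" for t x
  have w_x: "(w t has_real_derivative wx t x) (at x)" if "t \<in> {0..T}" for t x
    unfolding w_def wx_def using profile_DERIV[OF vec[OF that]] .
  have "continuous_on ({0..T} \<times> UNIV) (\<lambda>z. wx (fst z) (snd z))"
    unfolding wx_def using c0[of 0] c1[of 1]
    by (intro continuous_on_add) (simp_all add: case_prod_beta)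
  then have wx_cont: "continuous_on ({0..T} \<times> UNIV) (\<lambda>(t, x). wx t x)"
    by (simp add: case_prod_beta)
  have w_t: "((\<lambda>s. w s x) has_real_derivative - wx t x) (at t within {0..T})"
    if t: "t \<in> {0..T}" and x: "x \<ge> 0" for t x
  proof -
    have LB: "(LBINT y=0..x. fst (X s) y) = integral (cbox 0 x) (fst (X s))" if "s \<in> {0..T}" for s
    proof -
      have "(fst (X s) has_integral (LBINT y=0..x. fst (X s) y) - (LBINT y=0..ereal 0. fst (X s) y)) {0..x}"
        using x by (intro fundamental_theorem_of_calculus)
          (auto simp flip: has_real_derivative_iff_has_vector_derivative
            intro!: has_field_derivative_at_within DERIV_LBINT smooth_continuous_on dual_vecsD(5)[OF vec[OF that]])
      then show ?thesis by (simp add: integral_unique)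
    qed
    have "((\<lambda>s. integral (cbox 0 x) (fst (X s))) has_real_derivative
        integral (cbox 0 x) (\<lambda>y. - deriv (deriv (snd (X t))) y)) (at t within {0..T})"
    proof (rule leibniz_rule_field_derivative)
      show "(fst (X s)) integrable_on cbox 0 x" if "s \<in> {0..T}" for s
        by (intro integrable_continuous smooth_continuous_on dual_vecsD(5) vec that)
      show "continuous_on ({0..T} \<times> cbox 0 x) (\<lambda>(s, y). - deriv (deriv (snd (X s))) y)"
        using continuous_on_minus[OF continuous_on_subset[OF c1[of 2], of "{0..T} \<times> cbox 0 x"]]
        by (auto simp: case_prod_beta numeral_2_eq_2)
    qed (use t d0 in auto)
    moreover have "integral (cbox 0 x) (\<lambda>y. - deriv (deriv (snd (X t))) y) = - deriv (snd (X t)) x"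
    proof -
      have "((\<lambda>y. - deriv (deriv (snd (X t))) y) has_integral (- deriv (snd (X t)) x) - (- deriv (snd (X t)) 0)) {0..x}"
        using x by (intro fundamental_theorem_of_calculus)
          (auto simp flip: has_real_derivative_iff_has_vector_derivative
            intro!: has_field_derivative_at_within DERIV_minus smooth_DERIV smooth_deriv dual_vecsD(6)[OF vec[OF t]])
      moreover have "deriv (snd (X t)) 0 = 0"
        using deriv_even[of "snd (X t)" 0] dual_vecsD[OF vec[OF t]] by simp
      ultimately show ?thesis by - (rule integral_unique, simp)
    qed
    ultimately have "((\<lambda>s. snd (X s) x + integral (cbox 0 x) (fst (X s))) has_real_derivative
        - fst (X t) x + - deriv (snd (X t)) x) (at t within {0..T})"
      by (intro DERIV_add d1[OF t]) simp
    then show ?thesis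
      by (rule has_field_derivative_transform_within[OF _ zero_less_one t, THEN DERIV_cong])
         (auto simp: w_def profile_def LB wx_def)
  qed
  have "((\<lambda>t. w t (t - t0)) has_derivative (\<lambda>_. 0)) (at t within {t0..T})" if t: "t \<in> {t0..T}" for t
  proof -
    have tT: "t \<in> {0..T}" using t t0 by auto
    have "((\<lambda>(s, y). w s y) has_derivative (\<lambda>(ts, ty). (- wx t (t - t0)) * ts + blinfun_scaleR_left (wx t (t - t0)) ty))
        (at (t, t - t0) within {0..T} \<times> {0..})"
    proof (rule has_derivative_partialsI[where fx="\<lambda>ts. (- wx t (t - t0)) * ts"
          and fy="\<lambda>s y. blinfun_scaleR_left (wx s y)"])
      show "((\<lambda>s. w s (t - t0)) has_derivative (*) (- wx t (t - t0))) (at t within {0..T})"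
        using w_t[OF tT, of "t - t0"] t by (simp add: has_field_derivative_def)
      show "(w s has_derivative blinfun_apply (blinfun_scaleR_left (wx s y))) (at y within {0..})"
        if "s \<in> {0..T}" for s y
      proof -
        have "blinfun_apply (blinfun_scaleR_left (wx s y)) = (*) (wx s y)"
          by (auto simp: fun_eq_iff)
        then show ?thesis
          using has_field_derivative_at_within[OF w_x[OF that]] by (simp only: has_field_derivative_def)
      qed
      have "continuous (at (t, t - t0) within {0..T} \<times> {0..}) (\<lambda>(t, x). wx t x)"
        using continuous_on_subset[OF wx_cont, of "{0..T} \<times> {0..}", OF Sigma_mono[OF order_refl subset_UNIV]] tT t
        by (auto simp: continuous_on_eq_continuous_within)
      then show "continuous (at (t, t - t0) within {0..T} \<times> {0..}) (\<lambda>(s, y). blinfun_scaleR_left (wx s y))"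
        unfolding case_prod_beta by (intro continuous_intros)
    qed (use t in auto)
    then have 1: "((\<lambda>(s, y). w s y) has_derivative (\<lambda>(ts, ty). (- wx t (t - t0)) * ts + blinfun_scaleR_left (wx t (t - t0)) ty))
        (at (t, t - t0) within (\<lambda>t. (t, t - t0)) ` {t0..T})"
      by (rule has_derivative_subset) (use t0 in auto)
    have 2: "((\<lambda>t. (t, t - t0)) has_derivative (\<lambda>d. (d, d))) (at t within {t0..T})"
      by (auto intro!: derivative_eq_intros)
    show ?thesis
      using has_derivative_in_compose[OF 2 1] by (simp add: algebra_simps)
  qed
  then obtain c where "\<And>t. t \<in> {t0..T} \<Longrightarrow> w t (t - t0) = c"
    using has_derivative_zero_constant[of "{t0..T}" "\<lambda>t. w t (t - t0)"] by auto
  then have "w t0 0 = w T (T - t0)"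
    using t0 by (metis atLeastAtMost_iff diff_self order_refl)
  moreover have "X T = \<xi>" using X by (simp add: adjoint_solution_def)
  ultimately show ?thesis
    by (simp add: w_def profile_0)
qed

lemma LINT_reflect_Icc:
  fixes g :: "real \<Rightarrow> real"
  shows "(LINT t:{0..T}|lborel. g (T - t)) = (LINT t:{0..T}|lborel. g t)"
  unfolding set_lebesgue_integral_def
  using lborel_integral_real_affine[of "-1" "\<lambda>t. indicator {0..T} t *\<^sub>R g t" T]
  by (auto simp: indicator_def intro!: Bochner_Integration.integral_cong)

theorem dual_norm_eq:
  assumes "\<xi> \<in> dual_vecs"
  shows "dual_norm T \<xi> = (LINT t:{0..T}|lborel. \<bar>profile \<xi> t\<bar>)"
  unfolding dual_norm_def
proof (rule the_equality)
  have eq: "(LINT t:{0..T}|lborel. \<bar>snd (X t) 0\<bar>) = (LINT t:{0..T}|lborel. \<bar>profile \<xi> t\<bar>)"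
    if "adjoint_solution T \<xi> X" for X
  proof -
    have "(LINT t:{0..T}|lborel. \<bar>snd (X t) 0\<bar>) = (LINT t:{0..T}|lborel. \<bar>profile \<xi> (T - t)\<bar>)"
      using adjoint_solution_at_0[OF that assms]
      by (intro set_lebesgue_integral_cong) auto
    then show ?thesis using LINT_reflect_Icc[of T "\<lambda>t. \<bar>profile \<xi> t\<bar>"] by simp
  qed
  then show "\<exists>X. adjoint_solution T \<xi> X \<and>
      (LINT t:{0..T}|lborel. \<bar>profile \<xi> t\<bar>) = (LINT t:{0..T}|lborel. \<bar>snd (X t) 0\<bar>)"
    using adjoint_solution_exists[OF assms] by metis
  show "r = (LINT t:{0..T}|lborel. \<bar>profile \<xi> t\<bar>)"
    if "\<exists>X. adjoint_solution T \<xi> X \<and> r = (LINT t:{0..T}|lborel. \<bar>snd (X t) 0\<bar>)" for r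
    using that eq by blast
qed

section \<open>Comparing integrals over different intervals\<close>

definition L1_Icc :: "real \<Rightarrow> real \<Rightarrow> (real \<Rightarrow> real) \<Rightarrow> real" where
  "L1_Icc a b h = (LINT t:{a..b}|lborel. \<bar>h t\<bar>)"

lemma profiles_continuous: "h \<in> profiles \<Longrightarrow> continuous_on S h"
  by (intro smooth_continuous_on profiles_smooth)

lemma continuous_set_integrable:
  fixes f :: "real \<Rightarrow> real"
  assumes "continuous_on UNIV f"
  shows "set_integrable lborel {a..b} f"
  by (intro borel_integrable_atLeastAtMost' continuous_on_subset[OF assms]) auto

lemma continuous_set_integrable_abs:
  fixes f :: "real \<Rightarrow> real"
  assumes "continuous_on UNIV f"
  shows "set_integrable lborel {a..b} (\<lambda>x. \<bar>f x\<bar>)"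
  by (intro continuous_set_integrable continuous_intros assms)

lemma L1_Icc_nonneg: "0 \<le> L1_Icc a b h"
  unfolding L1_Icc_def set_lebesgue_integral_def
  by (intro integral_nonneg_AE) auto

lemma L1_Icc_add_integrable:
  assumes "set_integrable lborel {a..b} h" "set_integrable lborel {a..b} k"
  shows "L1_Icc a b (\<lambda>x. h x + k x) \<le> L1_Icc a b h + L1_Icc a b k"
proof -
  note h = set_integrable_abs[OF assms(1)] and k = set_integrable_abs[OF assms(2)]
  have "L1_Icc a b (\<lambda>x. h x + k x) \<le> (LINT t:{a..b}|lborel. \<bar>h t\<bar> + \<bar>k t\<bar>)"
    unfolding L1_Icc_def
    by (intro set_integral_mono set_integral_add set_integrable_abs assms) auto
  also have "\<dots> = L1_Icc a b h + L1_Icc a b k"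
    unfolding L1_Icc_def by (intro set_integral_add h k)
  finally show ?thesis .
qed

lemma L1_Icc_add:
  assumes "continuous_on UNIV h" "continuous_on UNIV k"
  shows "L1_Icc a b (\<lambda>x. h x + k x) \<le> L1_Icc a b h + L1_Icc a b k"
  by (intro L1_Icc_add_integrable continuous_set_integrable assms)

lemma L1_Icc_cmult: "L1_Icc a b (\<lambda>x. c * h x) = \<bar>c\<bar> * L1_Icc a b h"
  unfolding L1_Icc_def by (simp add: abs_mult)

lemma LINT_shift_Icc:
  fixes g :: "real \<Rightarrow> real"
  shows "(LINT t:{a..b}|lborel. g (t + d)) = (LINT t:{a+d..b+d}|lborel. g t)"
  unfolding set_lebesgue_integral_def
  using lborel_integral_real_affine[of "1" "\<lambda>t. indicator {a+d..b+d} t *\<^sub>R g t" d]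
  by (auto simp: indicator_def add.commute intro!: Bochner_Integration.integral_cong)

lemma LINT_reflect:
  fixes g :: "real \<Rightarrow> real"
  shows "(LINT t:{-a..a}|lborel. g (- t)) = (LINT t:{-a..a}|lborel. g t)"
  unfolding set_lebesgue_integral_def
  using lborel_integral_real_affine[of "-1" "\<lambda>t. indicator {-a..a} t *\<^sub>R g t" 0]
  by (auto simp: indicator_def intro!: Bochner_Integration.integral_cong)

lemma LINT_const_Icc: "a \<le> b \<Longrightarrow> (LINT t:{a..b}|lborel. c) = (b - a) * (c::real)"
  by (simp add: set_integral_const)

lemma L1_Icc_mono_set:
  assumes "continuous_on UNIV h" "{a..b} \<subseteq> {c..d}"
  shows "L1_Icc a b h \<le> L1_Icc c d h"
  unfolding L1_Icc_def set_lebesgue_integral_def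
  by (intro integral_mono)
     (use assms(2) continuous_set_integrable_abs[OF assms(1)] in \<open>auto simp: indicator_def set_integrable_def\<close>)

lemma profiles_period_int: "h \<in> profiles \<Longrightarrow> h (x + 2 * pi * of_int k) = h x + of_int k * slope h"
  by (rule quasiperiodic_shift) (rule profiles_period)

text \<open>On \<open>[a, b - 2\<pi>]\<close> the slope is the difference of two values of \<open>h\<close> in \<open>[a,b]\<close>. This is the only
  point in the comparison of the norms where the length has to exceed \<open>2\<pi>\<close>.\<close>

lemma slope_le_L1_Icc:
  assumes h: "h \<in> profiles" and ab: "b - a > 2 * pi"
  shows "(b - a - 2 * pi) * \<bar>slope h\<bar> \<le> 2 * L1_Icc a b h"
proof -
  note ch = profiles_continuous[OF h]
  have csh: "continuous_on UNIV (\<lambda>t. h (t + 2 * pi))"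
    by (intro profiles_continuous profiles_shift h)
  have "(b - a - 2 * pi) * \<bar>slope h\<bar> = (LINT t:{a..b - 2 * pi}|lborel. \<bar>slope h\<bar>)"
    using ab by (subst LINT_const_Icc) (auto simp: algebra_simps)
  also have "\<dots> \<le> (LINT t:{a..b - 2 * pi}|lborel. \<bar>h (t + 2 * pi)\<bar> + \<bar>h t\<bar>)"
    by (intro set_integral_mono continuous_set_integrable continuous_intros ch csh)
       (auto simp: profiles_period[OF h])
  also have "\<dots> = L1_Icc a (b - 2 * pi) (\<lambda>t. h (t + 2 * pi)) + L1_Icc a (b - 2 * pi) h"
    unfolding L1_Icc_def
    by (intro set_integral_add continuous_set_integrable_abs ch csh)
  also have "L1_Icc a (b - 2 * pi) (\<lambda>t. h (t + 2 * pi)) = L1_Icc (a + 2 * pi) b h"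
    unfolding L1_Icc_def using LINT_shift_Icc[of a "b - 2 * pi" "\<lambda>t. \<bar>h t\<bar>" "2 * pi"] by simp
  also have "L1_Icc (a + 2 * pi) b h \<le> L1_Icc a b h"
    by (intro L1_Icc_mono_set ch) auto
  also have "L1_Icc a (b - 2 * pi) h \<le> L1_Icc a b h"
    by (intro L1_Icc_mono_set ch) auto
  finally show ?thesis by simp
qed

lemma L1_Icc_translate:
  assumes h: "h \<in> profiles" and ab: "a \<le> b"
  shows "L1_Icc (a + 2 * pi * of_int k) (b + 2 * pi * of_int k) h
    \<le> L1_Icc a b h + (b - a) * \<bar>of_int k\<bar> * \<bar>slope h\<bar>"
proof -
  have "L1_Icc (a + 2 * pi * of_int k) (b + 2 * pi * of_int k) h = L1_Icc a b (\<lambda>t. h t + of_int k * slope h)"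
    unfolding L1_Icc_def LINT_shift_Icc[symmetric] profiles_period_int[OF h] ..
  also have "\<dots> \<le> L1_Icc a b h + L1_Icc a b (\<lambda>_. of_int k * slope h)"
    by (intro L1_Icc_add continuous_intros profiles_continuous h)
  also have "L1_Icc a b (\<lambda>_. of_int k * slope h) = (b - a) * \<bar>of_int k\<bar> * \<bar>slope h\<bar>"
    unfolding L1_Icc_def LINT_const_Icc[OF ab] by (simp add: abs_mult)
  finally show ?thesis .
qed

text \<open>Finitely many translates of \<open>[a,b]\<close> by multiples of \<open>2\<pi>\<close> cover \<open>[c,d]\<close>.\<close>

lemma L1_Icc_compare_slope:
  assumes ab: "b - a \<ge> 2 * pi"
  obtains C where "C > 0" "\<And>h. h \<in> profiles \<Longrightarrow> L1_Icc c d h \<le> C * (L1_Icc a b h + \<bar>slope h\<bar>)"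
proof -
  define N where "N = {\<lfloor>(c - a) / (2 * pi)\<rfloor>..\<lfloor>(d - a) / (2 * pi)\<rfloor>}"
  define B where "B k = 1 + (b - a) * \<bar>real_of_int k\<bar>" for k
  have "a \<le> b" using ab pi_gt_zero by linarith
  then have Bpos: "B k > 0" for k
    using ab unfolding B_def by (intro add_pos_nonneg mult_nonneg_nonneg) auto
  have "L1_Icc c d h \<le> (1 + (\<Sum>k\<in>N. B k)) * (L1_Icc a b h + \<bar>slope h\<bar>)" if h: "h \<in> profiles" for h
  proof -
    note ch = profiles_continuous[OF h]
    define J where "J k = {a + 2 * pi * of_int k..b + 2 * pi * real_of_int k}" for k
    have int: "integrable lborel (\<lambda>t. indicator (J k) t * \<bar>h t\<bar>)" for k
      using continuous_set_integrable_abs[OF ch] by (simp add: set_integrable_def J_def)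
    have "L1_Icc c d h \<le> (LINT t|lborel. (\<Sum>k\<in>N. indicator (J k) t * \<bar>h t\<bar>))"
      unfolding L1_Icc_def set_lebesgue_integral_def
    proof (intro integral_mono)
      show "integrable lborel (\<lambda>t. \<Sum>k\<in>N. indicator (J k) t * \<bar>h t\<bar>)"
        by (intro Bochner_Integration.integrable_sum int)
      fix t
      show "indicator {c..d} t *\<^sub>R \<bar>h t\<bar> \<le> (\<Sum>k\<in>N. indicator (J k) t * \<bar>h t\<bar>)"
      proof (cases "t \<in> {c..d}")
        case True
        define k where "k = \<lfloor>(t - a) / (2 * pi)\<rfloor>"
        have "k \<in> N"
          using True unfolding k_def N_def by (auto intro!: floor_mono divide_right_mono)
        have "t \<in> J k"
          using floor_divide_lower[of "2*pi" "t - a"] floor_divide_upper[of "2*pi" "t - a"] ab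
          by (auto simp: J_def k_def algebra_simps)
        then have "indicator {c..d} t *\<^sub>R \<bar>h t\<bar> = indicator (J k) t * \<bar>h t\<bar>"
          using True by simp
        also have "\<dots> \<le> (\<Sum>k\<in>N. indicator (J k) t * \<bar>h t\<bar>)"
          by (rule member_le_sum[of k N "\<lambda>k. indicator (J k) t * \<bar>h t\<bar>"])
             (use \<open>k \<in> N\<close> in \<open>auto simp: N_def\<close>)
        finally show ?thesis .
      qed (auto intro!: sum_nonneg)
    qed (use continuous_set_integrable_abs[OF ch] in \<open>simp add: set_integrable_def\<close>)
    also have "\<dots> = (\<Sum>k\<in>N. L1_Icc (a + 2 * pi * of_int k) (b + 2 * pi * of_int k) h)"
      by (subst Bochner_Integration.integral_sum) (use int in \<open>auto simp: L1_Icc_def set_lebesgue_integral_def J_def\<close>)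
    also have "\<dots> \<le> (\<Sum>k\<in>N. B k * (L1_Icc a b h + \<bar>slope h\<bar>))"
    proof (intro sum_mono)
      fix k
      have "L1_Icc (a + 2 * pi * of_int k) (b + 2 * pi * of_int k) h
          \<le> L1_Icc a b h + (b - a) * \<bar>of_int k\<bar> * \<bar>slope h\<bar>"
        using \<open>a \<le> b\<close> by (intro L1_Icc_translate h)
      also have "\<dots> \<le> L1_Icc a b h + (b - a) * \<bar>of_int k\<bar> * \<bar>slope h\<bar>
          + (\<bar>slope h\<bar> + (b - a) * \<bar>of_int k\<bar> * L1_Icc a b h)"
        using \<open>a \<le> b\<close> L1_Icc_nonneg[of a b h] by simp
      also have "\<dots> = B k * (L1_Icc a b h + \<bar>slope h\<bar>)"
        unfolding B_def by (simp add: algebra_simps)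
      finally show "L1_Icc (a + 2 * pi * of_int k) (b + 2 * pi * of_int k) h \<le> B k * (L1_Icc a b h + \<bar>slope h\<bar>)" .
    qed
    also have "\<dots> = (\<Sum>k\<in>N. B k) * (L1_Icc a b h + \<bar>slope h\<bar>)"
      by (rule sum_distrib_right[symmetric])
    also have "\<dots> \<le> (1 + (\<Sum>k\<in>N. B k)) * (L1_Icc a b h + \<bar>slope h\<bar>)"
      by (intro mult_right_mono) (auto simp: L1_Icc_nonneg)
    finally show ?thesis .
  qed
  moreover have "1 + (\<Sum>k\<in>N. B k) > 0"
    using sum_nonneg[of N B] Bpos by (simp add: add_pos_nonneg less_imp_le)
  ultimately show ?thesis using that by blast
qed

lemma L1_Icc_compare:
  assumes ab: "b - a > 2 * pi"
  obtains C where "C > 0" "\<And>h. h \<in> profiles \<Longrightarrow> L1_Icc c d h \<le> C * L1_Icc a b h"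
proof -
  obtain C where C: "C > 0" "\<And>h. h \<in> profiles \<Longrightarrow> L1_Icc c d h \<le> C * (L1_Icc a b h + \<bar>slope h\<bar>)"
    using L1_Icc_compare_slope[where a=a and b=b and c=c and d=d] ab by auto
  define D where "D = 2 / (b - a - 2 * pi)"
  have "D > 0" using ab by (simp add: D_def)
  have "L1_Icc c d h \<le> (C * (1 + D)) * L1_Icc a b h" if h: "h \<in> profiles" for h
  proof -
    have "\<bar>slope h\<bar> \<le> D * L1_Icc a b h"
      using slope_le_L1_Icc[OF h ab] ab by (simp add: D_def field_simps)
    then have "C * (L1_Icc a b h + \<bar>slope h\<bar>) \<le> C * (L1_Icc a b h + D * L1_Icc a b h)"
      using C(1) by simp
    then show ?thesis using C(2)[OF h] by (simp add: algebra_simps)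
  qed
  then show ?thesis using that[of "C * (1 + D)"] C(1) \<open>D > 0\<close> by simp
qed

lemma L1_Icc_eq_0D:
  assumes h: "continuous_on UNIV h" and "a < b" "L1_Icc a b h = 0" "x \<in> {a..b}"
  shows "h x = 0"
proof -
  have int: "set_integrable lborel {a..b} (\<lambda>x. \<bar>h x\<bar>)"
    by (rule continuous_set_integrable_abs[OF h])
  have "((\<lambda>x. \<bar>h x\<bar>) has_integral 0) (cbox a b)"
    using set_borel_integral_eq_integral[OF int] assms(3)
    by (simp add: L1_Icc_def has_integral_integrable_integral)
  then have "\<bar>h x\<bar> = 0"
    using assms by (intro has_integral_0_cbox_imp_0[of a b "\<lambda>x. \<bar>h x\<bar>"])
      (auto intro!: continuous_intros intro: continuous_on_subset)
  then show ?thesis by simp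
qed

lemma L1_Icc_profile_eq_0:
  assumes \<xi>: "\<xi> \<in> dual_vecs" and "b - a > 2 * pi" "L1_Icc a b (profile \<xi>) = 0"
  shows "\<xi> = ((\<lambda>_. 0), (\<lambda>_. 0))"
proof -
  note h = profile_in_profiles[OF \<xi>]
  have z: "profile \<xi> x = 0" for x
  proof -
    obtain C where "L1_Icc (x - 1) (x + 1) (profile \<xi>) \<le> C * L1_Icc a b (profile \<xi>)"
      using L1_Icc_compare[OF assms(2)] h by metis
    then have "L1_Icc (x - 1) (x + 1) (profile \<xi>) = 0"
      using L1_Icc_nonneg[of "x - 1" "x + 1" "profile \<xi>"] assms(3) by simp
    then show ?thesis
      by (intro L1_Icc_eq_0D[of "profile \<xi>" "x - 1" "x + 1"] profiles_continuous h) auto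
  qed
  then have "profile \<xi> = (\<lambda>_. 0)" by auto
  then show ?thesis
    using dual_vec_of_profile[OF \<xi>] by (simp add: dual_vec_of_def)
qed

lemma profile_zero [simp]: "profile ((\<lambda>_. 0), (\<lambda>_. 0)) = (\<lambda>_. 0)"
  by (simp add: profile_def)

lemma L1_Icc_zero [simp]: "L1_Icc a b (\<lambda>_. 0) = 0"
  by (simp add: L1_Icc_def)

lemma dual_norm_L1: "\<xi> \<in> dual_vecs \<Longrightarrow> dual_norm T \<xi> = L1_Icc 0 T (profile \<xi>)"
  by (simp add: dual_norm_eq L1_Icc_def)

lemma norm_dual_norm:
  assumes "T > 2 * pi"
  shows "norm_on_dual_vecs (dual_norm T)"
  unfolding norm_on_dual_vecs_def
proof (intro conjI ballI allI)
  fix \<xi> c assume \<xi>: "\<xi> \<in> dual_vecs"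
  show "0 \<le> dual_norm T \<xi>"
    by (simp add: dual_norm_L1 \<xi> L1_Icc_nonneg)
  show "dual_norm T \<xi> = 0 \<longleftrightarrow> \<xi> = ((\<lambda>_. 0), (\<lambda>_. 0))"
    using L1_Icc_profile_eq_0[OF \<xi>, of T 0] assms \<xi> by (auto simp: dual_norm_L1)
  show "dual_norm T (dv_scale c \<xi>) = \<bar>c\<bar> * dual_norm T \<xi>"
    by (simp add: dual_norm_L1 \<xi> dv_scale_in profile_scale L1_Icc_cmult)
  fix \<zeta> assume \<zeta>: "\<zeta> \<in> dual_vecs"
  show "dual_norm T (dv_add \<xi> \<zeta>) \<le> dual_norm T \<xi> + dual_norm T \<zeta>"
    by (simp add: dual_norm_L1 \<xi> \<zeta> dv_add_in profile_add)
       (intro L1_Icc_add profiles_continuous profile_in_profiles \<xi> \<zeta>)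
qed

definition odd_part :: "dual_vec \<Rightarrow> real \<Rightarrow> real" where
  "odd_part \<xi> t = (LBINT x=0..t. fst \<xi> x)"

lemma sobolev_L1: "sobolev_norm T \<xi> = L1_Icc (-(T/2)) (T/2) (snd \<xi>) + L1_Icc (-(T/2)) (T/2) (odd_part \<xi>)"
  by (simp add: sobolev_norm_def L1_norm_sym_def L1_Icc_def odd_part_def)

lemma profile_odd_part: "profile \<xi> = (\<lambda>x. snd \<xi> x + odd_part \<xi> x)"
  by (simp add: profile_def odd_part_def)

lemma odd_part_continuous: "\<xi> \<in> dual_vecs \<Longrightarrow> continuous_on S (odd_part \<xi>)"
  unfolding odd_part_def
  by (rule DERIV_continuous_on[OF has_field_derivative_at_within[OF DERIV_LBINT]])
     (intro smooth_continuous_on dual_vecsD)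

lemma snd_continuous: "\<xi> \<in> dual_vecs \<Longrightarrow> continuous_on S (snd \<xi>)"
  by (intro smooth_continuous_on dual_vecsD)

text \<open>Serves for the even and for the odd part \<open>k\<close> of \<open>h\<close>.\<close>

lemma L1_reflect_mean:
  assumes h: "continuous_on UNIV h" and le: "\<And>x. \<bar>k x\<bar> \<le> (\<bar>h x\<bar> + \<bar>h (- x)\<bar>) / 2" and k: "continuous_on UNIV k"
  shows "L1_Icc (-a) a k \<le> L1_Icc (-a) a h"
proof -
  have hr: "continuous_on UNIV (\<lambda>x. h (- x))"
    by (intro continuous_on_compose2[OF h] continuous_intros) auto
  have "L1_Icc (-a) a k \<le> (LINT x:{-a..a}|lborel. (\<bar>h x\<bar> + \<bar>h (- x)\<bar>) / 2)"
    unfolding L1_Icc_def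
    by (intro set_integral_mono continuous_set_integrable continuous_intros h k hr le) auto
  also have "\<dots> = ((LINT x:{-a..a}|lborel. \<bar>h x\<bar>) + (LINT x:{-a..a}|lborel. \<bar>h (- x)\<bar>)) / 2"
    using set_integral_add(2)[OF continuous_set_integrable_abs[OF h] continuous_set_integrable_abs[OF hr]]
    by simp
  also have "(LINT x:{-a..a}|lborel. \<bar>h (- x)\<bar>) = (LINT x:{-a..a}|lborel. \<bar>h x\<bar>)"
    by (rule LINT_reflect[of a "\<lambda>x. \<bar>h x\<bar>"])
  finally show ?thesis by (simp add: L1_Icc_def)
qed

lemma sobolev_bounds:
  assumes \<xi>: "\<xi> \<in> dual_vecs"
  shows "L1_Icc (-(T/2)) (T/2) (profile \<xi>) \<le> sobolev_norm T \<xi>"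
    and "sobolev_norm T \<xi> \<le> 2 * L1_Icc (-(T/2)) (T/2) (profile \<xi>)"
proof -
  let ?I = "L1_Icc (-(T/2)) (T/2)"
  show "?I (profile \<xi>) \<le> sobolev_norm T \<xi>"
    unfolding profile_odd_part sobolev_L1
    by (intro L1_Icc_add snd_continuous odd_part_continuous \<xi>)
  have ch: "continuous_on UNIV (profile \<xi>)"
    by (intro profiles_continuous profile_in_profiles \<xi>)
  have "?I (snd \<xi>) \<le> ?I (profile \<xi>)"
    by (intro L1_reflect_mean ch snd_continuous \<xi>)
       (simp add: even_part_profile(1)[OF \<xi>, symmetric])
  moreover have "?I (odd_part \<xi>) \<le> ?I (profile \<xi>)"
    by (intro L1_reflect_mean ch odd_part_continuous \<xi>)
       (simp add: odd_part_def even_part_profile(2)[OF \<xi>, symmetric])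
  ultimately show "sobolev_norm T \<xi> \<le> 2 * ?I (profile \<xi>)"
    unfolding sobolev_L1 by simp
qed

lemma norm_sobolev_norm:
  assumes "T > 2 * pi"
  shows "norm_on_dual_vecs (sobolev_norm T)"
proof -
  let ?I = "L1_Icc (-(T/2)) (T/2)"
  have odd_add: "odd_part (dv_add \<xi> \<zeta>) = (\<lambda>x. odd_part \<xi> x + odd_part \<zeta> x)"
    if "\<xi> \<in> dual_vecs" "\<zeta> \<in> dual_vecs" for \<xi> \<zeta>
    using fun_cong[OF profile_add[OF that]] by (simp add: profile_odd_part dv_add_def fun_eq_iff)
  have odd_scale: "odd_part (dv_scale c \<xi>) = (\<lambda>x. c * odd_part \<xi> x)"
    if "\<xi> \<in> dual_vecs" for \<xi> c
    using fun_cong[OF profile_scale[OF that, of c]] by (simp add: profile_odd_part dv_scale_def fun_eq_iff distrib_left)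
  show ?thesis
    unfolding norm_on_dual_vecs_def
  proof (intro conjI ballI allI)
    fix \<xi> c assume \<xi>: "\<xi> \<in> dual_vecs"
    show "0 \<le> sobolev_norm T \<xi>"
      by (simp add: sobolev_L1 L1_Icc_nonneg add_nonneg_nonneg)
    show "sobolev_norm T \<xi> = 0 \<longleftrightarrow> \<xi> = ((\<lambda>_. 0), (\<lambda>_. 0))"
      using L1_Icc_profile_eq_0[OF \<xi>, of "T/2" "-(T/2)"] assms sobolev_bounds[OF \<xi>, of T]
        L1_Icc_nonneg[of "-(T/2)" "T/2" "profile \<xi>"] by auto
    show "sobolev_norm T (dv_scale c \<xi>) = \<bar>c\<bar> * sobolev_norm T \<xi>"
      unfolding sobolev_L1 odd_scale[OF \<xi>]
      by (simp add: dv_scale_def L1_Icc_cmult algebra_simps)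
    fix \<zeta> assume \<zeta>: "\<zeta> \<in> dual_vecs"
    have "?I (snd (dv_add \<xi> \<zeta>)) \<le> ?I (snd \<xi>) + ?I (snd \<zeta>)"
      unfolding dv_add_def snd_conv by (intro L1_Icc_add snd_continuous \<xi> \<zeta>)
    moreover have "?I (odd_part (dv_add \<xi> \<zeta>)) \<le> ?I (odd_part \<xi>) + ?I (odd_part \<zeta>)"
      unfolding odd_add[OF \<xi> \<zeta>] by (intro L1_Icc_add odd_part_continuous \<xi> \<zeta>)
    ultimately show "sobolev_norm T (dv_add \<xi> \<zeta>) \<le> sobolev_norm T \<xi> + sobolev_norm T \<zeta>"
      by (simp add: sobolev_L1)
  qed
qed

lemma equivalent_normsI:
  assumes "norm_on_dual_vecs p" "norm_on_dual_vecs q" "K > 0" "C > 0"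
    and "\<And>\<xi>. \<xi> \<in> dual_vecs \<Longrightarrow> q \<xi> \<le> K * p \<xi>"
    and "\<And>\<xi>. \<xi> \<in> dual_vecs \<Longrightarrow> p \<xi> \<le> C * q \<xi>"
  shows "equivalent_norms p q"
  unfolding equivalent_norms_def
  using assms by (intro conjI exI[of _ "1 / K"] exI[of _ C]) (auto simp: field_simps)

theorem dual_norm_equivalent_sobolev_norm:
  assumes T: "T > 2 * pi"
  shows "equivalent_norms (dual_norm T) (sobolev_norm T)"
proof -
  obtain C where C: "C > 0" "\<And>h. h \<in> profiles \<Longrightarrow> L1_Icc 0 T h \<le> C * L1_Icc (-(T/2)) (T/2) h"
    using L1_Icc_compare[where a="-(T/2)" and b="T/2" and c=0 and d=T] T by auto
  obtain K where K: "K > 0" "\<And>h. h \<in> profiles \<Longrightarrow> L1_Icc (-(T/2)) (T/2) h \<le> K * L1_Icc 0 T h"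
    using L1_Icc_compare[where a=0 and b=T and c="-(T/2)" and d="T/2"] T by auto
  show ?thesis
  proof (rule equivalent_normsI[OF norm_dual_norm[OF T] norm_sobolev_norm[OF T], of "2 * K" C])
    fix \<xi> assume \<xi>: "\<xi> \<in> dual_vecs"
    show "sobolev_norm T \<xi> \<le> 2 * K * dual_norm T \<xi>"
      using sobolev_bounds(2)[OF \<xi>, of T] K(2)[OF profile_in_profiles[OF \<xi>]] by (simp add: dual_norm_L1[OF \<xi>])
    have "dual_norm T \<xi> \<le> C * L1_Icc (-(T/2)) (T/2) (profile \<xi>)"
      using C(2)[OF profile_in_profiles[OF \<xi>]] by (simp add: dual_norm_L1[OF \<xi>])
    also have "\<dots> \<le> C * sobolev_norm T \<xi>"
      using sobolev_bounds(1)[OF \<xi>, of T] C(1) by simp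
    finally show "dual_norm T \<xi> \<le> C * sobolev_norm T \<xi>" .
  qed (use C K in auto)
qed

theorem dual_norms_equivalent:
  assumes T: "T > 2 * pi" and S: "S > 2 * pi"
  shows "equivalent_norms (dual_norm S) (dual_norm T)"
proof -
  obtain C where C: "C > 0" "\<And>h. h \<in> profiles \<Longrightarrow> L1_Icc 0 S h \<le> C * L1_Icc 0 T h"
    using L1_Icc_compare[where a=0 and b=T and c=0 and d=S] T by auto
  obtain K where K: "K > 0" "\<And>h. h \<in> profiles \<Longrightarrow> L1_Icc 0 T h \<le> K * L1_Icc 0 S h"
    using L1_Icc_compare[where a=0 and b=S and c=0 and d=T] S by auto
  show ?thesis
    by (rule equivalent_normsI[OF norm_dual_norm[OF S] norm_dual_norm[OF T], of K C])
       (use C K profile_in_profiles in \<open>auto simp: dual_norm_L1\<close>)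
qed

section \<open>Smooth approximation of indicator functions\<close>

text \<open>The algebra generated by \<open>sin(y - c)\<close>, \<open>cos(y - c)\<close> and the logistic function \<open>\<sigma>\<close> of
  \<open>n (cos(y - c) - k)\<close>. It is closed under differentiation because \<open>\<sigma>' = \<sigma> (1 - \<sigma>)\<close>.\<close>

inductive_set trig_logistic :: "real \<Rightarrow> real \<Rightarrow> real \<Rightarrow> (real \<Rightarrow> real) set" for n c k where
  const: "(\<lambda>_. a) \<in> trig_logistic n c k"
| sin: "(\<lambda>y. sin (y - c)) \<in> trig_logistic n c k"
| cos: "(\<lambda>y. cos (y - c)) \<in> trig_logistic n c k"
| logistic: "(\<lambda>y. 1 / (1 + exp (- (n * (cos (y - c) - k))))) \<in> trig_logistic n c k"
| add: "f \<in> trig_logistic n c k \<Longrightarrow> g \<in> trig_logistic n c k \<Longrightarrow> (\<lambda>y. f y + g y) \<in> trig_logistic n c k"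
| mult: "f \<in> trig_logistic n c k \<Longrightarrow> g \<in> trig_logistic n c k \<Longrightarrow> (\<lambda>y. f y * g y) \<in> trig_logistic n c k"

lemma trig_logistic_deriv:
  assumes "f \<in> trig_logistic n c k"
  shows "\<exists>g\<in>trig_logistic n c k. \<forall>x. (f has_real_derivative g x) (at x)"
  using assms
proof induction
  case (const a)
  show ?case
    by (rule bexI[OF _ trig_logistic.const[of 0]]) auto
next
  case sin
  show ?case
    by (rule bexI[OF _ trig_logistic.cos]) (auto intro!: derivative_eq_intros)
next
  case cos
  show ?case
    by (rule bexI[OF _ trig_logistic.mult[OF trig_logistic.const[of "-1"] trig_logistic.sin]])
       (auto intro!: derivative_eq_intros)
next
  case logistic
  let ?s = "\<lambda>y. 1 / (1 + exp (- (n * (cos (y - c) - k))))"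
  have nz: "1 + exp z \<noteq> 0" for z :: real
    using exp_gt_zero[of z] by linarith
  have m: "(\<lambda>y. - n * sin (y - c) * (?s y * (1 + (-1) * ?s y))) \<in> trig_logistic n c k"
    by (intro trig_logistic.intros)
  have d: "(?s has_real_derivative - n * sin (x - c) * (?s x * (1 + (-1) * ?s x))) (at x)" for x
    by (rule derivative_eq_intros refl nz)+ (simp add: nz field_simps power2_eq_square)
  show ?case by (rule bexI[OF _ m]) (intro allI d)
next
  case (add f g)
  then obtain f' g' where f': "f' \<in> trig_logistic n c k" "\<And>x. (f has_real_derivative f' x) (at x)"
    and g': "g' \<in> trig_logistic n c k" "\<And>x. (g has_real_derivative g' x) (at x)" by blast
  show ?case
    by (rule bexI[OF _ trig_logistic.add[OF f'(1) g'(1)]]) (intro allI DERIV_add f' g')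
next
  case (mult f g)
  then obtain f' g' where f': "f' \<in> trig_logistic n c k" "\<And>x. (f has_real_derivative f' x) (at x)"
    and g': "g' \<in> trig_logistic n c k" "\<And>x. (g has_real_derivative g' x) (at x)" by blast
  have m: "(\<lambda>x. f' x * g x + g' x * f x) \<in> trig_logistic n c k"
    by (intro trig_logistic.add trig_logistic.mult f' g' mult)
  show ?case
    by (rule bexI[OF _ m]) (intro allI DERIV_mult f' g')
qed

text \<open>A smooth approximation of the indicator of the arc \<open>\<bar>y - c\<bar> < d\<close> on the torus: on the arc
  \<open>cos(y - c) > cos d\<close>, off its closure the inequality is reversed.\<close>

definition arc_bump :: "real \<Rightarrow> real \<Rightarrow> nat \<Rightarrow> real \<Rightarrow> real" where
  "arc_bump c d n y = 1 / (1 + exp (- (real n * (cos (y - c) - cos d))))"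

lemma arc_bump_test_fun: "arc_bump c d n \<in> test_funs"
proof -
  have "smooth (arc_bump c d n)"
    unfolding arc_bump_def
    by (rule smooth_coinduct[OF trig_logistic.logistic trig_logistic_deriv])
  moreover have "cos (x + 2 * pi - c) = cos (x - c)" for x
    using cos_periodic[of "x - c"] by (simp add: algebra_simps)
  ultimately show ?thesis
    by (simp add: test_funs_def periodic_2pi_def arc_bump_def)
qed

lemma arc_bump_range: "0 \<le> arc_bump c d n y" "arc_bump c d n y \<le> 1"
  unfolding arc_bump_def by (auto simp: add_nonneg_nonneg) (subst divide_le_eq_1_pos, auto intro: add_pos_pos)

lemma arc_bump_tendsto_1:
  assumes "cos (y - c) > cos d"
  shows "(\<lambda>n. arc_bump c d n y) \<longlonglongrightarrow> 1"
proof -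
  have "(\<lambda>n. exp (- (real n * (cos (y - c) - cos d)))) \<longlonglongrightarrow> 0"
    using assms
    by (intro filterlim_compose[OF exp_at_bot] filterlim_uminus_at_bot_at_top[THEN filterlim_compose]
        filterlim_at_top_mult_tendsto_pos[OF tendsto_const _ filterlim_real_sequentially]) auto
  then have "(\<lambda>n. 1 / (1 + exp (- (real n * (cos (y - c) - cos d))))) \<longlonglongrightarrow> 1 / (1 + 0)"
    by (intro tendsto_intros) auto
  then show ?thesis by (simp add: arc_bump_def)
qed

lemma arc_bump_tendsto_0:
  assumes "cos (y - c) < cos d"
  shows "(\<lambda>n. arc_bump c d n y) \<longlonglongrightarrow> 0"
proof -
  have "LIM n sequentially. (real n * (cos d - cos (y - c))) :> at_top"
    using assms
    by (intro filterlim_at_top_mult_tendsto_pos[OF tendsto_const _ filterlim_real_sequentially]) auto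
  then have "LIM n sequentially. 1 + exp (real n * (cos d - cos (y - c))) :> at_top"
    by (intro filterlim_tendsto_add_at_top[OF tendsto_const] filterlim_compose[OF exp_at_top])
  then have "(\<lambda>n. 1 / (1 + exp (real n * (cos d - cos (y - c))))) \<longlonglongrightarrow> 0"
    by (intro tendsto_divide_0[OF tendsto_const] filterlim_at_top_imp_at_infinity)
  then show ?thesis by (simp add: arc_bump_def algebra_simps)
qed

lemma arc_bump_pointwise:
  assumes "- pi \<le> a" "a \<le> b" "b \<le> pi" and y: "- pi < y" "y < pi" "y \<noteq> a" "y \<noteq> b"
  shows "(\<lambda>n. arc_bump ((a + b) / 2) ((b - a) / 2) n y) \<longlonglongrightarrow> indicator {a<..b} y"
proof (cases "a < y \<and> y < b")
  case True
  then have "\<bar>y - (a + b) / 2\<bar> < (b - a) / 2" by (auto simp: abs_if field_simps)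
  then have "cos ((b - a) / 2) < cos \<bar>y - (a + b) / 2\<bar>"
    using assms by (intro cos_monotone_0_pi) auto
  then show ?thesis using True arc_bump_tendsto_1 by simp
next
  case False
  define u where "u = \<bar>y - (a + b) / 2\<bar>"
  have u: "(b - a) / 2 < u" "u < 2 * pi - (b - a) / 2"
    using False assms unfolding u_def by (auto simp: abs_if field_simps)
  have "cos u < cos ((b - a) / 2)"
  proof (cases "u \<le> pi")
    case True
    then show ?thesis using u assms by (intro cos_monotone_0_pi) auto
  next
    case False
    have "0 \<le> (b - a) / 2" "(b - a) / 2 < 2 * pi - u" "2 * pi - u \<le> pi"
      using assms(2) u(2) False by (simp, linarith, linarith)
    then have "cos (2 * pi - u) < cos ((b - a) / 2)"
      by (intro cos_monotone_0_pi)
    then show ?thesis by (simp add: cos_diff)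
  qed
  moreover have "cos u = cos (y - (a + b) / 2)" unfolding u_def by simp
  ultimately show ?thesis using False y arc_bump_tendsto_0 by (auto simp: indicator_def)
qed

lemma bounded_set_integrable:
  fixes u :: "real \<Rightarrow> real"
  assumes [measurable]: "u \<in> borel_measurable borel" and "\<And>x. \<bar>u x\<bar> \<le> M"
  shows "set_integrable lborel {a..b} u"
  unfolding set_integrable_def
  by (rule integrableI_bounded_set_indicator[where B=M])
     (use assms(2) in \<open>auto simp: emeasure_lborel_Icc_eq\<close>)

lemma arc_bump_L1:
  assumes "- pi \<le> a" "a \<le> b" "b \<le> pi"
  shows "(\<lambda>n. L1_Icc (-pi) pi (\<lambda>y. arc_bump ((a + b) / 2) ((b - a) / 2) n y - indicator {a<..b} y)) \<longlonglongrightarrow> 0"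
proof -
  let ?g = "\<lambda>n y. indicator {-pi..pi} y *\<^sub>R \<bar>arc_bump ((a + b) / 2) ((b - a) / 2) n y - indicator {a<..b} y\<bar>"
  have [measurable]: "arc_bump c d n \<in> borel_measurable borel" for c d n
    unfolding arc_bump_def by measurable
  have "(\<lambda>n. integral\<^sup>L lborel (?g n)) \<longlonglongrightarrow> integral\<^sup>L lborel (\<lambda>y::real. 0)"
  proof (rule integral_dominated_convergence[where w="\<lambda>y. indicator {-pi..pi} y *\<^sub>R 1"])
    show "integrable lborel (\<lambda>y. indicator {- pi..pi} y *\<^sub>R (1::real))"
      using bounded_set_integrable[of "\<lambda>_. 1" 1 "-pi" pi] by (simp add: set_integrable_def)
    show "AE y in lborel. (\<lambda>n. ?g n y) \<longlonglongrightarrow> 0"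
    proof -
      have "AE y in lborel. y \<notin> {-pi, pi, a, b}"
        by (intro AE_not_in) (simp add: countable_imp_null_set_lborel)
      then show ?thesis
      proof eventually_elim
        fix y assume y: "y \<notin> {-pi, pi, a, b}"
        show "(\<lambda>n. ?g n y) \<longlonglongrightarrow> 0"
        proof (cases "y \<in> {-pi..pi}")
          case True
          then have "(\<lambda>n. \<bar>arc_bump ((a + b) / 2) ((b - a) / 2) n y - indicator {a<..b} y\<bar>) \<longlonglongrightarrow> \<bar>indicator {a<..b} y - indicator {a<..b} y\<bar>"
            using y assms by (intro tendsto_intros arc_bump_pointwise) auto
          then show ?thesis using True by simp
        qed simp
      qed
    qed
    show "AE x in lborel. norm (?g n x) \<le> indicator {-pi..pi} x *\<^sub>R 1" for n
    proof (intro AE_I2)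
      fix x
      show "norm (?g n x) \<le> indicator {-pi..pi} x *\<^sub>R 1"
        using arc_bump_range[of "(a + b) / 2" "(b - a) / 2" n x] by (auto simp: indicator_def)
    qed
  qed auto
  then show ?thesis by (simp add: L1_Icc_def set_lebesgue_integral_def)
qed

lemma set_integrable_bounded_mult_integrable:
  fixes g k :: "real \<Rightarrow> real"
  assumes [measurable]: "g \<in> borel_measurable borel" and M: "\<And>x. \<bar>g x\<bar> \<le> M" and k: "set_integrable lborel {a..b} k"
  shows "set_integrable lborel {a..b} (\<lambda>x. g x * k x)"
  unfolding set_integrable_def
proof (rule Bochner_Integration.integrable_bound)
  show "integrable lborel (\<lambda>x. M * (indicator {a..b} x *\<^sub>R k x))"
    using k by (simp add: set_integrable_def)
  have "(\<lambda>x. g x * (indicator {a..b} x *\<^sub>R k x)) \<in> borel_measurable lborel"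
    using borel_measurable_integrable[OF k[unfolded set_integrable_def]] by measurable
  then show "(\<lambda>x. indicator {a..b} x *\<^sub>R (g x * k x)) \<in> borel_measurable lborel"
    by (simp add: mult.left_commute)
  show "AE x in lborel. norm (indicator {a..b} x *\<^sub>R (g x * k x)) \<le> norm (M * (indicator {a..b} x *\<^sub>R k x))"
    using M order_trans[OF M abs_ge_self] by (auto simp: abs_mult indicator_def intro!: mult_right_mono)
qed

lemma LINT_bounded_mult_integrable:
  fixes g k :: "real \<Rightarrow> real"
  assumes g: "g \<in> borel_measurable borel" and M: "\<And>x. \<bar>g x\<bar> \<le> M" and k: "set_integrable lborel {a..b} k"
  shows "\<bar>LINT x:{a..b}|lborel. g x * k x\<bar> \<le> M * L1_Icc a b k"
proof -
  have "\<bar>LINT x:{a..b}|lborel. g x * k x\<bar> \<le> (LINT x:{a..b}|lborel. \<bar>g x * k x\<bar>)"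
    unfolding set_lebesgue_integral_def
    using integral_abs_bound[of lborel "\<lambda>x. indicator {a..b} x *\<^sub>R (g x * k x)"]
    by (simp add: abs_mult)
  also have "\<dots> \<le> (LINT x:{a..b}|lborel. M * \<bar>k x\<bar>)"
    using M by (intro set_integral_mono set_integrable_abs set_integrable_mult_right
        set_integrable_bounded_mult_integrable[OF g M] k) (auto simp: abs_mult intro: mult_right_mono)
  finally show ?thesis by (simp add: L1_Icc_def)
qed

lemmas set_integrable_bounded_mult = set_integrable_bounded_mult_integrable[OF _ _ continuous_set_integrable]
lemmas LINT_bounded_mult = LINT_bounded_mult_integrable[OF _ _ continuous_set_integrable]

section \<open>Functionals bounded in the mean are bounded functions\<close>

text \<open>The dual of \<open>L\<^sub>1\<close> of the torus, for functionals known on test functions only.\<close>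

locale L1_bounded_functional =
  fixes f :: dist and K :: real
  assumes f_add: "\<phi> \<in> test_funs \<Longrightarrow> \<psi> \<in> test_funs \<Longrightarrow> f (\<lambda>x. \<phi> x + \<psi> x) = f \<phi> + f \<psi>"
    and f_scale: "\<phi> \<in> test_funs \<Longrightarrow> f (\<lambda>x. c * \<phi> x) = c * f \<phi>"
    and f_bound: "\<phi> \<in> test_funs \<Longrightarrow> \<bar>f \<phi>\<bar> \<le> K * L1_Icc (-pi) pi \<phi>"
    and K_pos: "K > 0"
begin

abbreviation N :: "(real \<Rightarrow> real) \<Rightarrow> real" where "N \<equiv> L1_Icc (-pi) pi"
abbreviation integ :: "(real \<Rightarrow> real) \<Rightarrow> bool" where "integ \<equiv> set_integrable lborel {-pi..pi}"

text \<open>The value of the continuous extension of \<open>f\<close> to \<open>L\<^sub>1\<close> at \<open>u\<close>, as a relation: its existence is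
  needed at step functions only.\<close>

definition extends :: "(real \<Rightarrow> real) \<Rightarrow> real \<Rightarrow> bool" where
  "extends u l \<longleftrightarrow> integ u \<and> (\<exists>\<theta>. (\<forall>n. \<theta> n \<in> test_funs) \<and>
     (\<lambda>n. N (\<lambda>x. \<theta> n x - u x)) \<longlonglongrightarrow> 0 \<and> (\<lambda>n. f (\<theta> n)) \<longlonglongrightarrow> l)"

lemma int_test: "\<phi> \<in> test_funs \<Longrightarrow> integ \<phi>"
  by (intro continuous_set_integrable smooth_continuous_on) (simp add: test_funs_def)

lemma f_diff: "\<phi> \<in> test_funs \<Longrightarrow> \<psi> \<in> test_funs \<Longrightarrow> f (\<lambda>x. \<phi> x - \<psi> x) = f \<phi> - f \<psi>"
  using f_add[of \<phi> "\<lambda>x. -1 * \<psi> x"] f_scale[of \<psi> "-1"] test_funs_cmult[of \<psi> "-1"] by simp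

lemma N_add: "integ u \<Longrightarrow> integ v \<Longrightarrow> N (\<lambda>x. u x + v x) \<le> N u + N v"
  by (rule L1_Icc_add_integrable)

lemma N_minus_commute: "N (\<lambda>x. u x - v x) = N (\<lambda>x. v x - u x)"
  by (simp add: L1_Icc_def abs_minus_commute)

lemma int_diff: "integ u \<Longrightarrow> integ v \<Longrightarrow> integ (\<lambda>x. u x - v x)"
  by (rule set_integral_diff)

lemma int_add: "integ u \<Longrightarrow> integ v \<Longrightarrow> integ (\<lambda>x. u x + v x)"
  by (rule set_integral_add)

lemma int_scale: "integ u \<Longrightarrow> integ (\<lambda>x. c * u x)"
  by (rule set_integrable_mult_right) simp

lemma extends_test: "\<phi> \<in> test_funs \<Longrightarrow> extends \<phi> (f \<phi>)"
  unfolding extends_def by (auto simp: int_test intro!: exI[of _ "\<lambda>_. \<phi>"])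

lemma extends_bound:
  assumes "extends u l"
  shows "\<bar>l\<bar> \<le> K * N u"
proof -
  obtain \<theta> where u: "integ u" and \<theta>: "\<And>n. \<theta> n \<in> test_funs"
    and lim: "(\<lambda>n. N (\<lambda>x. \<theta> n x - u x)) \<longlonglongrightarrow> 0" "(\<lambda>n. f (\<theta> n)) \<longlonglongrightarrow> l"
    using assms unfolding extends_def by blast
  have "\<bar>f (\<theta> n)\<bar> \<le> K * (N (\<lambda>x. \<theta> n x - u x) + N u)" for n
  proof -
    have "\<bar>f (\<theta> n)\<bar> \<le> K * N (\<theta> n)" by (rule f_bound[OF \<theta>])
    also have "N (\<theta> n) \<le> N (\<lambda>x. \<theta> n x - u x) + N u"
      using N_add[of "\<lambda>x. \<theta> n x - u x" u] u int_test[OF \<theta>] by (simp add: int_diff)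
    finally show ?thesis using K_pos by simp
  qed
  moreover have "(\<lambda>n. \<bar>f (\<theta> n)\<bar>) \<longlonglongrightarrow> \<bar>l\<bar>" by (intro tendsto_intros lim)
  moreover have "(\<lambda>n. K * (N (\<lambda>x. \<theta> n x - u x) + N u)) \<longlonglongrightarrow> K * (0 + N u)"
    by (intro tendsto_intros lim)
  ultimately have "\<bar>l\<bar> \<le> K * (0 + N u)"
    by (intro LIMSEQ_le) auto
  then show ?thesis by simp
qed

lemma extends_lin:
  assumes "extends u l" "extends v m"
  shows "extends (\<lambda>x. u x + c * v x) (l + c * m)"
proof -
  obtain \<theta> where u: "integ u" and \<theta>: "\<And>n. \<theta> n \<in> test_funs"
    and lim\<theta>: "(\<lambda>n. N (\<lambda>x. \<theta> n x - u x)) \<longlonglongrightarrow> 0" "(\<lambda>n. f (\<theta> n)) \<longlonglongrightarrow> l"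
    using assms unfolding extends_def by blast
  obtain \<eta> where v: "integ v" and \<eta>: "\<And>n. \<eta> n \<in> test_funs"
    and lim\<eta>: "(\<lambda>n. N (\<lambda>x. \<eta> n x - v x)) \<longlonglongrightarrow> 0" "(\<lambda>n. f (\<eta> n)) \<longlonglongrightarrow> m"
    using assms unfolding extends_def by blast
  let ?\<zeta> = "\<lambda>n x. \<theta> n x + c * \<eta> n x"
  have "(\<lambda>n. N (\<lambda>x. ?\<zeta> n x - (u x + c * v x))) \<longlonglongrightarrow> 0"
  proof (rule tendsto_sandwich[OF _ _ tendsto_const])
    show "\<forall>\<^sub>F n in sequentially. 0 \<le> N (\<lambda>x. ?\<zeta> n x - (u x + c * v x))"
      by (simp add: L1_Icc_nonneg)
    have "N (\<lambda>x. ?\<zeta> n x - (u x + c * v x)) \<le> N (\<lambda>x. \<theta> n x - u x) + \<bar>c\<bar> * N (\<lambda>x. \<eta> n x - v x)" for n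
    proof -
      have "N (\<lambda>x. ?\<zeta> n x - (u x + c * v x)) = N (\<lambda>x. (\<theta> n x - u x) + c * (\<eta> n x - v x))"
        by (simp add: algebra_simps)
      also have "\<dots> \<le> N (\<lambda>x. \<theta> n x - u x) + N (\<lambda>x. c * (\<eta> n x - v x))"
        by (intro N_add int_diff int_scale int_test \<theta> \<eta> u v)
      finally show ?thesis by (simp only: L1_Icc_cmult)
    qed
    then show "\<forall>\<^sub>F n in sequentially. N (\<lambda>x. ?\<zeta> n x - (u x + c * v x))
        \<le> N (\<lambda>x. \<theta> n x - u x) + \<bar>c\<bar> * N (\<lambda>x. \<eta> n x - v x)" by simp
    show "(\<lambda>n. N (\<lambda>x. \<theta> n x - u x) + \<bar>c\<bar> * N (\<lambda>x. \<eta> n x - v x)) \<longlonglongrightarrow> 0"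
      using tendsto_add[OF lim\<theta>(1) tendsto_mult_left[OF lim\<eta>(1), of "\<bar>c\<bar>"]] by simp
  qed
  moreover have "(\<lambda>n. f (?\<zeta> n)) \<longlonglongrightarrow> l + c * m"
    by (simp add: f_add f_scale test_funs_cmult \<theta> \<eta>) (intro tendsto_intros lim\<theta> lim\<eta>)
  moreover have "?\<zeta> n \<in> test_funs" for n
    by (intro test_funs_add test_funs_cmult \<theta> \<eta>)
  moreover have "integ (\<lambda>x. u x + c * v x)"
    by (intro int_add int_scale u v)
  ultimately show ?thesis
    unfolding extends_def by (intro conjI exI[of _ ?\<zeta>]) auto
qed

lemma extends_diff_bound:
  assumes "extends u l" "extends v m"
  shows "\<bar>l - m\<bar> \<le> K * N (\<lambda>x. u x - v x)"
  using extends_bound[OF extends_lin[OF assms, of "-1"]] by simp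

lemma extends_sum:
  assumes "\<And>i. i \<in> I \<Longrightarrow> extends (u i) (l i)" "finite I"
  shows "extends (\<lambda>x. \<Sum>i\<in>I. c i * u i x) (\<Sum>i\<in>I. c i * l i)"
  using assms(2,1)
proof (induction I)
  case empty
  have "extends (\<lambda>_. 0 * 0) (0 * f (\<lambda>_. 0))"
    using extends_test[OF test_funs_const[of 0]] f_scale[OF test_funs_const[of 0], of 0] by simp
  then show ?case by simp
next
  case (insert i I)
  then show ?case
    using extends_lin[of "\<lambda>x. \<Sum>i\<in>I. c i * u i x" "\<Sum>i\<in>I. c i * l i" "u i" "l i" "c i"]
    by (simp add: add.commute)
qed

lemma int_indicator: "integ (indicator {a<..b})"
  by (rule bounded_set_integrable[where M=1]) (auto simp: indicator_def)

lemma extends_indicator: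
  assumes "- pi \<le> a" "a \<le> b" "b \<le> pi"
  shows "\<exists>l. extends (indicator {a<..b}) l"
proof -
  define \<theta> where "\<theta> = arc_bump ((a + b) / 2) ((b - a) / 2)"
  have \<theta>: "\<theta> n \<in> test_funs" for n unfolding \<theta>_def by (rule arc_bump_test_fun)
  have lim: "(\<lambda>n. N (\<lambda>x. \<theta> n x - indicator {a<..b} x)) \<longlonglongrightarrow> 0"
    unfolding \<theta>_def by (rule arc_bump_L1[OF assms])
  have "Cauchy (\<lambda>n. f (\<theta> n))"
  proof (rule metric_CauchyI)
    fix e :: real assume e: "e > 0"
    define d where "d = e / (2 * K)"
    have "d > 0" using e K_pos by (simp add: d_def)
    then obtain M where M: "\<And>n. n \<ge> M \<Longrightarrow> N (\<lambda>x. \<theta> n x - indicator {a<..b} x) < d"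
      using order_tendstoD(2)[OF lim] unfolding eventually_sequentially by blast
    have "dist (f (\<theta> m)) (f (\<theta> n)) < e" if "m \<ge> M" "n \<ge> M" for m n
    proof -
      have "dist (f (\<theta> m)) (f (\<theta> n)) = \<bar>f (\<lambda>x. \<theta> m x - \<theta> n x)\<bar>"
        by (simp add: f_diff \<theta> dist_real_def)
      also have "\<dots> \<le> K * N (\<lambda>x. \<theta> m x - \<theta> n x)"
        by (intro f_bound test_funs_diff \<theta>)
      also have "N (\<lambda>x. \<theta> m x - \<theta> n x) \<le> N (\<lambda>x. \<theta> m x - indicator {a<..b} x) + N (\<lambda>x. indicator {a<..b} x - \<theta> n x)"
        using N_add[of "\<lambda>x. \<theta> m x - indicator {a<..b} x" "\<lambda>x. indicator {a<..b} x - \<theta> n x"]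
        by (simp add: int_diff int_test \<theta> int_indicator)
      also have "\<dots> < d + d"
        using M that N_minus_commute[of "indicator {a<..b}" "\<theta> n"] by (intro add_strict_mono) auto
      also have "K * (d + d) = e" using K_pos by (simp add: d_def)
      finally show ?thesis using K_pos by simp
    qed
    then show "\<exists>M. \<forall>m\<ge>M. \<forall>n\<ge>M. dist (f (\<theta> m)) (f (\<theta> n)) < e" by blast
  qed
  then obtain l where "(\<lambda>n. f (\<theta> n)) \<longlonglongrightarrow> l"
    by (meson Cauchy_convergent convergent_def)
  then show ?thesis
    unfolding extends_def using lim \<theta> int_indicator by blast
qed

text \<open>A primitive of the distribution \<open>f\<close> on \<open>[-\<pi>, \<pi>]\<close>.\<close>

definition primitive :: "real \<Rightarrow> real" where
  "primitive x = (SOME l. extends (indicator {-pi<..x}) l)"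

lemma extends_primitive:
  assumes "- pi \<le> x" "x \<le> pi"
  shows "extends (indicator {-pi<..x}) (primitive x)"
  unfolding primitive_def by (rule someI_ex[OF extends_indicator[OF order_refl assms]])

lemma extends_Ioc:
  assumes "- pi \<le> a" "a \<le> b" "b \<le> pi"
  shows "extends (indicator {a<..b}) (primitive b - primitive a)"
proof -
  have "extends (\<lambda>x. indicator {-pi<..b} x + (-1) * indicator {-pi<..a} x) (primitive b + (-1) * primitive a)"
    using assms by (intro extends_lin extends_primitive) auto
  moreover have "(\<lambda>x. indicator {-pi<..b} x + (-1) * indicator {-pi<..a} x) = (indicator {a<..b} :: real \<Rightarrow> real)"
    using assms by (auto simp: fun_eq_iff indicator_def)
  ultimately show ?thesis by simp
qed

lemma N_indicator:
  assumes "- pi \<le> a" "a \<le> b" "b \<le> pi"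
  shows "N (indicator {a<..b}) = b - a"
proof -
  have "N (indicator {a<..b}) = (LINT x|lborel. indicator {a<..b} x)"
    unfolding L1_Icc_def set_lebesgue_integral_def
  proof (rule Bochner_Integration.integral_cong[OF refl])
    fix x :: real
    show "indicator {-pi..pi} x *\<^sub>R \<bar>indicator {a<..b} x\<bar> = (indicator {a<..b} x :: real)"
      using assms by (cases "x \<in> {a<..b}") auto
  qed
  then show ?thesis using assms by simp
qed

lemma primitive_Lipschitz:
  assumes "- pi \<le> a" "a \<le> b" "b \<le> pi"
  shows "\<bar>primitive b - primitive a\<bar> \<le> K * (b - a)"
  using extends_bound[OF extends_Ioc[OF assms]] unfolding N_indicator[OF assms] .

end

text \<open>A function with slopes in \<open>[0,1]\<close> is the primitive of a function with values in \<open>[0,1]\<close>. The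
  Stieltjes measures of \<open>H\<close> and of \<open>x - H(x)\<close> add up to Lebesgue measure, which gives absolute
  continuity of both and, by uniqueness of densities, the bound on the density.\<close>

lemma interval_measure_density:
  fixes H :: "real \<Rightarrow> real"
  assumes mono: "\<And>x y. x \<le> y \<Longrightarrow> 0 \<le> H y - H x \<and> H y - H x \<le> y - x"
  shows "\<exists>q \<in> borel_measurable borel. (\<forall>x. 0 \<le> q x \<and> q x \<le> 1) \<and>
    (\<forall>a b. a \<le> b \<longrightarrow> (LINT x|lborel. indicator {a<..b} x * q x) = H b - H a)"
proof -
  define H' where "H' x = x - H x" for x
  have mH: "H x \<le> H y" and mH': "H' x \<le> H' y" if "x \<le> y" for x y
    using mono[OF that] by (auto simp: H'_def)
  have lip: "\<bar>H x - H y\<bar> \<le> \<bar>x - y\<bar>" for x y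
    using mono[of x y] mono[of y x] by (cases "x \<le> y") auto
  have "continuous_on UNIV H"
    by (rule lipschitz_on_continuous_on[OF lipschitz_onI[of _ _ 1]]) (use lip in \<open>auto simp: dist_real_def\<close>)
  then have cH: "continuous (at_right a) H" and cH': "continuous (at_right a) H'" for a
    unfolding H'_def
    by (auto intro!: continuous_intros simp: continuous_on_eq_continuous_at continuous_at_imp_continuous_at_within)
  define \<mu> where "\<mu> = interval_measure H"
  define \<mu>' where "\<mu>' = interval_measure H'"
  have [simp]: "sets \<mu> = sets borel" "sets \<mu>' = sets borel" "space \<mu> = UNIV" "space \<mu>' = UNIV"
    by (auto simp: \<mu>_def \<mu>'_def)
  have \<mu>: "emeasure \<mu> {a<..b} = H b - H a" and \<mu>': "emeasure \<mu>' {a<..b} = H' b - H' a" if "a \<le> b" for a b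
    unfolding \<mu>_def \<mu>'_def
    by (intro emeasure_interval_measure_Ioc[OF that] mH mH' cH cH'; assumption)+
  define \<nu> where "\<nu> = measure_of UNIV (sets borel) (\<lambda>A. emeasure \<mu> A + emeasure \<mu>' A)"
  have sets_\<nu>[simp]: "sets \<nu> = sets borel"
    unfolding \<nu>_def using sets.sigma_sets_eq[of borel] by (simp add: sets_measure_of)
  have \<nu>: "emeasure \<nu> A = emeasure \<mu> A + emeasure \<mu>' A" if "A \<in> sets borel" for A
  proof (rule emeasure_measure_of[OF \<nu>_def])
    show "countably_additive (sets \<nu>) (\<lambda>A. emeasure \<mu> A + emeasure \<mu>' A)"
    proof (rule countably_additiveI)
      fix A :: "nat \<Rightarrow> real set"
      assume A: "range A \<subseteq> sets \<nu>" "disjoint_family A"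
      show "(\<Sum>i. emeasure \<mu> (A i) + emeasure \<mu>' (A i)) = emeasure \<mu> (\<Union> (range A)) + emeasure \<mu>' (\<Union> (range A))"
        using suminf_emeasure[of A \<mu>] suminf_emeasure[of A \<mu>'] A by (simp add: suminf_add[symmetric])
    qed
  qed (use that in \<open>auto simp: positive_def\<close>)
  define E where "E = {{a<..b} |a b :: real. True}"
  have E: "sigma_sets UNIV E = sets borel"
  proof -
    have "E = range (\<lambda>(a, b). {a<..b})" by (auto simp: E_def image_def)
    then show ?thesis by (subst borel_sigma_sets_Ioc) simp
  qed
  have "\<nu> = lborel"
  proof (rule measure_eqI_generator_eq)
    show "Int_stable E"
    proof (rule Int_stableI)
      fix A B assume "A \<in> E" "B \<in> E"
      then obtain a b c d where AB: "A = {a<..b}" "B = {c<..d}" unfolding E_def by blast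
      show "A \<inter> B \<in> E" unfolding AB Int_greaterThanAtMost E_def by blast
    qed
    show "emeasure \<nu> X = emeasure lborel X" if "X \<in> E" for X
    proof -
      obtain a b where X: "X = {a<..b}" using \<open>X \<in> E\<close> unfolding E_def by blast
      show ?thesis
      proof (cases "a \<le> b")
        case True
        have "emeasure \<nu> X = ennreal (H b - H a) + ennreal (H' b - H' a)"
          unfolding X by (simp add: \<nu> \<mu> \<mu>' True)
        also have "\<dots> = ennreal (b - a)"
          using mH[OF True] mH'[OF True] by (subst ennreal_plus[symmetric]) (auto simp: H'_def)
        finally show ?thesis unfolding X using True by simp
      qed (simp add: X)
    qed
    show "range (\<lambda>n. {- real n<..real n}) \<subseteq> E" unfolding E_def by blast
    show "(\<Union>i. {- real i<..real i}) = UNIV"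
    proof -
      have "x \<in> (\<Union>i. {- real i<..real i})" for x :: real
      proof -
        obtain n :: nat where "\<bar>x\<bar> < real n" using reals_Archimedean2 by blast
        then have "x \<in> {- real n<..real n}" by auto
        then show ?thesis by blast
      qed
      then show ?thesis by blast
    qed
    show "emeasure \<nu> {- real i<..real i} \<noteq> \<infinity>" for i
      by (simp add: \<nu> \<mu> \<mu>')
  qed (simp_all add: E)
  then have sum: "emeasure lborel A = emeasure \<mu> A + emeasure \<mu>' A" if "A \<in> sets borel" for A
    using \<nu>[OF that] by simp
  then have "absolutely_continuous lborel \<mu>" "absolutely_continuous lborel \<mu>'"
    by (auto simp: absolutely_continuous_def null_sets_def)
  then obtain p p' where p: "p \<in> borel_measurable lborel" "density lborel p = \<mu>"
    and p': "p' \<in> borel_measurable lborel" "density lborel p' = \<mu>'"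
    using sigma_finite_measure.Radon_Nikodym[OF sigma_finite_lborel, of \<mu>]
      sigma_finite_measure.Radon_Nikodym[OF sigma_finite_lborel, of \<mu>'] by auto
  note [measurable] = p(1) p'(1)
  have "density lborel (\<lambda>x. p x + p' x) = density lborel (\<lambda>_. 1)"
  proof (rule measure_eqI)
    fix A assume "A \<in> sets (density lborel (\<lambda>x. p x + p' x))"
    then have A[measurable]: "A \<in> sets borel" by simp
    have "emeasure (density lborel (\<lambda>x. p x + p' x)) A = emeasure (density lborel p) A + emeasure (density lborel p') A"
      by (simp add: emeasure_density distrib_right nn_integral_add)
    also have "\<dots> = emeasure (density lborel (\<lambda>_. 1)) A"
      using sum[OF A] by (simp add: p p' emeasure_density)
    finally show "emeasure (density lborel (\<lambda>x. p x + p' x)) A = emeasure (density lborel (\<lambda>_. 1)) A" .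
  qed simp
  then have "AE x in lborel. p x + p' x = 1"
    using sigma_finite_measure.density_unique_iff[OF sigma_finite_lborel, of "\<lambda>x. p x + p' x" "\<lambda>_. 1"] by simp
  then have p1: "AE x in lborel. p x \<le> 1"
    by eventually_elim (metis add_increasing2 le_iff_add order_refl)
  define q where "q x = min 1 (enn2real (p x))" for x
  have [measurable]: "q \<in> borel_measurable borel" unfolding q_def by measurable
  have q01: "0 \<le> q x" "q x \<le> 1" for x by (auto simp: q_def)
  have qp: "AE x in lborel. ennreal (q x) = p x"
    using p1
  proof eventually_elim
    fix x assume "p x \<le> 1"
    then have "enn2real (p x) \<le> 1" "p x < top"
      by (auto simp: enn2real_leI le_less_trans[OF _ ennreal_one_less_top])
    then show "ennreal (q x) = p x" by (simp add: q_def)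
  qed
  have "(LINT x|lborel. indicator {a<..b} x * q x) = H b - H a" if "a \<le> b" for a b
  proof -
    have "(LINT x|lborel. indicator {a<..b} x * q x) = enn2real (\<integral>\<^sup>+x. ennreal (indicator {a<..b} x * q x) \<partial>lborel)"
      by (rule integral_eq_nn_integral) (auto simp: q01)
    also have "(\<integral>\<^sup>+x. ennreal (indicator {a<..b} x * q x) \<partial>lborel) = (\<integral>\<^sup>+x. p x * indicator {a<..b} x \<partial>lborel)"
      using qp by (intro nn_integral_cong_AE, eventually_elim) (auto simp: indicator_def)
    also have "\<dots> = emeasure \<mu> {a<..b}"
      unfolding p(2)[symmetric] by (simp add: emeasure_density)
    finally show ?thesis using \<mu>[OF that] mH[OF that] by simp
  qed
  then show ?thesis using q01 by (intro bexI[of _ q] conjI allI impI) simp_all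
qed

lemma test_funs_Lipschitz:
  assumes "\<phi> \<in> test_funs"
  obtains M where "M \<ge> 0" "\<And>x y. \<bar>\<phi> x - \<phi> y\<bar> \<le> M * \<bar>x - y\<bar>"
proof -
  obtain M where M: "M \<ge> 0" "\<And>x. \<bar>deriv \<phi> x\<bar> \<le> M"
    using test_funs_bounded[OF test_funs_deriv[OF assms]] by blast
  have "norm (\<phi> x - \<phi> y) \<le> M * norm (x - y)" for x y
    by (rule field_differentiable_bound[of UNIV \<phi> "deriv \<phi>"])
       (use M test_funs_DERIV[OF assms] in auto)
  then show ?thesis using that M by auto
qed

context L1_bounded_functional
begin

definition density_on :: "(real \<Rightarrow> real) \<Rightarrow> bool" where
  "density_on g \<longleftrightarrow> g \<in> borel_measurable borel \<and> (\<forall>x. \<bar>g x\<bar> \<le> K) \<and>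
     (\<forall>a b. - pi \<le> a \<longrightarrow> a \<le> b \<longrightarrow> b \<le> pi \<longrightarrow>
        (LINT x:{-pi..pi}|lborel. g x * indicator {a<..b} x) = primitive b - primitive a)"

lemma ex_density: "\<exists>g. density_on g"
proof -
  define cl where "cl x = max (-pi) (min pi x)" for x
  \<comment> \<open>The primitive is \<open>K\<close>-Lipschitz, so the slopes of \<open>H\<close> lie in \<open>[0,1]\<close>.\<close>
  define H where "H x = x / 2 + primitive (cl x) / (2 * K)" for x
  have mono: "0 \<le> H y - H x \<and> H y - H x \<le> y - x" if "x \<le> y" for x y
  proof -
    have "\<bar>primitive (cl y) - primitive (cl x)\<bar> \<le> K * (cl y - cl x)"
      using that pi_gt_zero by (intro primitive_Lipschitz) (auto simp: cl_def)
    also have "\<dots> \<le> K * (y - x)"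
      using K_pos that by (intro mult_left_mono) (auto simp: cl_def)
    finally have "\<bar>primitive (cl y) - primitive (cl x)\<bar> / (2 * K) \<le> (y - x) / 2"
      using K_pos by (simp add: field_simps)
    moreover define d where "d = (primitive (cl y) - primitive (cl x)) / (2 * K)"
    ultimately have "\<bar>d\<bar> \<le> (y - x) / 2"
      using K_pos by (simp only: d_def abs_divide abs_mult abs_numeral abs_of_pos)
    then have d: "d \<le> (y - x) / 2" "- d \<le> (y - x) / 2"
      by (simp_all only: abs_le_iff)
    have "H y - H x = (y - x) / 2 + d"
      by (simp add: H_def d_def diff_divide_distrib)
    then show ?thesis using d by (simp only:) (simp add: field_simps)
  qed
  obtain q where q[measurable]: "q \<in> borel_measurable borel" and q01: "\<And>x. 0 \<le> q x \<and> q x \<le> 1"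
    and qH: "\<And>a b. a \<le> b \<Longrightarrow> (LINT x|lborel. indicator {a<..b} x * q x) = H b - H a"
    using interval_measure_density[OF mono] by blast
  define g where "g x = K * (2 * q x - 1)" for x
  have [measurable]: "g \<in> borel_measurable borel" unfolding g_def by measurable
  have gK: "\<bar>g x\<bar> \<le> K" for x
  proof -
    have "\<bar>2 * q x - 1\<bar> \<le> 1" using q01[of x] by (auto simp: abs_le_iff)
    then show ?thesis using K_pos mult_left_mono[of "\<bar>2 * q x - 1\<bar>" 1 K] by (simp add: g_def abs_mult)
  qed
  have "(LINT x:{-pi..pi}|lborel. g x * indicator {a<..b} x) = primitive b - primitive a"
    if ab: "- pi \<le> a" "a \<le> b" "b \<le> pi" for a b
  proof -
    have "integrable lborel (\<lambda>x. indicator {a<..b} x * q x)"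
      using integrableI_bounded_set_indicator[of "{a<..b}" lborel q 1] q01 ab by simp
    moreover have "integrable lborel (indicator {a<..b} :: real \<Rightarrow> real)"
      using ab by simp
    ultimately have 1: "(LINT x|lborel. (2 * K) * (indicator {a<..b} x * q x) - K * indicator {a<..b} x)
        = 2 * K * (H b - H a) - K * (b - a)"
      using qH[OF ab(2)] ab by simp
    have 2: "2 * K * (H b - H a) - K * (b - a) = primitive b - primitive a"
      using ab K_pos by (simp add: H_def cl_def field_simps)
    have "(LINT x|lborel. (2 * K) * (indicator {a<..b} x * q x) - K * indicator {a<..b} x)
        = (LINT x:{-pi..pi}|lborel. g x * indicator {a<..b} x)"
      unfolding set_lebesgue_integral_def
    proof (rule Bochner_Integration.integral_cong[OF refl])
      fix x :: real
      show "(2 * K) * (indicator {a<..b} x * q x) - K * indicator {a<..b} x = indicator {-pi..pi} x *\<^sub>R (g x * indicator {a<..b} x)"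
        using ab by (cases "x \<in> {a<..b}") (auto simp: g_def algebra_simps)
    qed
    then show ?thesis using 1 2 by simp
  qed
  then show ?thesis unfolding density_on_def using gK by (intro exI[of _ g]) simp
qed

text \<open>A test function is approximated in \<open>L\<^sub>1\<close> by step functions on \<open>n\<close> equal intervals, with error
  \<open>O(1/n)\<close>; on step functions both sides agree and both are bounded in \<open>L\<^sub>1\<close>.\<close>

lemma density_represents:
  assumes g: "density_on g" and \<phi>: "\<phi> \<in> test_funs"
  shows "f \<phi> = (LINT x:{-pi..pi}|lborel. g x * \<phi> x)"
proof -
  define I where "I u = (LINT x:{-pi..pi}|lborel. g x * u x)" for u
  have g_meas: "g \<in> borel_measurable borel" and gK: "\<And>x. \<bar>g x\<bar> \<le> K"
    and g_Ioc: "\<And>a b. - pi \<le> a \<Longrightarrow> a \<le> b \<Longrightarrow> b \<le> pi \<Longrightarrow> I (indicator {a<..b}) = primitive b - primitive a"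
    using g unfolding density_on_def I_def by auto
  note int_g = set_integrable_bounded_mult_integrable[OF g_meas gK]
  have I_bound: "\<bar>I u\<bar> \<le> K * N u" if "integ u" for u
    unfolding I_def by (rule LINT_bounded_mult_integrable[OF g_meas gK that])
  obtain M where M: "M \<ge> 0" "\<And>x y. \<bar>\<phi> x - \<phi> y\<bar> \<le> M * \<bar>x - y\<bar>"
    using test_funs_Lipschitz[OF \<phi>] by blast
  have "\<bar>f \<phi> - I \<phi>\<bar> \<le> (8 * K * pi^2 * M) * inverse (real (Suc m))" for m
  proof -
    define n where "n = Suc m"
    define X where "X i = - pi + 2 * pi * real i / real n" for i
    define s where "s x = (\<Sum>i<n. \<phi> (X i) * indicator {X i<..X (Suc i)} x)" for x
    have X: "- pi \<le> X i" "X i \<le> X (Suc i)" "X (Suc i) \<le> pi" if "i < n" for i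
      using that by (auto simp: X_def n_def field_simps)
    have ext: "extends s (\<Sum>i<n. \<phi> (X i) * (primitive (X (Suc i)) - primitive (X i)))"
      unfolding s_def by (intro extends_sum extends_Ioc X) auto
    then have int_s: "integ s" by (simp add: extends_def)
    have int_d: "integ (\<lambda>x. \<phi> x - s x)" by (intro int_diff int_test \<phi> int_s)
    have "I s = (\<Sum>i<n. \<phi> (X i) * I (indicator {X i<..X (Suc i)}))"
    proof -
      have "I s = (LINT x|lborel. (\<Sum>i<n. \<phi> (X i) * (indicator {-pi..pi} x *\<^sub>R (g x * indicator {X i<..X (Suc i)} x))))"
        unfolding I_def s_def set_lebesgue_integral_def sum_distrib_left scaleR_sum_right
        by (intro Bochner_Integration.integral_cong sum.cong refl) (simp add: mult_ac)
      also have "\<dots> = (\<Sum>i<n. \<phi> (X i) * I (indicator {X i<..X (Suc i)}))"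
        using int_g[OF int_indicator]
        by (subst Bochner_Integration.integral_sum) (auto simp: I_def set_lebesgue_integral_def set_integrable_def)
      finally show ?thesis .
    qed
    then have "I s = (\<Sum>i<n. \<phi> (X i) * (primitive (X (Suc i)) - primitive (X i)))"
      using g_Ioc X by simp
    then have 1: "\<bar>f \<phi> - I s\<bar> \<le> K * N (\<lambda>x. \<phi> x - s x)"
      using extends_diff_bound[OF extends_test[OF \<phi>] ext] by simp
    have "I \<phi> - I s = I (\<lambda>x. \<phi> x - s x)"
      unfolding I_def using set_integral_diff(2)[OF int_g[OF int_test[OF \<phi>]] int_g[OF int_s]]
      by (simp add: right_diff_distrib)
    then have 2: "\<bar>I \<phi> - I s\<bar> \<le> K * N (\<lambda>x. \<phi> x - s x)"
      using I_bound[OF int_d] by simp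
    have pt: "\<bar>\<phi> x - s x\<bar> \<le> M * (2 * pi / n)" if x: "-pi < x" "x \<le> pi" for x
    proof -
      define y where "y = (x + pi) * real n / (2 * pi)"
      have in_iff: "x \<in> {X j<..X (Suc j)} \<longleftrightarrow> real j < y \<and> y \<le> real j + 1" for j
        by (auto simp: X_def y_def n_def field_simps)
      have y: "0 < y" "y \<le> real n" 
        using x mult_right_mono[of "x + pi" "2 * pi" "real n"]
        by (auto simp: y_def n_def divide_le_eq mult.commute)
      define i where "i = nat (\<lceil>y\<rceil> - 1)"
      have i: "real i < y" "y \<le> real i + 1" and "i < n"
        using y unfolding i_def by linarith+
      have ind: "indicator {X j<..X (Suc j)} x = (if j = i then 1 else 0 :: real)" for j
      proof -
        have "x \<in> {X j<..X (Suc j)} \<longleftrightarrow> j = i" unfolding in_iff using i by linarith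
        then show ?thesis by (auto simp: indicator_def)
      qed
      have "s x = \<phi> (X i)"
        unfolding s_def ind using \<open>i < n\<close> by (simp add: if_distrib sum.delta cong: if_cong)
      moreover have "\<bar>x - X i\<bar> \<le> 2 * pi / n"
      proof -
        have "x \<in> {X i<..X (Suc i)}" unfolding in_iff using i by simp
        moreover have "X (Suc i) = X i + 2 * pi / n" by (simp add: X_def add_divide_distrib distrib_left)
        ultimately show ?thesis by auto
      qed
      ultimately show ?thesis
        using M(2)[of x "X i"] M(1) by (metis mult_left_mono order_trans)
    qed
    have "N (\<lambda>x. \<phi> x - s x) \<le> (LINT x:{-pi..pi}|lborel. M * (2 * pi / n))"
      unfolding L1_Icc_def set_lebesgue_integral_def
    proof (rule integral_mono_AE)
      show "integrable lborel (\<lambda>x. indicator {-pi..pi} x *\<^sub>R \<bar>\<phi> x - s x\<bar>)"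
        using set_integrable_abs[OF int_d] by (simp add: set_integrable_def)
      show "integrable lborel (\<lambda>x. indicator {-pi..pi} x *\<^sub>R (M * (2 * pi / n)))"
        by simp
      show "AE x in lborel. indicator {-pi..pi} x *\<^sub>R \<bar>\<phi> x - s x\<bar> \<le> indicator {-pi..pi} x *\<^sub>R (M * (2 * pi / n))"
        using AE_lborel_singleton[of "-pi"]
      proof eventually_elim
        fix x :: real assume "x \<noteq> - pi"
        then show "indicator {-pi..pi} x *\<^sub>R \<bar>\<phi> x - s x\<bar> \<le> indicator {-pi..pi} x *\<^sub>R (M * (2 * pi / n))"
          using pt[of x] by (cases "x \<in> {-pi..pi}") auto
      qed
    qed
    also have "\<dots> = 4 * pi^2 * M * inverse (real n)"
      by (simp add: LINT_const_Icc field_simps power2_eq_square)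
    finally have "K * N (\<lambda>x. \<phi> x - s x) \<le> K * (4 * pi^2 * M * inverse (real n))"
      using K_pos by (intro mult_left_mono) auto
    then have "\<bar>f \<phi> - I \<phi>\<bar> \<le> 2 * (K * (4 * pi^2 * M * inverse (real n)))"
      using 1 2 by linarith
    then show ?thesis by (simp add: n_def algebra_simps)
  qed
  moreover have "(\<lambda>m. (8 * K * pi^2 * M) * inverse (real (Suc m))) \<longlonglongrightarrow> (8 * K * pi^2 * M) * 0"
    by (intro tendsto_mult tendsto_const LIMSEQ_inverse_real_of_nat)
  ultimately have "\<bar>f \<phi> - I \<phi>\<bar> \<le> 0"
    by (intro LIMSEQ_le[OF tendsto_const]) auto
  then show ?thesis by (simp add: I_def)
qed

theorem representation:
  "\<exists>g\<in>Linfty_torus. \<forall>\<phi>\<in>test_funs. f \<phi> = (LINT x:{-pi..pi}|lborel. g x * \<phi> x)"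
proof -
  obtain g0 where g0: "density_on g0" using ex_density by blast
  then have [measurable]: "g0 \<in> borel_measurable borel" and g0K: "\<And>x. \<bar>g0 x\<bar> \<le> K"
    unfolding density_on_def by auto
  \<comment> \<open>Periodic extension from \<open>(-\<pi>, \<pi>]\<close>; only the value at \<open>-\<pi>\<close> may change.\<close>
  define g where "g x = g0 (x - 2 * pi * of_int \<lceil>(x - pi) / (2 * pi)\<rceil>)" for x
  have [measurable]: "g \<in> borel_measurable borel" unfolding g_def by measurable
  have "g (x + 2 * pi) = g x" for x
  proof -
    have "(x + 2 * pi - pi) / (2 * pi) = (x - pi) / (2 * pi) + 1" by (simp add: field_simps)
    then have c: "\<lceil>(x + 2 * pi - pi) / (2 * pi)\<rceil> = \<lceil>(x - pi) / (2 * pi)\<rceil> + 1"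
      by (simp only: ceiling_add_one)
    show ?thesis unfolding g_def c by (simp add: distrib_left)
  qed
  then have "g \<in> Linfty_torus"
    using g0K by (auto simp: Linfty_torus_def periodic_2pi_def g_def)
  moreover have "f \<phi> = (LINT x:{-pi..pi}|lborel. g x * \<phi> x)" if \<phi>: "\<phi> \<in> test_funs" for \<phi>
  proof -
    have [measurable]: "\<phi> \<in> borel_measurable borel"
      using \<phi> by (intro borel_measurable_continuous_onI smooth_continuous_on) (simp add: test_funs_def)
    have "(LINT x:{-pi..pi}|lborel. g x * \<phi> x) = (LINT x:{-pi..pi}|lborel. g0 x * \<phi> x)"
      unfolding set_lebesgue_integral_def
    proof (rule integral_cong_AE)
      show "AE x in lborel. indicator {-pi..pi} x *\<^sub>R (g x * \<phi> x) = indicator {-pi..pi} x *\<^sub>R (g0 x * \<phi> x)"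
        using AE_lborel_singleton[of "-pi"]
      proof eventually_elim
        fix x :: real assume "x \<noteq> -pi"
        then have "\<lceil>(x - pi) / (2 * pi)\<rceil> = 0" if "x \<in> {-pi..pi}"
          using that by (intro ceiling_unique) (auto simp: field_simps)
        then show "indicator {-pi..pi} x *\<^sub>R (g x * \<phi> x) = indicator {-pi..pi} x *\<^sub>R (g0 x * \<phi> x)"
          by (cases "x \<in> {-pi..pi}") (auto simp: g_def)
      qed
    qed measurable
    then show ?thesis using density_represents[OF g0 \<phi>] by simp
  qed
  ultimately show ?thesis by blast
qed

end

lemma Linfty_distsI:
  assumes "f \<in> extensional test_funs"
    and "\<And>\<phi> \<psi>. \<phi> \<in> test_funs \<Longrightarrow> \<psi> \<in> test_funs \<Longrightarrow> f (\<lambda>x. \<phi> x + \<psi> x) = f \<phi> + f \<psi>"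
    and "\<And>\<phi> c. \<phi> \<in> test_funs \<Longrightarrow> f (\<lambda>x. c * \<phi> x) = c * f \<phi>"
    and bound: "\<And>\<phi>. \<phi> \<in> test_funs \<Longrightarrow> \<bar>f \<phi>\<bar> \<le> K * L1_Icc (-pi) pi \<phi>"
  shows "f \<in> Linfty_dists"
proof -
  interpret L1_bounded_functional f "max K 1"
  proof
    show "\<bar>f \<phi>\<bar> \<le> max K 1 * L1_Icc (-pi) pi \<phi>" if "\<phi> \<in> test_funs" for \<phi>
      using bound[OF that] mult_right_mono[OF max.cobounded1[of K 1] L1_Icc_nonneg[of "-pi" pi \<phi>]] by linarith
  qed (use assms in auto)
  obtain g where "g \<in> Linfty_torus" "\<And>\<phi>. \<phi> \<in> test_funs \<Longrightarrow> f \<phi> = (LINT x:{-pi..pi}|lborel. g x * \<phi> x)"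
    using representation by blast
  then have "f = dist_of_fun g"
    using assms(1) by (auto simp: dist_of_fun_def extensional_def fun_eq_iff restrict_def)
  then show ?thesis using \<open>g \<in> Linfty_torus\<close> by (auto simp: Linfty_dists_def)
qed

text \<open>A load must be bounded everywhere, not almost everywhere; hence the truncation.\<close>

lemma Linfty_dists_bounded_density:
  assumes "F \<in> Linfty_dists"
  obtains g K where "g \<in> borel_measurable borel" "periodic_2pi g" "\<And>x. \<bar>g x\<bar> \<le> K" "F = dist_of_fun g"
proof -
  obtain g0 K where F: "F = dist_of_fun g0" and [measurable]: "g0 \<in> borel_measurable borel"
    and per: "periodic_2pi g0" and K: "AE x in lborel. \<bar>g0 x\<bar> \<le> K"
    using assms by (auto simp: Linfty_dists_def Linfty_torus_def)
  define g where "g x = max (-K) (min K (g0 x))" for x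
  have g[measurable]: "g \<in> borel_measurable borel" unfolding g_def by measurable
  have "dist_of_fun g0 = dist_of_fun g"
    unfolding dist_of_fun_def set_lebesgue_integral_def
  proof (rule restrict_ext)
    fix \<phi> assume \<phi>: "\<phi> \<in> test_funs"
    then have [measurable]: "\<phi> \<in> borel_measurable borel"
      by (intro borel_measurable_continuous_onI smooth_continuous_on) (simp add: test_funs_def)
    show "(LINT x|lborel. indicator {-pi..pi} x *\<^sub>R (g0 x * \<phi> x)) = (LINT x|lborel. indicator {-pi..pi} x *\<^sub>R (g x * \<phi> x))"
    proof (rule integral_cong_AE)
      show "AE x in lborel. indicator {-pi..pi} x *\<^sub>R (g0 x * \<phi> x) = indicator {-pi..pi} x *\<^sub>R (g x * \<phi> x)"
        using K
      proof eventually_elim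
        fix x assume "\<bar>g0 x\<bar> \<le> K"
        then have "g x = g0 x" by (auto simp: g_def)
        then show "indicator {-pi..pi} x *\<^sub>R (g0 x * \<phi> x) = indicator {-pi..pi} x *\<^sub>R (g x * \<phi> x)" by simp
      qed
    qed measurable
  qed
  moreover have "\<bar>g x\<bar> \<le> \<bar>K\<bar>" for x by (auto simp: g_def)
  moreover have "periodic_2pi g" using per by (auto simp: periodic_2pi_def g_def)
  ultimately show ?thesis using that[of g "\<bar>K\<bar>"] F g by simp
qed

section \<open>The states with bounded density\<close>

lemma LINT_lin_right:
  fixes g k l :: "real \<Rightarrow> real"
  assumes g: "g \<in> borel_measurable borel" "\<And>x. \<bar>g x\<bar> \<le> M"
    and "continuous_on UNIV k" "continuous_on UNIV l"
  shows "(LINT x:{a..b}|lborel. g x * (p * k x + q * l x))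
    = p * (LINT x:{a..b}|lborel. g x * k x) + q * (LINT x:{a..b}|lborel. g x * l x)"
proof -
  have "set_integrable lborel {a..b} (\<lambda>x. p * (g x * k x))" "set_integrable lborel {a..b} (\<lambda>x. q * (g x * l x))"
    by (intro set_integrable_mult_right set_integrable_bounded_mult[OF g] assms(3,4))+
  from set_integral_add(2)[OF this] show ?thesis
    by (simp add: distrib_left mult.left_commute)
qed

lemma LINT_lin_left:
  fixes g g' k :: "real \<Rightarrow> real"
  assumes g: "g \<in> borel_measurable borel" "\<And>x. \<bar>g x\<bar> \<le> M"
    and g': "g' \<in> borel_measurable borel" "\<And>x. \<bar>g' x\<bar> \<le> M'" and k: "continuous_on UNIV k"
  shows "(LINT x:{a..b}|lborel. (p * g x + q * g' x) * k x)
    = p * (LINT x:{a..b}|lborel. g x * k x) + q * (LINT x:{a..b}|lborel. g' x * k x)"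
proof -
  have "set_integrable lborel {a..b} (\<lambda>x. p * (g x * k x))" "set_integrable lborel {a..b} (\<lambda>x. q * (g' x * k x))"
    by (intro set_integrable_mult_right set_integrable_bounded_mult[OF g k] set_integrable_bounded_mult[OF g' k])+
  from set_integral_add(2)[OF this] show ?thesis
    by (simp add: distrib_right mult.assoc)
qed

lemma torus_distsD:
  assumes "f \<in> torus_dists"
  shows "f \<in> extensional test_funs"
    and "\<phi> \<in> test_funs \<Longrightarrow> \<psi> \<in> test_funs \<Longrightarrow> f (\<lambda>x. \<phi> x + \<psi> x) = f \<phi> + f \<psi>"
    and "\<phi> \<in> test_funs \<Longrightarrow> f (\<lambda>x. c * \<phi> x) = c * f \<phi>"
  using assms by (auto simp: torus_dists_def)

lemma torus_dists_zero: "f \<in> torus_dists \<Longrightarrow> f (\<lambda>_. 0) = 0"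
  using torus_distsD(3)[OF _ test_funs_const[of 0], of f 0] by simp

lemma statesD:
  assumes "f \<in> states"
  shows "fst f \<in> torus_dists" "snd f \<in> torus_dists" "even_dist (fst f)" "even_dist (snd f)"
  using assms by (auto simp: states_def)

definition even_part :: "(real \<Rightarrow> real) \<Rightarrow> real \<Rightarrow> real" where
  "even_part \<phi> = (\<lambda>x. (\<phi> x + \<phi> (- x)) / 2)"

lemma even_part_test: "\<phi> \<in> test_funs \<Longrightarrow> even_part \<phi> \<in> test_funs"
  using test_funs_cmult[OF test_funs_add[OF _ test_funs_reflect], of \<phi> \<phi> "1/2"]
  by (simp add: even_part_def)

lemma even_part_even: "even_fun (even_part \<phi>)"
  by (simp add: even_fun_def even_part_def add.commute)

lemma even_part_id: "even_fun \<phi> \<Longrightarrow> even_part \<phi> = \<phi>"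
  by (simp add: even_fun_def even_part_def)

lemma even_dist_even_part:
  assumes "f \<in> torus_dists" "even_dist f" "\<phi> \<in> test_funs"
  shows "f (even_part \<phi>) = f \<phi>"
proof -
  have "f (\<lambda>x. (1/2) * (\<phi> x + \<phi> (- x))) = (1/2) * (f \<phi> + f (\<lambda>x. \<phi> (- x)))"
    using assms(3) torus_distsD(2)[OF assms(1,3) test_funs_reflect[OF assms(3)]]
      torus_distsD(3)[OF assms(1) test_funs_add[OF assms(3) test_funs_reflect[OF assms(3)]], of "1/2"]
    by simp
  then show ?thesis using assms(2,3) by (simp add: even_part_def even_dist_def)
qed

text \<open>Evenness of the state absorbs the symmetrisation in the construction of the dual vector.\<close>

lemma pairing_dual_vec_of_test:
  assumes f: "f \<in> states" and \<phi>: "\<phi> \<in> test_funs"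
  shows "pairing f (dual_vec_of \<phi>) = fst f (deriv \<phi>) + snd f \<phi>"
  using even_dist_even_part[OF statesD(1)[OF f] statesD(3)[OF f] test_funs_deriv[OF \<phi>]]
    even_dist_even_part[OF statesD(2)[OF f] statesD(4)[OF f] \<phi>]
  by (simp add: pairing_def dual_vec_of_def even_part_def)

lemma pairing_add:
  "f \<in> states \<Longrightarrow> \<xi> \<in> dual_vecs \<Longrightarrow> \<zeta> \<in> dual_vecs \<Longrightarrow> pairing f (dv_add \<xi> \<zeta>) = pairing f \<xi> + pairing f \<zeta>"
  by (simp add: pairing_def dv_add_def torus_distsD statesD dual_vecsD)

lemma pairing_scale:
  "f \<in> states \<Longrightarrow> \<xi> \<in> dual_vecs \<Longrightarrow> pairing f (dv_scale c \<xi>) = c * pairing f \<xi>"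
  by (simp add: pairing_def dv_scale_def torus_distsD statesD dual_vecsD algebra_simps)

lemma Linfty_states_subset: "f \<in> Linfty_states \<Longrightarrow> f \<in> states"
  by (auto simp: Linfty_states_def)

text \<open>The form that the pairing with a state of bounded density takes on profiles.\<close>

definition Phi :: "(real \<Rightarrow> real) \<Rightarrow> real \<Rightarrow> (real \<Rightarrow> real) \<Rightarrow> real" where
  "Phi v c h = (LINT x:{-pi..pi}|lborel. v x * h x) + c * slope h"

lemma Phi_bound:
  assumes v: "v \<in> borel_measurable borel" "\<And>x. \<bar>v x\<bar> \<le> M" and T: "T > 2 * pi"
  obtains K where "K \<ge> 0" "\<And>h. h \<in> profiles \<Longrightarrow> \<bar>Phi v c h\<bar> \<le> K * L1_Icc 0 T h"
proof -
  have M: "M \<ge> 0" using v(2)[of 0] by linarith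
  obtain C where C: "C > 0" "\<And>h. h \<in> profiles \<Longrightarrow> L1_Icc (-pi) pi h \<le> C * L1_Icc 0 T h"
    using L1_Icc_compare[where a=0 and b=T and c="-pi" and d=pi] T by auto
  define D where "D = 2 / (T - 2 * pi)"
  have "\<bar>Phi v c h\<bar> \<le> (M * C + \<bar>c\<bar> * D) * L1_Icc 0 T h" if h: "h \<in> profiles" for h
  proof -
    have "\<bar>LINT x:{-pi..pi}|lborel. v x * h x\<bar> \<le> M * L1_Icc (-pi) pi h"
      by (intro LINT_bounded_mult v profiles_continuous h)
    also have "\<dots> \<le> M * (C * L1_Icc 0 T h)"
      by (intro mult_left_mono C h M)
    finally have 1: "\<bar>LINT x:{-pi..pi}|lborel. v x * h x\<bar> \<le> M * (C * L1_Icc 0 T h)" .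
    have "\<bar>slope h\<bar> \<le> D * L1_Icc 0 T h"
      using slope_le_L1_Icc[OF h, of T 0] T by (simp add: D_def field_simps)
    then have 2: "\<bar>c * slope h\<bar> \<le> \<bar>c\<bar> * (D * L1_Icc 0 T h)"
      unfolding abs_mult by (rule mult_left_mono) simp
    show ?thesis
      unfolding Phi_def using order_trans[OF abs_triangle_ineq add_mono[OF 1 2]]
      by (simp add: distrib_right mult.assoc)
  qed
  moreover have "M * C + \<bar>c\<bar> * D \<ge> 0" using M C T by (simp add: D_def)
  ultimately show ?thesis by (rule that[rotated])
qed

text \<open>The function \<open>\<xi>\<^sub>0\<close> is its mean, which is the slope divided by \<open>2\<pi>\<close>, plus the derivative of a
  test function, the odd part of \<open>h\<close> made periodic; on the latter \<open>f\<^sub>0\<close> acts through \<open>f\<^sub>0'\<close>. Reflection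
  \<open>x \<mapsto> - x\<close> moves the formation of even and odd parts from \<open>h\<close> to the densities.\<close>

lemma pairing_profile_density:
  assumes f: "f \<in> Linfty_states"
  obtains v c M where "v \<in> borel_measurable borel" "periodic_2pi v" "\<And>x. \<bar>v x\<bar> \<le> M"
    "\<And>h. h \<in> profiles \<Longrightarrow> pairing f (dual_vec_of h) = Phi v c h"
proof -
  have fs: "f \<in> states" using f by (rule Linfty_states_subset)
  have "dist_deriv (fst f) \<in> Linfty_dists" "snd f \<in> Linfty_dists"
    using f by (auto simp: Linfty_states_def)
  obtain g0 K0 where g0m[measurable]: "g0 \<in> borel_measurable borel" and g0: "periodic_2pi g0" "\<And>x. \<bar>g0 x\<bar> \<le> K0"
    "dist_deriv (fst f) = dist_of_fun g0"
    using Linfty_dists_bounded_density \<open>dist_deriv (fst f) \<in> Linfty_dists\<close> by blast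
  obtain g1 K1 where g1m[measurable]: "g1 \<in> borel_measurable borel" and g1: "periodic_2pi g1" "\<And>x. \<bar>g1 x\<bar> \<le> K1"
    "snd f = dist_of_fun g1"
    using Linfty_dists_bounded_density \<open>snd f \<in> Linfty_dists\<close> by blast
  define v where "v x = (g1 x + g1 (- x)) / 2 - (g0 x - g0 (- x)) / 2" for x
  define c where "c = (fst f (\<lambda>_. 1) + (LINT x:{-pi..pi}|lborel. g0 x * x)) / (2 * pi)"
  have [measurable]: "v \<in> borel_measurable borel" unfolding v_def by measurable
  have refl_per: "g (- (x + 2 * pi)) = g (- x)" if "periodic_2pi g" for g :: "real \<Rightarrow> real" and x
    using periodic_2piD[OF that, of "- (x + 2 * pi)"] by simp
  have per: "periodic_2pi v"
    unfolding periodic_2pi_def v_def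
    using periodic_2piD[OF g0(1)] periodic_2piD[OF g1(1)] refl_per[OF g0(1)] refl_per[OF g1(1)] by metis
  have bound: "\<bar>v x\<bar> \<le> K1 + K0" for x
    unfolding v_def using g0(2)[of x] g0(2)[of "-x"] g1(2)[of x] g1(2)[of "-x"]
    by (auto simp: abs_le_iff field_simps)
  have rep: "pairing f (dual_vec_of h) = Phi v c h"
    if h: "h \<in> profiles" for h
  proof -
    note D = smooth_DERIV[OF profiles_smooth[OF h]]
    define m where "m = slope h / (2 * pi)"
    define \<theta> where "\<theta> x = (1/2) * (h x - h (- x)) - m * x" for x
    have "\<theta> (x + 2 * pi) = \<theta> x" for x
      unfolding \<theta>_def profiles_period[OF h] reflect_profiles[OF h]
      by (simp add: slope_def m_def field_simps)
    moreover have "smooth \<theta>"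
      unfolding \<theta>_def by (intro smooth_intros profiles_smooth[OF h])
    ultimately have \<theta>: "\<theta> \<in> test_funs" by (simp add: test_funs_def periodic_2pi_def)
    have "(\<theta> has_real_derivative fst (dual_vec_of h) x - m) (at x)" for x
      unfolding \<theta>_def dual_vec_of_def by (auto intro!: derivative_eq_intros DERIV_chain'[OF _ D] D)
    then have "deriv \<theta> = (\<lambda>x. fst (dual_vec_of h) x - m)"
      by (auto intro!: DERIV_imp_deriv)
    then have "fst (dual_vec_of h) = (\<lambda>x. deriv \<theta> x + m * 1)" by auto
    then have "fst f (fst (dual_vec_of h)) = fst f (deriv \<theta>) + m * fst f (\<lambda>_. 1)"
      using torus_distsD(2)[OF statesD(1)[OF fs] test_funs_deriv[OF \<theta>] test_funs_const[of m]]
        torus_distsD(3)[OF statesD(1)[OF fs] test_funs_const[of 1], of m] by simp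
    also have "fst f (deriv \<theta>) = - (LINT x:{-pi..pi}|lborel. g0 x * \<theta> x)"
      using fun_cong[OF g0(3), of \<theta>] \<theta> by (simp add: dist_deriv_def dist_of_fun_def)
    finally have 0: "fst f (fst (dual_vec_of h)) = - (LINT x:{-pi..pi}|lborel. g0 x * \<theta> x) + m * fst f (\<lambda>_. 1)" .
    have 1: "snd f (snd (dual_vec_of h)) = (LINT x:{-pi..pi}|lborel. g1 x * ((h x + h (- x)) / 2))"
      unfolding g1(3) using dual_vecsD(2)[OF dual_vec_of_in[OF h]] by (simp add: dist_of_fun_def dual_vec_of_def)
    have ch: "continuous_on UNIV h" by (rule profiles_continuous[OF h])
    have chr: "continuous_on UNIV (\<lambda>x. h (- x))"
      by (intro continuous_on_compose2[OF ch] continuous_intros) auto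
    have refl: "(LINT x:{-pi..pi}|lborel. g x * h (- x)) = (LINT x:{-pi..pi}|lborel. g (- x) * h x)" for g
      using LINT_reflect[of pi "\<lambda>x. g (- x) * h x"] by simp
    define J where "J g = (LINT x:{-pi..pi}|lborel. g x * h x)" for g
    have m0: "(\<lambda>x. g0 (- x)) \<in> borel_measurable borel" and m1: "(\<lambda>x. g1 (- x)) \<in> borel_measurable borel"
      by measurable
    have "(LINT x:{-pi..pi}|lborel. g0 x * (1 * ((1/2) * h x + (-1/2) * h (- x)) + (- m) * x))
        = 1 * ((1/2) * J g0 + (-1/2) * J (\<lambda>x. g0 (- x))) + (- m) * (LINT x:{-pi..pi}|lborel. g0 x * x)"
    proof -
      have "continuous_on UNIV (\<lambda>x. (1/2) * h x + (-1/2) * h (- x))"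
        by (intro continuous_intros ch chr)
      from LINT_lin_right[OF g0m g0(2) this continuous_on_id, of "-pi" pi 1 "- m"] show ?thesis
        unfolding J_def refl[symmetric] LINT_lin_right[OF g0m g0(2) ch chr] .
    qed
    then have 2: "(LINT x:{-pi..pi}|lborel. g0 x * \<theta> x)
        = (1/2) * J g0 - (1/2) * J (\<lambda>x. g0 (- x)) - m * (LINT x:{-pi..pi}|lborel. g0 x * x)"
      by (simp add: \<theta>_def right_diff_distrib)
    have "(LINT x:{-pi..pi}|lborel. g1 x * ((1/2) * h x + (1/2) * h (- x))) = (1/2) * J g1 + (1/2) * J (\<lambda>x. g1 (- x))"
      unfolding J_def refl[symmetric] by (rule LINT_lin_right[OF g1m g1(2) ch chr])
    then have 3: "(LINT x:{-pi..pi}|lborel. g1 x * ((h x + h (- x)) / 2)) = (1/2) * J g1 + (1/2) * J (\<lambda>x. g1 (- x))"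
      by (simp add: add_divide_distrib)
    have "J (\<lambda>x. 1 * ((1/2) * g1 x + (1/2) * g1 (- x)) + (-1) * ((1/2) * g0 x + (-1/2) * g0 (- x)))
        = 1 * J (\<lambda>x. (1/2) * g1 x + (1/2) * g1 (- x)) + (-1) * J (\<lambda>x. (1/2) * g0 x + (-1/2) * g0 (- x))"
      unfolding J_def
    proof (rule LINT_lin_left[OF _ _ _ _ ch])
      show "\<bar>(1/2) * g1 x + (1/2) * g1 (- x)\<bar> \<le> K1" for x
        using g1(2)[of x] g1(2)[of "- x"] by (auto simp: abs_le_iff field_simps)
      show "\<bar>(1/2) * g0 x + (-1/2) * g0 (- x)\<bar> \<le> K0" for x
        using g0(2)[of x] g0(2)[of "- x"] by (auto simp: abs_le_iff field_simps)
    qed measurable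
    moreover have "J (\<lambda>x. (1/2) * g1 x + (1/2) * g1 (- x)) = (1/2) * J g1 + (1/2) * J (\<lambda>x. g1 (- x))"
      "J (\<lambda>x. (1/2) * g0 x + (-1/2) * g0 (- x)) = (1/2) * J g0 + (-1/2) * J (\<lambda>x. g0 (- x))"
      unfolding J_def by (rule LINT_lin_left[OF g1m g1(2) m1 g1(2) ch], rule LINT_lin_left[OF g0m g0(2) m0 g0(2) ch])
    moreover have "v = (\<lambda>x. 1 * ((1/2) * g1 x + (1/2) * g1 (- x)) + (-1) * ((1/2) * g0 x + (-1/2) * g0 (- x)))"
      by (auto simp: v_def field_simps)
    ultimately have 4: "J v = ((1/2) * J g1 + (1/2) * J (\<lambda>x. g1 (- x))) - ((1/2) * J g0 - (1/2) * J (\<lambda>x. g0 (- x)))"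
      by simp
    have "c * slope h = m * (fst f (\<lambda>_. 1) + (LINT x:{-pi..pi}|lborel. g0 x * x))"
      by (simp add: c_def m_def)
    then have "pairing f (dual_vec_of h) = J v + c * slope h"
      unfolding pairing_def 0 1 2 3 4 by (simp add: algebra_simps)
    then show ?thesis by (simp only: J_def Phi_def)
  qed
  show ?thesis
    by (rule that[OF _ per bound rep]) measurable
qed

lemma Linfty_states_pairing_bounded:
  assumes f: "f \<in> Linfty_states" and T: "T > 2 * pi"
  obtains K where "\<And>\<xi>. \<xi> \<in> dual_vecs \<Longrightarrow> \<bar>pairing f \<xi>\<bar> \<le> K * dual_norm T \<xi>"
proof -
  obtain v c M where v: "v \<in> borel_measurable borel" "\<And>x. \<bar>v x\<bar> \<le> M"
    and rep: "\<And>h. h \<in> profiles \<Longrightarrow> pairing f (dual_vec_of h) = Phi v c h"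
    using pairing_profile_density[OF f] by metis
  obtain K where "\<And>h. h \<in> profiles \<Longrightarrow> \<bar>Phi v c h\<bar> \<le> K * L1_Icc 0 T h"
    using Phi_bound[OF v T] by metis
  then have "\<bar>pairing f \<xi>\<bar> \<le> K * dual_norm T \<xi>" if "\<xi> \<in> dual_vecs" for \<xi>
    using rep profile_in_profiles[OF that] dual_vec_of_profile[OF that] dual_norm_L1[OF that] by metis
  then show ?thesis by (rule that)
qed

lemma L1_reflect: "L1_Icc (-a) a (\<lambda>x. h (- x)) = L1_Icc (-a) a h"
  unfolding L1_Icc_def by (rule LINT_reflect[of a "\<lambda>x. \<bar>h x\<bar>"])

text \<open>For a test function \<open>\<phi>\<close> used as a profile the pairing is \<open>f\<^sub>0(\<phi>') + f\<^sub>1(\<phi>)\<close>, for its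
  reflection it is \<open>- f\<^sub>0(\<phi>') + f\<^sub>1(\<phi>)\<close>. So both terms are bounded separately by the \<open>L\<^sub>1\<close> norm of \<open>\<phi>\<close>;
  the slope of \<open>\<phi>\<close> vanishes, hence the interval \<open>[-\<pi>, \<pi>]\<close> is long enough here.\<close>

lemma pairing_bounded_Linfty_states:
  assumes f: "f \<in> states" and K: "\<And>\<xi>. \<xi> \<in> dual_vecs \<Longrightarrow> \<bar>pairing f \<xi>\<bar> \<le> K * dual_norm T \<xi>"
  shows "f \<in> Linfty_states"
proof -
  define P where "P \<phi> = pairing f (dual_vec_of \<phi>)" for \<phi>
  obtain C where C: "C > 0" "\<And>h. h \<in> profiles \<Longrightarrow> L1_Icc 0 T h \<le> C * (L1_Icc (-pi) pi h + \<bar>slope h\<bar>)"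
    using L1_Icc_compare_slope[where a="-pi" and b=pi and c=0 and d=T] by auto
  have P: "\<bar>P \<phi>\<bar> \<le> \<bar>K\<bar> * C * L1_Icc (-pi) pi \<phi>" if \<phi>: "\<phi> \<in> test_funs" for \<phi>
  proof -
    note h = test_funs_in_profiles[OF \<phi>]
    have "slope \<phi> = 0"
      using \<phi> periodic_2piD[of \<phi> 0] by (simp add: slope_def test_funs_def)
    have "\<bar>P \<phi>\<bar> \<le> K * dual_norm T (dual_vec_of \<phi>)"
      unfolding P_def by (intro K dual_vec_of_in h)
    also have "dual_norm T (dual_vec_of \<phi>) = L1_Icc 0 T \<phi>"
      by (simp add: dual_norm_L1 dual_vec_of_in h profile_dual_vec_of)
    also have "K * L1_Icc 0 T \<phi> \<le> \<bar>K\<bar> * L1_Icc 0 T \<phi>"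
      by (intro mult_right_mono L1_Icc_nonneg) simp
    also have "\<dots> \<le> \<bar>K\<bar> * (C * L1_Icc (-pi) pi \<phi>)"
      using C(2)[OF h] \<open>slope \<phi> = 0\<close> by (intro mult_left_mono) auto
    finally show ?thesis by (simp add: mult.assoc)
  qed
  have reflect: "P (\<lambda>x. \<phi> (- x)) = - fst f (deriv \<phi>) + snd f \<phi>" if \<phi>: "\<phi> \<in> test_funs" for \<phi>
  proof -
    have "deriv (\<lambda>x. \<phi> (- x)) = (\<lambda>x. -1 * deriv \<phi> (- x))"
      using DERIV_chain'[OF DERIV_minus[OF DERIV_ident] test_funs_DERIV[OF \<phi>]]
      by (auto intro!: DERIV_imp_deriv)
    then show ?thesis
      unfolding P_def pairing_dual_vec_of_test[OF f test_funs_reflect[OF \<phi>]]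
      using torus_distsD(3)[OF statesD(1)[OF f] test_funs_reflect[OF test_funs_deriv[OF \<phi>]], of "-1"]
        statesD(3,4)[OF f] \<phi> test_funs_deriv[OF \<phi>] by (simp add: even_dist_def)
  qed
  have direct: "P \<phi> = fst f (deriv \<phi>) + snd f \<phi>" if "\<phi> \<in> test_funs" for \<phi>
    unfolding P_def by (rule pairing_dual_vec_of_test[OF f that])
  have bound: "\<bar>fst f (deriv \<phi>)\<bar> \<le> \<bar>K\<bar> * C * L1_Icc (-pi) pi \<phi>" "\<bar>snd f \<phi>\<bar> \<le> \<bar>K\<bar> * C * L1_Icc (-pi) pi \<phi>"
    if \<phi>: "\<phi> \<in> test_funs" for \<phi>
    using P[OF \<phi>] P[OF test_funs_reflect[OF \<phi>]]
    unfolding L1_reflect direct[OF \<phi>] reflect[OF \<phi>] abs_le_iff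
    by (intro conjI; linarith)+
  have "snd f \<in> Linfty_dists"
    by (rule Linfty_distsI[OF torus_distsD(1)]) (use bound(2) statesD[OF f] torus_distsD in auto)
  moreover have "dist_deriv (fst f) \<in> Linfty_dists"
  proof (rule Linfty_distsI)
    show "dist_deriv (fst f) \<in> extensional test_funs" by (simp add: dist_deriv_def)
    show "\<bar>dist_deriv (fst f) \<phi>\<bar> \<le> \<bar>K\<bar> * C * L1_Icc (-pi) pi \<phi>" if "\<phi> \<in> test_funs" for \<phi>
      using bound(1)[OF that] that by (simp add: dist_deriv_def)
    fix \<phi> assume \<phi>: "\<phi> \<in> test_funs"
    have "deriv (\<lambda>x. c * \<phi> x) = (\<lambda>x. c * deriv \<phi> x)" for c
      by (intro ext DERIV_imp_deriv DERIV_cmult test_funs_DERIV \<phi>)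
    then show "dist_deriv (fst f) (\<lambda>x. c * \<phi> x) = c * dist_deriv (fst f) \<phi>" for c
      using \<phi> torus_distsD(3)[OF statesD(1)[OF f] test_funs_deriv[OF \<phi>]]
      by (simp add: dist_deriv_def test_funs_cmult)
    fix \<psi> assume \<psi>: "\<psi> \<in> test_funs"
    have "deriv (\<lambda>x. \<phi> x + \<psi> x) = (\<lambda>x. deriv \<phi> x + deriv \<psi> x)"
      by (intro ext DERIV_imp_deriv DERIV_add test_funs_DERIV \<phi> \<psi>)
    then show "dist_deriv (fst f) (\<lambda>x. \<phi> x + \<psi> x) = dist_deriv (fst f) \<phi> + dist_deriv (fst f) \<psi>"
      using \<phi> \<psi> torus_distsD(2)[OF statesD(1)[OF f] test_funs_deriv[OF \<phi>] test_funs_deriv[OF \<psi>]]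
      by (simp add: dist_deriv_def test_funs_add)
  qed
  ultimately show ?thesis
    using f by (auto simp: Linfty_states_def)
qed

section \<open>The dual of the completion\<close>

lemma closure_add_scale:
  fixes V :: "'b::real_normed_vector set"
  assumes V: "subspace V" and "a \<in> closure V" "b \<in> closure V"
  shows "a + b \<in> closure V" "c *\<^sub>R a \<in> closure V"
proof -
  obtain x y where x: "\<And>n. x n \<in> V" "x \<longlonglongrightarrow> a" and y: "\<And>n. y n \<in> V" "y \<longlonglongrightarrow> b"
    using assms(2,3) unfolding closure_sequential by blast
  have "(\<lambda>n. x n + y n) \<longlonglongrightarrow> a + b" "(\<lambda>n. c *\<^sub>R x n) \<longlonglongrightarrow> c *\<^sub>R a"
    by (intro tendsto_intros x y)+
  moreover have "\<forall>n. x n + y n \<in> V" "\<forall>n. c *\<^sub>R x n \<in> V"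
    using x(1) y(1) subspace_add[OF V] subspace_scale[OF V] by simp_all
  ultimately show "a + b \<in> closure V" "c *\<^sub>R a \<in> closure V"
    unfolding closure_sequential by - (intro exI conjI; assumption)+
qed

lemma dual_spaceD:
  assumes "F \<in> dual_space V"
  shows "F \<in> extensional V"
    and "a \<in> V \<Longrightarrow> b \<in> V \<Longrightarrow> F (a + b) = F a + F b"
    and "a \<in> V \<Longrightarrow> F (c *\<^sub>R a) = c * F a"
    and "\<exists>K. \<forall>a\<in>V. \<bar>F a\<bar> \<le> K * norm a"
proof -
  have *: "F \<in> extensional V \<and> (\<forall>a\<in>V. \<forall>b\<in>V. F (a + b) = F a + F b) \<and>
      (\<forall>c. \<forall>a\<in>V. F (c *\<^sub>R a) = c * F a) \<and> (\<exists>K. \<forall>a\<in>V. \<bar>F a\<bar> \<le> K * norm a)"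
    using assms unfolding dual_space_def mem_Collect_eq .
  show "F \<in> extensional V" "\<exists>K. \<forall>a\<in>V. \<bar>F a\<bar> \<le> K * norm a"
    by (rule *[THEN conjunct1], rule *[THEN conjunct2, THEN conjunct2, THEN conjunct2])
  show "F (a + b) = F a + F b" if "a \<in> V" "b \<in> V" using * that by simp
  show "F (c *\<^sub>R a) = c * F a" if "a \<in> V" using * that by simp
qed

lemma dual_space_Lipschitz:
  fixes V :: "'b::real_normed_vector set"
  assumes V: "subspace V" and F: "F \<in> dual_space (closure V)"
  shows "\<exists>K. \<forall>a\<in>closure V. \<forall>b\<in>closure V. \<bar>F a - F b\<bar> \<le> K * norm (a - b)"
proof -
  obtain K where K: "\<And>a. a \<in> closure V \<Longrightarrow> \<bar>F a\<bar> \<le> K * norm a"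
    using dual_spaceD(4)[OF F] by blast
  have "\<bar>F a - F b\<bar> \<le> K * norm (a - b)" if ab: "a \<in> closure V" "b \<in> closure V" for a b
  proof -
    have nb: "(-1) *\<^sub>R b \<in> closure V" by (rule closure_add_scale(2)[OF V ab(2) ab(2)])
    have "F (a + (-1) *\<^sub>R b) = F a + (-1) * F b"
      using dual_spaceD(2)[OF F ab(1) nb] dual_spaceD(3)[OF F ab(2), of "-1"] by simp
    then have "F (a - b) = F a - F b" by simp
    moreover have "a - b \<in> closure V" using closure_add_scale(1)[OF V ab(1) nb] by simp
    ultimately show ?thesis using K[of "a - b"] by simp
  qed
  then show ?thesis by blast
qed

lemma dual_space_eqI:
  fixes V :: "'b::real_normed_vector set"
  assumes V: "subspace V" and F: "F \<in> dual_space (closure V)" and G: "G \<in> dual_space (closure V)"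
    and eq: "\<And>a. a \<in> V \<Longrightarrow> F a = G a"
  shows "F = G"
proof (rule extensionalityI)
  show "F \<in> extensional (closure V)" "G \<in> extensional (closure V)"
    by (rule dual_spaceD(1)[OF F], rule dual_spaceD(1)[OF G])
  fix a assume a: "a \<in> closure V"
  obtain x where x: "\<And>n. x n \<in> V" "x \<longlonglongrightarrow> a"
    using a unfolding closure_sequential by blast
  have lim: "(\<lambda>n. H (x n)) \<longlonglongrightarrow> H a" if H: "H \<in> dual_space (closure V)" for H
  proof -
    obtain K where K: "\<forall>b\<in>closure V. \<forall>c\<in>closure V. \<bar>H b - H c\<bar> \<le> K * norm (b - c)"
      using dual_space_Lipschitz[OF V H] by (elim exE)
    have "(\<lambda>n. K * norm (x n - a)) \<longlonglongrightarrow> K * norm (a - a)"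
      by (intro tendsto_intros x)
    then have null: "(\<lambda>n. K * norm (x n - a)) \<longlonglongrightarrow> 0" by simp
    have "norm (H (x n) - H a) \<le> K * norm (x n - a)" for n
      using bspec[OF bspec[OF K subsetD[OF closure_subset x(1)]] a] by simp
    then have "(\<lambda>n. H (x n) - H a) \<longlonglongrightarrow> 0"
      by (intro Lim_null_comparison[OF _ null] always_eventually allI)
    then show ?thesis by (rule LIM_zero_cancel)
  qed
  show "F a = G a"
    using LIMSEQ_unique[OF lim[OF F]] lim[OF G] unfolding eq[OF x(1)] by blast
qed

lemma extend_to_closure:
  fixes V :: "'b::real_normed_vector set"
  assumes V: "subspace V"
    and add: "\<And>a b. a \<in> V \<Longrightarrow> b \<in> V \<Longrightarrow> F (a + b) = F a + F b"
    and scale: "\<And>a c. a \<in> V \<Longrightarrow> F (c *\<^sub>R a) = c * F a"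
    and bound: "\<And>a. a \<in> V \<Longrightarrow> \<bar>F a\<bar> \<le> K * norm a"
  shows "\<exists>G\<in>dual_space (closure V). \<forall>a\<in>V. G a = (F a :: real)"
proof -
  have lip: "\<bar>F a - F b\<bar> \<le> K * norm (a - b)" if "a \<in> V" "b \<in> V" for a b
    using bound[OF subspace_diff[OF V that]] add[OF that(1) subspace_scale[OF V that(2)], of "-1"]
      scale[OF that(2), of "-1"] by simp
  have uc: "uniformly_continuous_on V F"
  proof (rule lipschitz_on_uniformly_continuous[OF lipschitz_onI])
    show "dist (F a) (F b) \<le> \<bar>K\<bar> * dist a b" if "a \<in> V" "b \<in> V" for a b
      using lip[OF that] mult_right_mono[OF abs_ge_self[of K] norm_ge_zero[of "a - b"]]
      by (simp add: dist_norm)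
  qed simp
  obtain g where g: "uniformly_continuous_on (closure V) g" "\<And>a. a \<in> V \<Longrightarrow> F a = g a"
    by (rule uniformly_continuous_on_extension_on_closure[OF uc]) (rule that)
  have lim: "(\<lambda>n. F (x n)) \<longlonglongrightarrow> g a" if "a \<in> closure V" "\<And>n. x n \<in> V" "x \<longlonglongrightarrow> a" for x a
  proof -
    have "(\<lambda>n. g (x n)) \<longlonglongrightarrow> g a"
      using subsetD[OF closure_subset that(2)] that
      by (intro continuous_on_tendsto_compose[OF uniformly_continuous_imp_continuous[OF g(1)]]) auto
    then show ?thesis using g(2) that(2) by simp
  qed
  define G where "G = restrict g (closure V)"
  have "G \<in> dual_space (closure V)"
    unfolding dual_space_def
  proof (intro CollectI conjI ballI allI exI[of _ K])
    show "G \<in> extensional (closure V)" by (simp add: G_def)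
    fix a assume a: "a \<in> closure V"
    obtain x where x: "\<And>n. x n \<in> V" "x \<longlonglongrightarrow> a" using a unfolding closure_sequential by blast
    have Fx: "(\<lambda>n. F (x n)) \<longlonglongrightarrow> g a" by (rule lim[OF a x])
    show "\<bar>G a\<bar> \<le> K * norm a"
    proof -
      have "(\<lambda>n. \<bar>F (x n)\<bar>) \<longlonglongrightarrow> \<bar>g a\<bar>" "(\<lambda>n. K * norm (x n)) \<longlonglongrightarrow> K * norm a"
        by (intro tendsto_intros Fx x)+
      then have "\<bar>g a\<bar> \<le> K * norm a" using bound x(1) by (intro LIMSEQ_le) auto
      then show ?thesis using a by (simp add: G_def)
    qed
    show "G (c *\<^sub>R a) = c * G a" for c
    proof -
      have ca: "c *\<^sub>R a \<in> closure V" by (rule closure_add_scale(2)[OF V a a])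
      have "(\<lambda>n. F (c *\<^sub>R x n)) \<longlonglongrightarrow> g (c *\<^sub>R a)"
        by (intro lim ca subspace_scale[OF V] x tendsto_intros)
      moreover have "(\<lambda>n. F (c *\<^sub>R x n)) \<longlonglongrightarrow> c * g a"
        unfolding scale[OF x(1)] by (intro tendsto_intros Fx)
      ultimately show ?thesis using a ca LIMSEQ_unique by (auto simp: G_def)
    qed
    fix b assume b: "b \<in> closure V"
    obtain y where y: "\<And>n. y n \<in> V" "y \<longlonglongrightarrow> b" using b unfolding closure_sequential by blast
    have ab: "a + b \<in> closure V" by (rule closure_add_scale(1)[OF V a b])
    have "(\<lambda>n. F (x n + y n)) \<longlonglongrightarrow> g (a + b)"
      by (intro lim ab subspace_add[OF V] x y tendsto_intros)
    moreover have "(\<lambda>n. F (x n + y n)) \<longlonglongrightarrow> g a + g b"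
      unfolding add[OF x(1) y(1)] by (intro tendsto_intros Fx lim[OF b y])
    ultimately show "G (a + b) = G a + G b" using a b ab LIMSEQ_unique by (auto simp: G_def)
  qed
  moreover have "G a = F a" if "a \<in> V" for a
    using g(2)[OF that] that closure_subset by (auto simp: G_def)
  ultimately show ?thesis by blast
qed

lemma isometric_embeddingD:
  assumes "isometric_embedding p \<iota>"
  shows "\<xi> \<in> dual_vecs \<Longrightarrow> \<zeta> \<in> dual_vecs \<Longrightarrow> \<iota> (dv_add \<xi> \<zeta>) = \<iota> \<xi> + \<iota> \<zeta>"
    and "\<xi> \<in> dual_vecs \<Longrightarrow> \<iota> (dv_scale c \<xi>) = c *\<^sub>R \<iota> \<xi>"
    and "\<xi> \<in> dual_vecs \<Longrightarrow> norm (\<iota> \<xi>) = p \<xi>"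
  using assms by (simp_all add: isometric_embedding_def)

lemma zero_dual_vec: "((\<lambda>_. 0), (\<lambda>_. 0)) \<in> dual_vecs"
  by (simp add: dual_vecs_def test_funs_const even_fun_def)

lemma subspace_range_embedding:
  assumes \<iota>: "isometric_embedding p \<iota>"
  shows "subspace (\<iota> ` dual_vecs)"
  unfolding subspace_def
proof (intro conjI ballI allI)
  have "\<iota> (dv_scale 0 ((\<lambda>_. 0), (\<lambda>_. 0))) = 0"
    using isometric_embeddingD(2)[OF \<iota> zero_dual_vec, of 0] by simp
  then show "0 \<in> \<iota> ` dual_vecs" using zero_dual_vec dv_scale_in by (metis imageI)
  fix a assume "a \<in> \<iota> ` dual_vecs"
  then obtain \<xi> where \<xi>: "\<xi> \<in> dual_vecs" "a = \<iota> \<xi>" by blast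
  show "c *\<^sub>R a \<in> \<iota> ` dual_vecs" for c
    using isometric_embeddingD(2)[OF \<iota> \<xi>(1), of c] dv_scale_in[OF \<xi>(1)] \<xi>(2) by (metis imageI)
  fix b assume "b \<in> \<iota> ` dual_vecs"
  then obtain \<zeta> where \<zeta>: "\<zeta> \<in> dual_vecs" "b = \<iota> \<zeta>" by blast
  show "a + b \<in> \<iota> ` dual_vecs"
    using isometric_embeddingD(1)[OF \<iota> \<xi>(1) \<zeta>(1)] dv_add_in[OF \<xi>(1) \<zeta>(1)] \<xi>(2) \<zeta>(2) by (metis imageI)
qed

lemma bounded_pairing_represented:
  fixes \<iota> :: "dual_vec \<Rightarrow> 'b::banach"
  assumes \<iota>: "isometric_embedding p \<iota>" and f: "f \<in> states"
    and K: "\<And>\<xi>. \<xi> \<in> dual_vecs \<Longrightarrow> \<bar>pairing f \<xi>\<bar> \<le> K * p \<xi>"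
  shows "\<exists>!F. F \<in> dual_space (completion \<iota>) \<and> represents \<iota> f F"
proof -
  let ?V = "\<iota> ` dual_vecs"
  note V = subspace_range_embedding[OF \<iota>]
  have wd: "pairing f \<xi> = pairing f \<zeta>" if "\<xi> \<in> dual_vecs" "\<zeta> \<in> dual_vecs" "\<iota> \<xi> = \<iota> \<zeta>" for \<xi> \<zeta>
  proof -
    let ?d = "dv_add \<xi> (dv_scale (-1) \<zeta>)"
    have d: "?d \<in> dual_vecs" by (intro dv_add_in dv_scale_in that)
    have "\<iota> ?d = 0"
      using isometric_embeddingD(1)[OF \<iota> that(1) dv_scale_in[OF that(2)], of "-1"]
        isometric_embeddingD(2)[OF \<iota> that(2), of "-1"] that(3) by simp
    then have "p ?d = 0" using isometric_embeddingD(3)[OF \<iota> d] by simp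
    then have "pairing f ?d = 0" using K[OF d] by simp
    then show ?thesis
      using pairing_add[OF f that(1) dv_scale_in[OF that(2)], of "-1"] pairing_scale[OF f that(2), of "-1"]
      by simp
  qed
  define F where "F a = pairing f (inv_into dual_vecs \<iota> a)" for a
  have F: "F (\<iota> \<xi>) = pairing f \<xi>" if "\<xi> \<in> dual_vecs" for \<xi>
    unfolding F_def using that by (intro wd inv_into_into f_inv_into_f imageI)
  have "\<exists>G\<in>dual_space (closure ?V). \<forall>a\<in>?V. G a = F a"
  proof (rule extend_to_closure[OF V])
    show "F (a + b) = F a + F b" if "a \<in> ?V" "b \<in> ?V" for a b
      using that by (auto simp: F pairing_add[OF f] dv_add_in isometric_embeddingD(1)[OF \<iota>, symmetric])
    show "F (c *\<^sub>R a) = c * F a" if "a \<in> ?V" for a c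
      using that by (auto simp: F pairing_scale[OF f] dv_scale_in isometric_embeddingD(2)[OF \<iota>, symmetric])
    show "\<bar>F a\<bar> \<le> K * norm a" if "a \<in> ?V" for a
      using that K by (auto simp: F isometric_embeddingD(3)[OF \<iota>])
  qed
  then obtain G where G: "G \<in> dual_space (completion \<iota>)" "\<And>a. a \<in> ?V \<Longrightarrow> G a = F a"
    unfolding completion_def by blast
  show ?thesis
  proof (rule ex1I[of _ G])
    show "G \<in> dual_space (completion \<iota>) \<and> represents \<iota> f G"
      using G F by (auto simp: represents_def)
    fix H assume H: "H \<in> dual_space (completion \<iota>) \<and> represents \<iota> f H"
    show "H = G"
      by (rule dual_space_eqI[OF V])
         (use H G F in \<open>auto simp: completion_def represents_def\<close>)
  qed
qed

lemma component_pairing: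
  assumes f: "f \<in> states" and \<phi>: "\<phi> \<in> test_funs"
  shows "pairing f (even_part \<phi>, (\<lambda>_. 0)) = fst f \<phi>" "pairing f ((\<lambda>_. 0), even_part \<phi>) = snd f \<phi>"
  using torus_dists_zero[OF statesD(1)[OF f]] torus_dists_zero[OF statesD(2)[OF f]]
    even_dist_even_part[OF statesD(1)[OF f] statesD(3)[OF f] \<phi>]
    even_dist_even_part[OF statesD(2)[OF f] statesD(4)[OF f] \<phi>]
  by (auto simp: pairing_def)

lemma component_dual_vec:
  assumes "\<phi> \<in> test_funs"
  shows "(even_part \<phi>, (\<lambda>_. 0)) \<in> dual_vecs" "((\<lambda>_. 0), even_part \<phi>) \<in> dual_vecs"
  using even_part_test[OF assms] even_part_even
  by (auto simp: dual_vecs_def test_funs_const even_fun_def)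

lemma dual_norm_le_sup:
  assumes \<xi>: "\<xi> \<in> dual_vecs" and T: "T \<ge> 0" and B: "\<And>x. \<bar>fst \<xi> x\<bar> \<le> B0" "\<And>x. \<bar>snd \<xi> x\<bar> \<le> B1"
  shows "dual_norm T \<xi> \<le> T * (B1 + B0 * T)"
proof -
  have "\<bar>profile \<xi> x\<bar> \<le> B1 + B0 * T" if x: "x \<in> {0..T}" for x
  proof -
    have "norm (odd_part \<xi> x - odd_part \<xi> 0) \<le> B0 * norm (x - 0)"
      unfolding odd_part_def
      by (rule field_differentiable_bound[of UNIV _ "fst \<xi>"])
         (use B(1) DERIV_LBINT[OF smooth_continuous_on[OF dual_vecsD(5)[OF \<xi>]]] in auto)
    then have "\<bar>odd_part \<xi> x\<bar> \<le> B0 * x" using x by (simp add: odd_part_def)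
    also have "\<dots> \<le> B0 * T" using x B(1)[of 0] by (intro mult_left_mono) auto
    finally have 1: "\<bar>odd_part \<xi> x\<bar> \<le> B0 * T" .
    have "\<bar>profile \<xi> x\<bar> \<le> \<bar>snd \<xi> x\<bar> + \<bar>odd_part \<xi> x\<bar>"
      unfolding profile_odd_part by (rule abs_triangle_ineq)
    then show ?thesis using 1 B(2)[of x] by linarith
  qed
  then have "L1_Icc 0 T (profile \<xi>) \<le> (LINT x:{0..T}|lborel. B1 + B0 * T)"
    unfolding L1_Icc_def
    by (intro set_integral_mono continuous_set_integrable_abs continuous_set_integrable
        profiles_continuous profile_in_profiles \<xi> continuous_intros) auto
  then show ?thesis using T by (simp add: dual_norm_L1[OF \<xi>] LINT_const_Icc)
qed

lemma abs_mean_le: "\<bar>a\<bar> \<le> S \<Longrightarrow> \<bar>b\<bar> \<le> S \<Longrightarrow> \<bar>(a + b) / 2\<bar> \<le> S" for a b S :: real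
  by (auto simp: abs_le_iff field_simps)

lemma even_part_le_SUP: "\<phi> \<in> test_funs \<Longrightarrow> \<bar>even_part \<phi> x\<bar> \<le> (SUP x. \<bar>\<phi> x\<bar>)"
  unfolding even_part_def by (intro abs_mean_le test_funs_le_SUP)

lemma state_eqI:
  assumes "f \<in> states" "g \<in> states" "\<And>\<xi>. \<xi> \<in> dual_vecs \<Longrightarrow> pairing f \<xi> = pairing g \<xi>"
  shows "f = g"
proof (rule prod_eqI)
  show "fst f = fst g"
  proof (rule extensionalityI)
    show "fst f \<in> extensional test_funs" "fst g \<in> extensional test_funs"
      using statesD(1) torus_distsD(1) assms by blast+
    show "fst f \<phi> = fst g \<phi>" if "\<phi> \<in> test_funs" for \<phi>
      using assms(3)[OF component_dual_vec(1)[OF that]] component_pairing(1)[OF _ that] assms by metis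
  qed
  show "snd f = snd g"
  proof (rule extensionalityI)
    show "snd f \<in> extensional test_funs" "snd g \<in> extensional test_funs"
      using statesD(2) torus_distsD(1) assms by blast+
    show "snd f \<phi> = snd g \<phi>" if "\<phi> \<in> test_funs" for \<phi>
      using assms(3)[OF component_dual_vec(2)[OF that]] component_pairing(2)[OF _ that] assms by metis
  qed
qed

text \<open>The even state that induces a given functional on dual vectors.\<close>

definition state_of :: "(dual_vec \<Rightarrow> real) \<Rightarrow> dist \<times> dist" where
  "state_of Z = ((\<lambda>\<phi>\<in>test_funs. Z (even_part \<phi>, (\<lambda>_. 0))), (\<lambda>\<phi>\<in>test_funs. Z ((\<lambda>_. 0), even_part \<phi>)))"

text \<open>The dual norm is dominated by the supremum norm, so a functional bounded in the dual norm is a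
  pair of distributions of order zero.\<close>

lemma state_of:
  assumes Z_add: "\<And>\<xi> \<zeta>. \<xi> \<in> dual_vecs \<Longrightarrow> \<zeta> \<in> dual_vecs \<Longrightarrow> Z (dv_add \<xi> \<zeta>) = Z \<xi> + Z \<zeta>"
    and Z_scale: "\<And>\<xi> c. \<xi> \<in> dual_vecs \<Longrightarrow> Z (dv_scale c \<xi>) = c * Z \<xi>"
    and Z_bound: "\<And>\<xi>. \<xi> \<in> dual_vecs \<Longrightarrow> \<bar>Z \<xi>\<bar> \<le> K * dual_norm T \<xi>"
    and T: "T \<ge> 0"
  shows "state_of Z \<in> states" and "\<And>\<xi>. \<xi> \<in> dual_vecs \<Longrightarrow> pairing (state_of Z) \<xi> = Z \<xi>"
proof -
  define f where "f = state_of Z"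
  have f0: "fst f \<phi> = Z (even_part \<phi>, (\<lambda>_. 0))" and f1: "snd f \<phi> = Z ((\<lambda>_. 0), even_part \<phi>)"
    if "\<phi> \<in> test_funs" for \<phi>
    using that by (auto simp: f_def state_of_def)
  have ext: "fst f \<in> extensional test_funs" "snd f \<in> extensional test_funs"
    by (auto simp: f_def state_of_def)
  have Z_SUP: "\<bar>Z \<xi>\<bar> \<le> \<bar>K\<bar> * (T * (1 + T)) * (SUP x. \<bar>\<phi> x\<bar>)"
    if \<phi>: "\<phi> \<in> test_funs" and \<xi>: "\<xi> \<in> dual_vecs"
      and le: "\<And>x. \<bar>fst \<xi> x\<bar> \<le> \<bar>even_part \<phi> x\<bar>" "\<And>x. \<bar>snd \<xi> x\<bar> \<le> \<bar>even_part \<phi> x\<bar>" for \<phi> \<xi>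
  proof -
    define S where "S = (SUP x. \<bar>\<phi> x\<bar>)"
    have "dual_norm T \<xi> \<le> T * (S + S * T)"
      unfolding S_def by (rule dual_norm_le_sup[OF \<xi> T])
        (use order_trans[OF le(1) even_part_le_SUP[OF \<phi>]] order_trans[OF le(2) even_part_le_SUP[OF \<phi>]] in auto)
    moreover have "0 \<le> dual_norm T \<xi>"
      unfolding dual_norm_L1[OF \<xi>] by (rule L1_Icc_nonneg)
    ultimately have "\<bar>Z \<xi>\<bar> \<le> \<bar>K\<bar> * (T * (S + S * T))"
      using Z_bound[OF \<xi>] mult_right_mono[OF abs_ge_self[of K], of "dual_norm T \<xi>"]
        mult_left_mono[OF _ abs_ge_zero[of K], of "dual_norm T \<xi>" "T * (S + S * T)"] by linarith
    then show ?thesis unfolding S_def[symmetric] by (simp add: algebra_simps)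
  qed
  have ep_add: "even_part (\<lambda>x. \<phi> x + \<psi> x) = (\<lambda>x. even_part \<phi> x + even_part \<psi> x)" for \<phi> \<psi>
    by (auto simp: even_part_def add_divide_distrib)
  have ep_scale: "even_part (\<lambda>x. c * \<phi> x) = (\<lambda>x. c * even_part \<phi> x)" for \<phi> c
    by (auto simp: even_part_def distrib_left)
  have ep_refl: "even_part (\<lambda>x. \<phi> (- x)) = even_part \<phi>" for \<phi>
    by (auto simp: even_part_def add.commute)
  have torus: "g \<in> torus_dists"
    if g: "g \<in> extensional test_funs" "\<And>\<phi>. \<phi> \<in> test_funs \<Longrightarrow> g \<phi> = Z (I (even_part \<phi>))"
      and I: "\<And>\<phi>. \<phi> \<in> test_funs \<Longrightarrow> I (even_part \<phi>) \<in> dual_vecs"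
        "\<And>\<phi> \<psi>. I (\<lambda>x. \<phi> x + \<psi> x) = dv_add (I \<phi>) (I \<psi>)" "\<And>\<phi> c. I (\<lambda>x. c * \<phi> x) = dv_scale c (I \<phi>)"
        "\<And>\<phi> x. \<bar>fst (I \<phi>) x\<bar> \<le> \<bar>\<phi> x\<bar>" "\<And>\<phi> x. \<bar>snd (I \<phi>) x\<bar> \<le> \<bar>\<phi> x\<bar>" for g I
    unfolding torus_dists_def
  proof (intro CollectI conjI ballI allI exI[of _ "0::nat"] exI[of _ "\<bar>K\<bar> * (T * (1 + T))"] g(1))
    fix \<phi> assume \<phi>: "\<phi> \<in> test_funs"
    show "\<bar>g \<phi>\<bar> \<le> \<bar>K\<bar> * (T * (1 + T)) * (\<Sum>k\<le>0. SUP x. \<bar>(deriv ^^ k) \<phi> x\<bar>)"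
      using Z_SUP[OF \<phi> I(1)[OF \<phi>] I(4,5)] g(2)[OF \<phi>] by simp
    show "g (\<lambda>x. c * \<phi> x) = c * g \<phi>" for c
      using Z_scale[OF I(1)[OF \<phi>], of c] by (simp add: g(2) test_funs_cmult ep_scale I(3) \<phi>)
    fix \<psi> assume \<psi>: "\<psi> \<in> test_funs"
    show "g (\<lambda>x. \<phi> x + \<psi> x) = g \<phi> + g \<psi>"
      using Z_add[OF I(1)[OF \<phi>] I(1)[OF \<psi>]] by (simp add: g(2) test_funs_add ep_add I(2) \<phi> \<psi>)
  qed
  have "fst f \<in> torus_dists"
    by (rule torus[where I="\<lambda>\<phi>. (\<phi>, \<lambda>_. 0)"])
       (auto simp: ext f0 component_dual_vec dv_add_def dv_scale_def)
  moreover have "snd f \<in> torus_dists"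
    by (rule torus[where I="\<lambda>\<phi>. (\<lambda>_. 0, \<phi>)"])
       (auto simp: ext f1 component_dual_vec dv_add_def dv_scale_def)
  moreover have "even_dist (fst f)" "even_dist (snd f)"
    by (auto simp: even_dist_def f0 f1 test_funs_reflect ep_refl)
  ultimately show "state_of Z \<in> states"
    unfolding f_def[symmetric] by (auto simp: states_def case_prod_beta)
  fix \<xi> assume \<xi>: "\<xi> \<in> dual_vecs"
  note tf = dual_vecsD(1,2)[OF \<xi>]
  have ep: "even_part (fst \<xi>) = fst \<xi>" "even_part (snd \<xi>) = snd \<xi>"
    using even_part_id dual_vecsD(3,4)[OF \<xi>] by auto
  have "\<xi> = dv_add (fst \<xi>, (\<lambda>_. 0)) ((\<lambda>_. 0), snd \<xi>)"
    by (simp add: dv_add_def)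
  then have "Z \<xi> = Z (fst \<xi>, (\<lambda>_. 0)) + Z ((\<lambda>_. 0), snd \<xi>)"
    using Z_add component_dual_vec(1)[OF tf(1)] component_dual_vec(2)[OF tf(2)] unfolding ep by metis
  then show "pairing (state_of Z) \<xi> = Z \<xi>"
    unfolding f_def[symmetric] pairing_def by (simp add: f0 f1 tf ep)
qed

lemma functional_represented_by_state:
  fixes \<iota> :: "dual_vec \<Rightarrow> 'b::banach"
  assumes \<iota>: "isometric_embedding (dual_norm T) \<iota>" and T: "T \<ge> 0"
    and F: "F \<in> dual_space (completion \<iota>)"
  shows "\<exists>!f. f \<in> states \<and> represents \<iota> f F"
proof -
  have in_compl: "\<iota> \<xi> \<in> completion \<iota>" if "\<xi> \<in> dual_vecs" for \<xi>
    unfolding completion_def using that closure_subset[of "\<iota> ` dual_vecs"] by blast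
  obtain K where "\<And>a. a \<in> completion \<iota> \<Longrightarrow> \<bar>F a\<bar> \<le> K * norm a"
    using dual_spaceD(4)[OF F] by blast
  then have K: "\<bar>F (\<iota> \<xi>)\<bar> \<le> K * dual_norm T \<xi>" if "\<xi> \<in> dual_vecs" for \<xi>
    using in_compl[OF that] isometric_embeddingD(3)[OF \<iota> that] by metis
  define f where "f = state_of (\<lambda>\<xi>. F (\<iota> \<xi>))"
  have A: "F (\<iota> (dv_add \<xi> \<zeta>)) = F (\<iota> \<xi>) + F (\<iota> \<zeta>)" if "\<xi> \<in> dual_vecs" "\<zeta> \<in> dual_vecs" for \<xi> \<zeta>
    unfolding isometric_embeddingD(1)[OF \<iota> that] by (intro dual_spaceD(2)[OF F] in_compl that)
  have S: "F (\<iota> (dv_scale c \<xi>)) = c * F (\<iota> \<xi>)" if "\<xi> \<in> dual_vecs" for \<xi> c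
    unfolding isometric_embeddingD(2)[OF \<iota> that] by (intro dual_spaceD(3)[OF F] in_compl that)
  have fs: "f \<in> states" unfolding f_def using A S K T by (rule state_of(1))
  have pf: "pairing f \<xi> = F (\<iota> \<xi>)" if "\<xi> \<in> dual_vecs" for \<xi>
    unfolding f_def using A S K T that by (rule state_of(2))
  show ?thesis
  proof (rule ex1I[where a=f])
    show "f \<in> states \<and> represents \<iota> f F" using fs pf by (simp add: represents_def)
    fix g assume g: "g \<in> states \<and> represents \<iota> g F"
    show "g = f"
      by (rule state_eqI) (use g fs pf in \<open>auto simp: represents_def\<close>)
  qed
qed

theorem dual_coincides_with_Linfty_states:
  fixes \<iota> :: "dual_vec \<Rightarrow> 'b::banach"
  assumes T: "T > 2 * pi" and \<iota>: "isometric_embedding (dual_norm T) \<iota>"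
  shows "dual_coincides_with \<iota> Linfty_states"
  unfolding dual_coincides_with_def
proof (intro conjI ballI impI)
  have "T \<ge> 0" using T pi_gt_zero by linarith
  fix f assume f: "f \<in> Linfty_states"
  obtain K where "\<And>\<xi>. \<xi> \<in> dual_vecs \<Longrightarrow> \<bar>pairing f \<xi>\<bar> \<le> K * dual_norm T \<xi>"
    using Linfty_states_pairing_bounded[OF f T] by blast
  then show "\<exists>!F. F \<in> dual_space (completion \<iota>) \<and> represents \<iota> f F"
    by (rule bounded_pairing_represented[OF \<iota> Linfty_states_subset[OF f]])
next
  have "T \<ge> 0" using T pi_gt_zero by linarith
  fix F assume F: "F \<in> dual_space (completion \<iota>)"
  show "\<exists>!f. f \<in> states \<and> represents \<iota> f F"
    by (rule functional_represented_by_state[OF \<iota> \<open>T \<ge> 0\<close> F])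
  fix f assume f: "f \<in> states" "represents \<iota> f F"
  obtain K where K: "\<And>a. a \<in> completion \<iota> \<Longrightarrow> \<bar>F a\<bar> \<le> K * norm a"
    using dual_spaceD(4)[OF F] by blast
  have "\<bar>pairing f \<xi>\<bar> \<le> K * dual_norm T \<xi>" if "\<xi> \<in> dual_vecs" for \<xi>
    using K[of "\<iota> \<xi>"] that f(2) isometric_embeddingD(3)[OF \<iota> that] closure_subset[of "\<iota> ` dual_vecs"]
    by (auto simp: represents_def completion_def)
  then show "f \<in> Linfty_states"
    by (rule pairing_bounded_Linfty_states[OF f(1)])
qed

section \<open>Damping\<close>

text \<open>Duhamel's integral: a unit impulse at \<open>x = 0\<close> applied at time \<open>s\<close> and observed at time \<open>t\<close>
  through a profile \<open>h\<close> gives \<open>h(t - s)\<close>.\<close>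

definition control_term :: "(real \<Rightarrow> real) \<Rightarrow> (real \<Rightarrow> real) \<Rightarrow> real \<Rightarrow> real" where
  "control_term u h t = (LINT s:{0..t}|lborel. u s * h (t - s))"

definition evolved :: "(real \<Rightarrow> real) \<Rightarrow> real \<Rightarrow> (real \<Rightarrow> real) \<Rightarrow> (real \<Rightarrow> real) \<Rightarrow> real \<Rightarrow> real" where
  "evolved v c u h t = Phi v c (\<lambda>x. h (x + t)) + control_term u h t"

lemma profiles_deriv: "h \<in> profiles \<Longrightarrow> deriv h \<in> profiles"
  by (rule test_funs_in_profiles[OF profiles_deriv_test_fun])

lemma slope_shift: "h \<in> profiles \<Longrightarrow> slope (\<lambda>x. h (x + t)) = slope h"
  using profiles_period[of h t] by (simp add: slope_def add.commute)

lemma slope_deriv: "h \<in> profiles \<Longrightarrow> slope (deriv h) = 0"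
  using profiles_deriv_test_fun[of h] periodic_2piD[of "deriv h" 0] by (simp add: slope_def test_funs_def)

text \<open>Differentiation under the sign of \<^const>\<open>Phi\<close> needs an error that is uniform in \<open>x\<close>.\<close>

lemma profile_quadratic_error:
  assumes h: "h \<in> profiles"
  obtains B where "B \<ge> 0" "\<And>x d. \<bar>h (x + d) - h x - d * deriv h x\<bar> \<le> B * d\<^sup>2"
proof -
  obtain B where B: "B \<ge> 0" "\<And>x y. \<bar>deriv h x - deriv h y\<bar> \<le> B * \<bar>x - y\<bar>"
    using test_funs_Lipschitz[OF profiles_deriv_test_fun[OF h]] by blast
  have "\<bar>h (x + d) - h x - d * deriv h x\<bar> \<le> B * d\<^sup>2" for x d
  proof -
    define S where "S = cball x \<bar>d\<bar>"
    have "norm ((h (x + d) - (x + d) * deriv h x) - (h x - x * deriv h x)) \<le> (B * \<bar>d\<bar>) * norm ((x + d) - x)"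
    proof (rule field_differentiable_bound[of S "\<lambda>y. h y - y * deriv h x" "\<lambda>y. deriv h y - deriv h x"])
      show "convex S" by (simp add: S_def)
      show "((\<lambda>y. h y - y * deriv h x) has_real_derivative deriv h y - deriv h x) (at y within S)" for y
        by (rule has_field_derivative_at_within)
           (auto intro!: derivative_eq_intros smooth_DERIV profiles_smooth[OF h])
      show "norm (deriv h y - deriv h x) \<le> B * \<bar>d\<bar>" if "y \<in> S" for y
      proof -
        have "\<bar>y - x\<bar> \<le> \<bar>d\<bar>" using that by (simp add: S_def dist_real_def abs_minus_commute)
        from mult_left_mono[OF this B(1)] show ?thesis using B(2)[of y x] by simp
      qed
    qed (auto simp: S_def dist_real_def)
    then show ?thesis by (simp add: algebra_simps power2_eq_square abs_mult_self_eq)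
  qed
  then show ?thesis using that B(1) by blast
qed

lemma DERIV_quadratic_error:
  fixes F :: "real \<Rightarrow> real"
  assumes "\<And>d. \<bar>F (t + d) - F t - d * D\<bar> \<le> B * d\<^sup>2"
  shows "(F has_real_derivative D) (at t)"
  unfolding DERIV_def
proof (rule LIM_zero_cancel, rule Lim_null_comparison)
  show "\<forall>\<^sub>F d in at 0. norm ((F (t + d) - F t) / d - D) \<le> B * \<bar>d\<bar>"
    unfolding eventually_at_filter
  proof (intro always_eventually allI impI)
    fix d :: real assume "d \<noteq> 0"
    then have "((F (t + d) - F t) / d - D) * d = F (t + d) - F t - d * D"
      by (simp add: field_simps)
    then have "\<bar>(F (t + d) - F t) / d - D\<bar> * \<bar>d\<bar> = \<bar>F (t + d) - F t - d * D\<bar>"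
      unfolding abs_mult[symmetric] by simp
    also have "\<dots> \<le> (B * \<bar>d\<bar>) * \<bar>d\<bar>"
      using assms[of d] by (simp add: power2_eq_square mult.assoc)
    finally show "norm ((F (t + d) - F t) / d - D) \<le> B * \<bar>d\<bar>"
      using \<open>d \<noteq> 0\<close> by simp
  qed
  have "((\<lambda>d. B * \<bar>d\<bar>) \<longlongrightarrow> B * \<bar>0\<bar>) (at (0::real))" by (intro tendsto_intros)
  then show "((\<lambda>d. B * \<bar>d\<bar>) \<longlongrightarrow> 0) (at 0)" by simp
qed

context
  fixes v :: "real \<Rightarrow> real" and c M :: real
  assumes v_meas: "v \<in> borel_measurable borel" and v_bound: "\<And>x. \<bar>v x\<bar> \<le> M"
begin

lemma M_nonneg: "M \<ge> 0"
  using v_bound[of 0] by linarith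

lemma Phi_lin:
  assumes "h \<in> profiles" "k \<in> profiles"
  shows "Phi v c (\<lambda>x. p * h x + q * k x) = p * Phi v c h + q * Phi v c k"
  unfolding Phi_def LINT_lin_right[OF v_meas v_bound profiles_continuous[OF assms(1)] profiles_continuous[OF assms(2)]]
  by (simp add: slope_def algebra_simps)

lemma Phi_shift_DERIV:
  assumes h: "h \<in> profiles"
  shows "((\<lambda>t. Phi v c (\<lambda>x. h (x + t))) has_real_derivative Phi v c (\<lambda>x. deriv h (x + t))) (at t)"
proof -
  obtain B where B: "B \<ge> 0" "\<And>x d. \<bar>h (x + d) - h x - d * deriv h x\<bar> \<le> B * d\<^sup>2"
    using profile_quadratic_error[OF h] by blast
  note hs = profiles_shift[OF h] and ds = profiles_shift[OF profiles_deriv[OF h]]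
  show ?thesis
  proof (rule DERIV_quadratic_error)
    fix d
    define e where "e = (\<lambda>x. 1 * (1 * h (x + (t + d)) + (-1) * h (x + t)) + (- d) * deriv h (x + t))"
    have k: "(\<lambda>x. 1 * h (x + (t + d)) + (-1) * h (x + t)) \<in> profiles"
      by (intro profiles_add profiles_cmult hs)
    have e: "e \<in> profiles" unfolding e_def by (intro profiles_add profiles_cmult hs ds)
    have eq: "Phi v c (\<lambda>x. h (x + (t + d))) - Phi v c (\<lambda>x. h (x + t)) - d * Phi v c (\<lambda>x. deriv h (x + t)) = Phi v c e"
      unfolding e_def Phi_lin[OF k ds] Phi_lin[OF hs hs] by simp
    have "slope e = 0"
      using slope_shift[OF h, of "t + d"] slope_shift[OF h, of t]
        slope_shift[OF profiles_deriv[OF h], of t] slope_deriv[OF h]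
      by (simp add: e_def slope_def algebra_simps)
    then have "\<bar>Phi v c e\<bar> \<le> M * L1_Icc (-pi) pi e"
      using LINT_bounded_mult[OF v_meas v_bound profiles_continuous[OF e]] by (simp add: Phi_def)
    also have "L1_Icc (-pi) pi e \<le> (LINT x:{-pi..pi}|lborel. B * d\<^sup>2)"
      unfolding L1_Icc_def
    proof (intro set_integral_mono continuous_set_integrable_abs profiles_continuous[OF e] continuous_set_integrable continuous_intros)
      show "\<bar>e x\<bar> \<le> B * d\<^sup>2" for x
        using B(2)[of "x + t" d] by (simp add: e_def algebra_simps)
    qed
    also have "\<dots> = 2 * pi * (B * d\<^sup>2)" by (simp add: LINT_const_Icc)
    finally show "\<bar>Phi v c (\<lambda>x. h (x + (t + d))) - Phi v c (\<lambda>x. h (x + t)) - d * Phi v c (\<lambda>x. deriv h (x + t))\<bar>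
        \<le> (M * (2 * pi * B)) * d\<^sup>2"
      unfolding eq using M_nonneg by (simp add: mult.assoc mult_left_mono)
  qed
qed

lemma Phi_shift_continuous:
  assumes "h \<in> profiles"
  shows "continuous_on S (\<lambda>t. Phi v c (\<lambda>x. h (x + t)))"
  by (rule DERIV_continuous_on[OF has_field_derivative_at_within[OF Phi_shift_DERIV[OF assms]]])

lemma Phi_shift_integral:
  assumes h: "h \<in> profiles" and t: "0 \<le> t"
  shows "Phi v c (\<lambda>x. h (x + t)) = Phi v c h + (LINT r:{0..t}|lborel. Phi v c (\<lambda>x. deriv h (x + r)))"
proof -
  have "(\<integral>r. indicator {0..t} r *\<^sub>R Phi v c (\<lambda>x. deriv h (x + r)) \<partial>lborel)
      = Phi v c (\<lambda>x. h (x + t)) - Phi v c (\<lambda>x. h (x + 0))"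
    by (rule integral_FTC_Icc)
       (use t in \<open>auto intro!: Phi_shift_continuous profiles_deriv[OF h] has_field_derivative_at_within
          Phi_shift_DERIV[OF h] simp flip: has_real_derivative_iff_has_vector_derivative\<close>)
  then show ?thesis by (simp add: set_lebesgue_integral_def)
qed

end

text \<open>Since \<open>u\<close> is only measurable, the term is not differentiated. Instead \<open>h(t - s)\<close> is written as
  \<open>h(0)\<close> plus the integral of \<open>h'(r - s)\<close> over \<open>r \<in> [s,t]\<close>, and Fubini's theorem is applied on
  the triangle \<open>0 \<le> s \<le> r \<le> t\<close>.\<close>

lemma control_term_integral:
  assumes u: "u \<in> borel_measurable borel" and U: "\<And>x. \<bar>u x\<bar> \<le> U" and h: "h \<in> profiles" and t: "0 \<le> t"
  shows "set_integrable lborel {0..t} (control_term u (deriv h))"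
    and "control_term u h t = (LINT r:{0..t}|lborel. control_term u (deriv h) r + u r * h 0)"
proof -
  note [measurable] = u
  note D = smooth_DERIV[OF profiles_smooth[OF h]]
  have cd: "continuous_on UNIV (deriv h)" by (intro profiles_continuous profiles_deriv h)
  then have [measurable]: "deriv h \<in> borel_measurable borel" by (rule borel_measurable_continuous_onI)
  have [measurable]: "h \<in> borel_measurable borel"
    by (intro borel_measurable_continuous_onI profiles_continuous h)
  obtain B where B: "B \<ge> 0" "\<And>x. \<bar>deriv h x\<bar> \<le> B"
    using test_funs_bounded[OF profiles_deriv_test_fun[OF h]] by blast
  have U0: "U \<ge> 0" using U[of 0] by linarith
  define k where "k s r = indicator {0..t} s * indicator {s..t} r * (u s * deriv h (r - s))" for s r
  have k_eq: "k s r = indicator {0..t} r * (indicator {0..r} s * (u s * deriv h (r - s)))" for s r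
    by (auto simp: k_def indicator_def)
  have [measurable]: "case_prod k \<in> borel_measurable (lborel \<Otimes>\<^sub>M lborel)"
    unfolding k_def case_prod_beta indicator_def atLeastAtMost_iff by measurable
  have int_k: "integrable (lborel \<Otimes>\<^sub>M lborel) (case_prod k)"
  proof (rule Bochner_Integration.integrable_bound)
    show "integrable (lborel \<Otimes>\<^sub>M lborel) (\<lambda>z. indicator ({0..t} \<times> {0..t}) z *\<^sub>R (U * B))"
      by (intro integrable_scaleR_left integrable_real_indicator)
         (auto simp: lborel.emeasure_pair_measure_Times emeasure_lborel_Icc_eq ennreal_mult_less_top)
    show "AE z in lborel \<Otimes>\<^sub>M lborel. norm (case_prod k z) \<le> norm (indicator ({0..t} \<times> {0..t}) z *\<^sub>R (U * B))"
    proof (intro AE_I2)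
      fix z :: "real \<times> real"
      obtain s r where z: "z = (s, r)" by (cases z)
      have "\<bar>u s * deriv h (r - s)\<bar> \<le> U * B"
        unfolding abs_mult by (intro mult_mono U B U0) auto
      then show "norm (case_prod k z) \<le> norm (indicator ({0..t} \<times> {0..t}) z *\<^sub>R (U * B))"
        using U0 B(1) by (auto simp: z k_def indicator_def)
    qed
  qed measurable
  have inner_s: "(\<integral>s. k s r \<partial>lborel) = indicator {0..t} r * control_term u (deriv h) r" for r
    unfolding k_eq control_term_def set_lebesgue_integral_def by simp
  have inner_r: "(\<integral>r. k s r \<partial>lborel) = indicator {0..t} s * (u s * (h (t - s) - h 0))" for s
  proof (cases "s \<in> {0..t}")
    case True
    have "(\<integral>r. indicator {s..t} r *\<^sub>R deriv h (r - s) \<partial>lborel) = h (t - s) - h (s - s)"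
    proof (rule integral_FTC_Icc)
      show "s \<le> t" using True by simp
      show "continuous_on {s..t} (\<lambda>r. deriv h (r - s))"
        by (intro continuous_on_compose2[OF cd] continuous_intros) auto
      show "((\<lambda>r. h (r - s)) has_vector_derivative deriv h (r - s)) (at r within {s..t})" for r
        unfolding has_real_derivative_iff_has_vector_derivative[symmetric]
        by (rule has_field_derivative_at_within)
           (use DERIV_shift[of h "deriv h (r - s)" r "- s"] D in simp)
    qed
    then have "(\<integral>r. u s * (indicator {s..t} r *\<^sub>R deriv h (r - s)) \<partial>lborel) = u s * (h (t - s) - h 0)"
      by simp
    moreover have "k s r = u s * (indicator {s..t} r *\<^sub>R deriv h (r - s))" for r
      using True by (simp add: k_def)
    ultimately show ?thesis using True by simp
  qed (simp add: k_def)
  show int: "set_integrable lborel {0..t} (control_term u (deriv h))"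
    using lborel_pair.integrable_snd[OF int_k] unfolding inner_s set_integrable_def by simp
  have "(LINT r:{0..t}|lborel. control_term u (deriv h) r) = (\<integral>r. (\<integral>s. k s r \<partial>lborel) \<partial>lborel)"
    unfolding inner_s set_lebesgue_integral_def by simp
  also have "\<dots> = (\<integral>s. (\<integral>r. k s r \<partial>lborel) \<partial>lborel)"
    by (rule lborel_pair.Fubini_integral[OF int_k])
  also have "\<dots> = (LINT s:{0..t}|lborel. u s * (h (t - s) - h 0))"
    unfolding inner_r set_lebesgue_integral_def by simp
  finally have 1: "(LINT r:{0..t}|lborel. control_term u (deriv h) r) = (LINT s:{0..t}|lborel. u s * (h (t - s) - h 0))" .
  have ch: "continuous_on UNIV (\<lambda>s. h (t - s))"
    by (intro continuous_on_compose2[OF profiles_continuous[OF h, of UNIV]] continuous_intros) auto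
  have i0: "set_integrable lborel {0..t} (\<lambda>s. u s * h 0)"
    and i1: "set_integrable lborel {0..t} (\<lambda>s. u s * (h (t - s) - h 0))"
    by (intro set_integrable_bounded_mult[OF u U] continuous_intros ch)+
  have "control_term u h t = (LINT s:{0..t}|lborel. u s * (h (t - s) - h 0) + u s * h 0)"
    unfolding control_term_def by (simp add: algebra_simps)
  also have "\<dots> = (LINT s:{0..t}|lborel. u s * (h (t - s) - h 0)) + (LINT s:{0..t}|lborel. u s * h 0)"
    by (rule set_integral_add(2)[OF i1 i0])
  also have "\<dots> = (LINT r:{0..t}|lborel. control_term u (deriv h) r + u r * h 0)"
    unfolding 1[symmetric] by (rule set_integral_add(2)[OF int i0, symmetric])
  finally show "control_term u h t = (LINT r:{0..t}|lborel. control_term u (deriv h) r + u r * h 0)" .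
qed

lemma control_term_lin:
  assumes u: "u \<in> borel_measurable borel" "\<And>x. \<bar>u x\<bar> \<le> U" and h: "h \<in> profiles" and k: "k \<in> profiles"
  shows "control_term u (\<lambda>x. p * h x + q * k x) t = p * control_term u h t + q * control_term u k t"
proof -
  have c: "continuous_on UNIV (\<lambda>s. h (t - s))" if "h \<in> profiles" for h
    by (intro continuous_on_compose2[OF profiles_continuous[OF that, of UNIV]] continuous_intros) auto
  show ?thesis
    unfolding control_term_def by (rule LINT_lin_right[OF u c[OF h] c[OF k]])
qed

lemma control_term_bound:
  assumes u: "u \<in> borel_measurable borel" "\<And>x. \<bar>u x\<bar> \<le> U" and h: "h \<in> profiles"
  shows "\<bar>control_term u h t\<bar> \<le> U * L1_Icc 0 t h"
proof -
  have "\<bar>control_term u h t\<bar> \<le> U * L1_Icc 0 t (\<lambda>s. h (t - s))"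
    unfolding control_term_def
    by (intro LINT_bounded_mult u continuous_on_compose2[OF profiles_continuous[OF h, of UNIV]] continuous_intros) auto
  also have "L1_Icc 0 t (\<lambda>s. h (t - s)) = L1_Icc 0 t h"
    unfolding L1_Icc_def by (rule LINT_reflect_Icc[of t "\<lambda>s. \<bar>h s\<bar>"])
  finally show ?thesis .
qed

lemma evolved_0: "evolved v c u h 0 = Phi v c h"
proof -
  have "control_term u h 0 = 0"
    unfolding control_term_def set_lebesgue_integral_def
  proof (rule integral_eq_zero_AE)
    show "AE x in lborel. indicator {0..0} x *\<^sub>R (u x * h (0 - x)) = 0"
      using AE_lborel_singleton[of "0::real"] by eventually_elim simp
  qed
  then show ?thesis
    by (simp add: evolved_def)
qed

context
  fixes v u :: "real \<Rightarrow> real" and c M U T :: real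
  assumes v: "v \<in> borel_measurable borel" "\<And>x. \<bar>v x\<bar> \<le> M"
    and u: "u \<in> borel_measurable borel" "\<And>x. \<bar>u x\<bar> \<le> U"
    and T: "T > 2 * pi"
begin

text \<open>The equation of motion in terms of profiles: \<open>\<partial>/\<partial>t\<close> turns \<open>h\<close> into \<open>h'\<close>, and the load adds
  \<open>u(t) h(0)\<close>. Both equations of the string are instances, see \<open>trajectory_controlled_string\<close>.\<close>

lemma evolved_integral:
  assumes h: "h \<in> profiles" and t: "t \<ge> 0"
  shows "set_integrable lborel {0..t} (evolved v c u (deriv h))"
    and "set_integrable lborel {0..t} (\<lambda>r. evolved v c u (deriv h) r + u r * h 0)"
    and "evolved v c u h t = evolved v c u h 0 + (LINT r:{0..t}|lborel. evolved v c u (deriv h) r + u r * h 0)"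
proof -
  have i1: "set_integrable lborel {0..t} (\<lambda>r. Phi v c (\<lambda>x. deriv h (x + r)))"
    by (intro continuous_set_integrable Phi_shift_continuous[OF v] profiles_deriv h)
  note i2 = control_term_integral(1)[OF u h t]
  have i3: "set_integrable lborel {0..t} (\<lambda>r. u r * h 0)"
    by (intro set_integrable_bounded_mult[OF u] continuous_intros)
  note i4 = set_integral_add(1)[OF i2 i3]
  show i12: "set_integrable lborel {0..t} (evolved v c u (deriv h))"
    unfolding evolved_def by (rule set_integral_add(1)[OF i1 i2])
  show "set_integrable lborel {0..t} (\<lambda>r. evolved v c u (deriv h) r + u r * h 0)"
    by (rule set_integral_add(1)[OF i12 i3])
  have "(LINT r:{0..t}|lborel. evolved v c u (deriv h) r + u r * h 0)
      = (LINT r:{0..t}|lborel. Phi v c (\<lambda>x. deriv h (x + r))) + (LINT r:{0..t}|lborel. control_term u (deriv h) r + u r * h 0)"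
    unfolding evolved_def add.assoc by (rule set_integral_add(2)[OF i1 i4])
  then show "evolved v c u h t = evolved v c u h 0 + (LINT r:{0..t}|lborel. evolved v c u (deriv h) r + u r * h 0)"
    using Phi_shift_integral[OF v h t] control_term_integral(2)[OF u h t]
    unfolding evolved_0 by (simp add: evolved_def)
qed

lemma evolved_bound:
  "\<exists>K. \<forall>h\<in>profiles. \<bar>evolved v c u h t\<bar> \<le> K * L1_Icc 0 T h"
proof -
  obtain K where K: "K \<ge> 0" "\<And>h. h \<in> profiles \<Longrightarrow> \<bar>Phi v c h\<bar> \<le> K * L1_Icc 0 T h"
    using Phi_bound[OF v T] by blast
  obtain C1 where C1: "\<And>h. h \<in> profiles \<Longrightarrow> L1_Icc (0 + t) (T + t) h \<le> C1 * L1_Icc 0 T h"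
    using L1_Icc_compare[where a=0 and b=T and c="0 + t" and d="T + t"] T by auto
  obtain C2 where C2: "\<And>h. h \<in> profiles \<Longrightarrow> L1_Icc 0 t h \<le> C2 * L1_Icc 0 T h"
    using L1_Icc_compare[where a=0 and b=T and c=0 and d=t] T by auto
  have U: "U \<ge> 0" using u(2)[of 0] by linarith
  have "\<bar>evolved v c u h t\<bar> \<le> (K * C1 + U * C2) * L1_Icc 0 T h" if h: "h \<in> profiles" for h
  proof -
    have "\<bar>Phi v c (\<lambda>x. h (x + t))\<bar> \<le> K * L1_Icc 0 T (\<lambda>x. h (x + t))"
      by (intro K profiles_shift h)
    also have "L1_Icc 0 T (\<lambda>x. h (x + t)) = L1_Icc (0 + t) (T + t) h"
      unfolding L1_Icc_def by (rule LINT_shift_Icc[where g="\<lambda>x. \<bar>h x\<bar>"])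
    also have "K * L1_Icc (0 + t) (T + t) h \<le> K * (C1 * L1_Icc 0 T h)"
      by (intro mult_left_mono C1 h K)
    finally have 1: "\<bar>Phi v c (\<lambda>x. h (x + t))\<bar> \<le> K * (C1 * L1_Icc 0 T h)" .
    have 2: "\<bar>control_term u h t\<bar> \<le> U * (C2 * L1_Icc 0 T h)"
      using control_term_bound[OF u h, of t] mult_left_mono[OF C2[OF h] U] by linarith
    show ?thesis
      unfolding evolved_def using order_trans[OF abs_triangle_ineq add_mono[OF 1 2]]
      by (simp add: distrib_right mult.assoc)
  qed
  then show ?thesis by blast
qed

definition trajectory :: "real \<Rightarrow> dist \<times> dist" where
  "trajectory t = state_of (\<lambda>\<xi>. evolved v c u (profile \<xi>) t)"

lemma trajectory:
  shows trajectory_states: "trajectory t \<in> states"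
    and trajectory_pairing: "\<xi> \<in> dual_vecs \<Longrightarrow> pairing (trajectory t) \<xi> = evolved v c u (profile \<xi>) t"
proof -
  have lin: "evolved v c u (\<lambda>x. p * h x + q * k x) t = p * evolved v c u h t + q * evolved v c u k t"
    if "h \<in> profiles" "k \<in> profiles" for h k p q
    using Phi_lin[OF v profiles_shift[OF that(1), of t] profiles_shift[OF that(2), of t]] control_term_lin[OF u that]
    by (simp add: evolved_def algebra_simps)
  have add: "evolved v c u (profile (dv_add \<xi> \<zeta>)) t = evolved v c u (profile \<xi>) t + evolved v c u (profile \<zeta>) t"
    if "\<xi> \<in> dual_vecs" "\<zeta> \<in> dual_vecs" for \<xi> \<zeta>
    using lin[OF that[THEN profile_in_profiles], of 1 1] by (simp add: profile_add[OF that])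
  have scale: "evolved v c u (profile (dv_scale a \<xi>)) t = a * evolved v c u (profile \<xi>) t" if "\<xi> \<in> dual_vecs" for \<xi> a
    using lin[OF profile_in_profiles[OF that] profile_in_profiles[OF that], of a 0] by (simp add: profile_scale[OF that])
  obtain K where "\<forall>h\<in>profiles. \<bar>evolved v c u h t\<bar> \<le> K * L1_Icc 0 T h"
    using evolved_bound by blast
  then have bound: "\<bar>evolved v c u (profile \<xi>) t\<bar> \<le> K * dual_norm T \<xi>" if "\<xi> \<in> dual_vecs" for \<xi>
    using profile_in_profiles[OF that] dual_norm_L1[OF that] by metis
  have "T \<ge> 0" using T pi_gt_zero by linarith
  show "trajectory t \<in> states"
    unfolding trajectory_def using add scale bound \<open>T \<ge> 0\<close> by (rule state_of(1))
  show "pairing (trajectory t) \<xi> = evolved v c u (profile \<xi>) t" if "\<xi> \<in> dual_vecs"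
    unfolding trajectory_def using add scale bound \<open>T \<ge> 0\<close> that by (rule state_of(2))
qed

lemma trajectory_components:
  assumes \<phi>: "\<phi> \<in> test_funs"
  shows "fst (trajectory t) \<phi> = evolved v c u (odd_part (even_part \<phi>, \<lambda>_. 0)) t"
    and "snd (trajectory t) \<phi> = evolved v c u (even_part \<phi>) t"
  using component_pairing[OF trajectory_states[of t] \<phi>]
    trajectory_pairing[OF component_dual_vec(1)[OF \<phi>], of t] trajectory_pairing[OF component_dual_vec(2)[OF \<phi>], of t]
  by (simp_all add: profile_odd_part) (simp add: odd_part_def)

lemma odd_primitive_profile:
  assumes \<phi>: "\<phi> \<in> test_funs"
  shows "odd_part (even_part \<phi>, \<lambda>_. 0) \<in> profiles" (is "?o \<in> _")
    "deriv (odd_part (even_part \<phi>, \<lambda>_. 0)) = even_part \<phi>"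
    "odd_part (even_part \<phi>, \<lambda>_. 0) 0 = 0"
proof -
  note \<xi> = component_dual_vec(1)[OF \<phi>]
  have eq: "?o = profile (even_part \<phi>, \<lambda>_. 0)"
    by (simp add: profile_odd_part)
  show "?o \<in> profiles"
    unfolding eq by (rule profile_in_profiles[OF \<xi>])
  show "deriv (?o) = even_part \<phi>"
    unfolding eq using profile_DERIV[OF \<xi>] by (auto intro!: DERIV_imp_deriv)
  show "?o 0 = 0" by (simp add: odd_part_def)
qed

lemma even_part_0: "even_part \<phi> 0 = \<phi> 0"
  by (simp add: even_part_def)

text \<open>The profile that computes \<open>f\<^sub>0(\<phi>'')\<close> is the derivative of the one that computes \<open>f\<^sub>1(\<phi>)\<close>; this is
  how \<open>\<partial>f\<^sub>1/\<partial>t = \<Delta>f\<^sub>0\<close> appears among profiles.\<close>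

lemma odd_primitive_second_deriv:
  assumes \<phi>: "\<phi> \<in> test_funs"
  shows "odd_part (even_part (deriv (deriv \<phi>)), \<lambda>_. 0) = deriv (even_part \<phi>)"
proof
  fix x :: real
  note d = test_funs_deriv[OF \<phi>] and dd = test_funs_deriv[OF test_funs_deriv[OF \<phi>]]
  have 1: "(even_part \<phi> has_real_derivative (deriv \<phi> x - deriv \<phi> (- x)) / 2) (at x)" for x
    unfolding even_part_def
    by (auto intro!: derivative_eq_intros test_funs_DERIV[OF \<phi>] DERIV_chain'[OF _ test_funs_DERIV[OF \<phi>]])
  then have D: "deriv (even_part \<phi>) = (\<lambda>x. (deriv \<phi> x - deriv \<phi> (- x)) / 2)"
    by (auto intro!: DERIV_imp_deriv)
  have "odd_part (even_part (deriv (deriv \<phi>)), \<lambda>_. 0) x = deriv (even_part \<phi>) x - deriv (even_part \<phi>) 0"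
    unfolding odd_part_def fst_conv
  proof (rule LBINT_eq_primitive)
    show "continuous_on UNIV (even_part (deriv (deriv \<phi>)))"
      using even_part_test[OF dd] by (intro smooth_continuous_on) (simp add: test_funs_def)
    show "(deriv (even_part \<phi>) has_real_derivative even_part (deriv (deriv \<phi>)) x) (at x)" for x
      unfolding D unfolding even_part_def
      by (auto intro!: derivative_eq_intros test_funs_DERIV[OF d] DERIV_chain'[OF _ test_funs_DERIV[OF d]])
  qed
  then show "odd_part (even_part (deriv (deriv \<phi>)), \<lambda>_. 0) x = deriv (even_part \<phi>) x"
    by (simp add: D)
qed

lemma trajectory_controlled_string: "controlled_string S u trajectory"
  unfolding controlled_string_def
proof (intro conjI ballI)
  show "trajectory t \<in> states" for t by (rule trajectory_states)
  fix \<phi> assume \<phi>: "\<phi> \<in> test_funs"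
  note dd = test_funs_deriv[OF test_funs_deriv[OF \<phi>]]
  let ?o = "odd_part (even_part \<phi>, \<lambda>_. 0)"
  note op = odd_primitive_profile[OF \<phi>]
  have ep: "even_part \<phi> \<in> profiles" by (intro test_funs_in_profiles even_part_test \<phi>)
  have snd_eq: "snd (trajectory s) \<phi> = evolved v c u (deriv (?o)) s
      + u s * ?o 0" for s
    unfolding op(2,3) by (simp add: trajectory_components[OF \<phi>])
  have "dist_deriv (dist_deriv (fst (trajectory s))) \<phi> = fst (trajectory s) (deriv (deriv \<phi>))" for s
    by (simp add: dist_deriv_def \<phi> test_funs_deriv)
  then have acc_eq: "dist_deriv (dist_deriv (fst (trajectory s))) \<phi> + u s * dirac \<phi>
      = evolved v c u (deriv (even_part \<phi>)) s + u s * even_part \<phi> 0" for s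
    by (simp add: trajectory_components[OF dd] odd_primitive_second_deriv[OF \<phi>] dirac_def \<phi> even_part_0)
  have empty: "set_integrable lborel {0..S} k" if "\<not> S \<ge> 0" for k :: "real \<Rightarrow> real"
    using that by (simp add: set_integrable_def)
  show "set_integrable lborel {0..S} (\<lambda>s. snd (trajectory s) \<phi>)"
    unfolding snd_eq by (cases "S \<ge> 0") (auto intro: evolved_integral(2)[OF op(1)] empty)
  show "set_integrable lborel {0..S} (\<lambda>s. dist_deriv (dist_deriv (fst (trajectory s))) \<phi> + u s * dirac \<phi>)"
    unfolding acc_eq by (cases "S \<ge> 0") (auto intro: evolved_integral(2)[OF ep] empty)
  fix t assume "t \<in> {0..S}"
  then have t: "t \<ge> 0" by simp
  show "fst (trajectory t) \<phi> = fst (trajectory 0) \<phi> + (LINT s:{0..t}|lborel. snd (trajectory s) \<phi>)"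
    unfolding snd_eq trajectory_components(1)[OF \<phi>] by (rule evolved_integral(3)[OF op(1) t])
  show "snd (trajectory t) \<phi> = snd (trajectory 0) \<phi> +
      (LINT s:{0..t}|lborel. dist_deriv (dist_deriv (fst (trajectory s))) \<phi> + u s * dirac \<phi>)"
    unfolding acc_eq trajectory_components(2)[OF \<phi>] by (rule evolved_integral(3)[OF ep t])
qed

end

lemma LINT_split:
  fixes f :: "real \<Rightarrow> real"
  assumes ab: "a \<le> b" "b \<le> c" and f: "set_integrable lborel {a..c} f"
  shows "(LINT x:{a..c}|lborel. f x) = (LINT x:{a..b}|lborel. f x) + (LINT x:{b..c}|lborel. f x)"
proof -
  have 1: "set_integrable lborel {a..b} f" and 2: "set_integrable lborel {b..c} f"
    using ab by (auto intro: set_integrable_subset[OF f])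
  have "(LINT x:{a..c}|lborel. f x) = (LINT x|lborel. indicator {a..b} x *\<^sub>R f x + indicator {b..c} x *\<^sub>R f x)"
    unfolding set_lebesgue_integral_def
  proof (rule integral_cong_AE)
    show "AE x in lborel. indicator {a..c} x *\<^sub>R f x = indicator {a..b} x *\<^sub>R f x + indicator {b..c} x *\<^sub>R f x"
      using AE_lborel_singleton[of b]
    proof eventually_elim
      fix x :: real assume "x \<noteq> b"
      then show "indicator {a..c} x *\<^sub>R f x = indicator {a..b} x *\<^sub>R f x + indicator {b..c} x *\<^sub>R f x"
        using ab by (auto simp: indicator_def)
    qed
  qed (use f 1 2 in \<open>auto simp: set_integrable_def dest: borel_measurable_integrable\<close>)
  also have "\<dots> = (LINT x:{a..b}|lborel. f x) + (LINT x:{b..c}|lborel. f x)"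
    using 1 2 unfolding set_lebesgue_integral_def set_integrable_def
    by (rule Bochner_Integration.integral_add)
  finally show ?thesis .
qed

lemma LINT_indicator_mult:
  fixes g :: "real \<Rightarrow> real"
  assumes "{a..b} \<subseteq> {c..d}"
  shows "(LINT x:{c..d}|lborel. indicator {a..b} x * g x) = (LINT x:{a..b}|lborel. g x)"
  unfolding set_lebesgue_integral_def
proof (rule Bochner_Integration.integral_cong[OF refl])
  fix x
  show "indicator {c..d} x *\<^sub>R (indicator {a..b} x * g x) = indicator {a..b} x *\<^sub>R g x"
    using subsetD[OF assms, of x] by (cases "x \<in> {a..b}") auto
qed

text \<open>The part of \<open>\<integral> v(x) h(x + T) dx\<close> over \<open>[0,\<pi>]\<close> would look at \<open>h\<close> beyond \<open>T\<close>. Because \<open>v\<close> is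
  periodic, shifting it back by \<open>2\<pi>\<close> costs only a multiple of the slope, and the slope is the mean of
  \<open>h(x + 2\<pi>) - h(x)\<close> over \<open>[0, T - 2\<pi>]\<close>. Everything is then an integral of \<open>h\<close> against a bounded
  function \<open>w\<close> on \<open>[0,T]\<close>, which the load \<open>u(s) = - w(T - s)\<close> cancels.\<close>

lemma exists_steering_control:
  assumes v: "v \<in> borel_measurable borel" "\<And>x. \<bar>v x\<bar> \<le> M" and per: "periodic_2pi v" and T: "T > 2 * pi"
  obtains u U where "u \<in> borel_measurable borel" "\<And>x. \<bar>u x\<bar> \<le> U"
    "\<And>h. h \<in> profiles \<Longrightarrow> evolved v c u h T = 0"
proof -
  note [measurable] = v(1)
  define \<kappa> where "\<kappa> = (LINT x:{-2*pi..-pi}|lborel. v x)"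
  \<comment> \<open>\<open>\<kappa>\<close> is the cost of the shift, \<open>a\<close> turns the slope into an integral over \<open>[0, T - 2\<pi>]\<close>.\<close>
  define a where "a = (c + \<kappa>) / (T - 2 * pi)"
  define w where "w x = indicator {T - 2 * pi..T} x * v (x - T)
      + a * (indicator {2 * pi..T} x - indicator {0..T - 2 * pi} x)" for x
  define u where "u s = - w (T - s)" for s
  have [measurable]: "w \<in> borel_measurable borel" unfolding w_def by measurable
  have "u \<in> borel_measurable borel" unfolding u_def by measurable
  moreover have "\<bar>u s\<bar> \<le> M + \<bar>a\<bar>" for s
  proof -
    have "\<bar>w x\<bar> \<le> M + \<bar>a\<bar>" for x
    proof -
      have "\<bar>indicator {T - 2 * pi..T} x * v (x - T)\<bar> \<le> M"
        using v(2)[of "x - T"] v(2)[of 0] by (auto simp: indicator_def)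
      moreover have "\<bar>a * (indicator {2 * pi..T} x - indicator {0..T - 2 * pi} x)\<bar> \<le> \<bar>a\<bar>"
        by (auto simp: indicator_def)
      ultimately show ?thesis
        unfolding w_def using abs_triangle_ineq order_trans add_mono by meson
    qed
    then show ?thesis by (simp add: u_def)
  qed
  moreover have "evolved v c u h T = 0" if h: "h \<in> profiles" for h
  proof -
    let ?J = "\<lambda>b d. LINT x:{b..d}|lborel. h x"
    have ch: "continuous_on UNIV h" by (rule profiles_continuous[OF h])
    define k where "k x = h (x + T)" for x
    have k: "k \<in> profiles" unfolding k_def by (rule profiles_shift[OF h])
    note ck = profiles_continuous[OF k]
    have sk: "slope k = slope h" unfolding k_def by (rule slope_shift[OF h])
    have "(LINT x:{-pi..pi}|lborel. v x * k x) = (LINT x:{-pi..0}|lborel. v x * k x) + (LINT x:{0..pi}|lborel. v x * k x)"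
      by (intro LINT_split set_integrable_bounded_mult[OF v ck]) auto
    also have "(LINT x:{0..pi}|lborel. v x * k x) = (LINT x:{-2*pi..-pi}|lborel. v (x + 2 * pi) * k (x + 2 * pi))"
      using LINT_shift_Icc[of "-2*pi" "-pi" "\<lambda>x. v x * k x" "2*pi"] by simp
    also have "\<dots> = (LINT x:{-2*pi..-pi}|lborel. v x * (1 * k x + slope h * 1))"
      unfolding periodic_2piD[OF per] profiles_period[OF k] sk by simp
    also have "\<dots> = 1 * (LINT x:{-2*pi..-pi}|lborel. v x * k x) + slope h * (LINT x:{-2*pi..-pi}|lborel. v x * 1)"
      by (rule LINT_lin_right[OF v ck]) (rule continuous_on_const)
    also have "(LINT x:{-2*pi..-pi}|lborel. v x * 1) = \<kappa>"
      by (simp add: \<kappa>_def)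
    finally have "(LINT x:{-pi..pi}|lborel. v x * k x)
        = (LINT x:{-2*pi..-pi}|lborel. v x * k x) + (LINT x:{-pi..0}|lborel. v x * k x) + slope h * \<kappa>" by simp
    also have "(LINT x:{-2*pi..-pi}|lborel. v x * k x) + (LINT x:{-pi..0}|lborel. v x * k x) = (LINT x:{-2*pi..0}|lborel. v x * k x)"
      by (intro LINT_split[symmetric] set_integrable_bounded_mult[OF v ck]) auto
    also have "\<dots> = (LINT x:{T - 2*pi..T}|lborel. v (x - T) * h x)"
      using LINT_shift_Icc[of "-2*pi" 0 "\<lambda>x. v (x - T) * h x" T] by (simp add: k_def)
    finally have "Phi v c k = (LINT x:{T - 2*pi..T}|lborel. v (x - T) * h x) + (c + \<kappa>) * slope h"
      by (simp add: Phi_def sk algebra_simps)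
    also have "(c + \<kappa>) * slope h = a * ((T - 2 * pi) * slope h)"
      using T by (simp add: a_def)
    also have "(T - 2 * pi) * slope h = ?J (2 * pi) T - ?J 0 (T - 2 * pi)"
    proof -
      have "?J (2 * pi) T = (LINT x:{0..T - 2*pi}|lborel. h x + slope h)"
        using LINT_shift_Icc[of 0 "T - 2*pi" h "2*pi"] by (simp add: profiles_period[OF h])
      also have "\<dots> = ?J 0 (T - 2 * pi) + (LINT x:{0..T - 2*pi}|lborel. slope h)"
        by (intro set_integral_add continuous_set_integrable ch continuous_intros)
      finally show ?thesis using T by (simp add: LINT_const_Icc)
    qed
    finally have Phi: "Phi v c k = (LINT x:{T - 2*pi..T}|lborel. v (x - T) * h x)
        + a * (?J (2 * pi) T - ?J 0 (T - 2 * pi))" .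
    have v': "(\<lambda>x. indicator {T - 2*pi..T} x * v (x - T)) \<in> borel_measurable borel"
      "\<bar>indicator {T - 2*pi..T} x * v (x - T)\<bar> \<le> M" for x
      using v(2)[of "x - T"] v(2)[of 0] by (measurable, auto simp: indicator_def)
    have i1: "set_integrable lborel {0..T} (\<lambda>x. (indicator {T - 2*pi..T} x * v (x - T)) * h x)"
      by (rule set_integrable_bounded_mult[OF v' ch])
    have i2: "set_integrable lborel {0..T} (\<lambda>x. indicator {b..d} x * h x)" for b d :: real
      by (rule set_integrable_bounded_mult[where M=1, OF _ _ ch]) (auto simp: indicator_def)
    note i3 = set_integral_diff(1)[OF i2 i2]
    have "(LINT x:{0..T}|lborel. w x * h x) = (LINT x:{0..T}|lborel. (indicator {T - 2*pi..T} x * v (x - T)) * h x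
        + a * (indicator {2*pi..T} x * h x - indicator {0..T - 2*pi} x * h x))"
      unfolding w_def by (simp add: algebra_simps)
    also have "\<dots> = (LINT x:{0..T}|lborel. (indicator {T - 2*pi..T} x * v (x - T)) * h x)
        + (LINT x:{0..T}|lborel. a * (indicator {2*pi..T} x * h x - indicator {0..T - 2*pi} x * h x))"
      by (intro set_integral_add(2) i1 set_integrable_mult_right i3)
    also have "(LINT x:{0..T}|lborel. a * (indicator {2*pi..T} x * h x - indicator {0..T - 2*pi} x * h x))
        = a * ((LINT x:{0..T}|lborel. indicator {2*pi..T} x * h x) - (LINT x:{0..T}|lborel. indicator {0..T - 2*pi} x * h x))"
      using set_integral_diff(2)[OF i2 i2, of "2*pi" T 0 "T - 2*pi"] by simp
    also have "(LINT x:{0..T}|lborel. (indicator {T - 2*pi..T} x * v (x - T)) * h x) = (LINT x:{T - 2*pi..T}|lborel. v (x - T) * h x)"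
      unfolding mult.assoc using T by (intro LINT_indicator_mult) auto
    also have "(LINT x:{0..T}|lborel. indicator {2*pi..T} x * h x) = ?J (2 * pi) T"
      by (intro LINT_indicator_mult) (use pi_ge_zero in auto)
    also have "(LINT x:{0..T}|lborel. indicator {0..T - 2*pi} x * h x) = ?J 0 (T - 2 * pi)"
      by (intro LINT_indicator_mult) (use pi_ge_zero in auto)
    finally have w: "(LINT x:{0..T}|lborel. w x * h x) = Phi v c k" unfolding Phi .
    have "control_term u h T = (LINT s:{0..T}|lborel. - (w (T - s) * h (T - s)))"
      by (simp add: control_term_def u_def)
    also have "\<dots> = (LINT s:{0..T}|lborel. - (w s * h s))"
      by (rule LINT_reflect_Icc[of T "\<lambda>s. - (w s * h s)"])
    also have "\<dots> = - Phi v c k"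
      unfolding w[symmetric] by (simp add: set_lebesgue_integral_def)
    finally show ?thesis by (simp add: evolved_def k_def[abs_def])
  qed
  ultimately show ?thesis by (rule that)
qed

lemma zero_state: "(zero_dist, zero_dist) \<in> states"
  and pairing_zero_state: "\<xi> \<in> dual_vecs \<Longrightarrow> pairing (zero_dist, zero_dist) \<xi> = 0"
proof -
  have "zero_dist \<in> torus_dists"
    unfolding torus_dists_def
    by (auto simp: zero_dist_def test_funs_add test_funs_cmult intro!: exI[of _ "0::real"])
  moreover have "even_dist zero_dist" by (simp add: even_dist_def zero_dist_def test_funs_reflect)
  ultimately show "(zero_dist, zero_dist) \<in> states" by (simp add: states_def)
  show "\<xi> \<in> dual_vecs \<Longrightarrow> pairing (zero_dist, zero_dist) \<xi> = 0"
    using dual_vecsD by (simp add: pairing_def zero_dist_def)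
qed

theorem Linfty_states_can_be_damped:
  assumes f: "f \<in> Linfty_states" and T: "T > 2 * pi"
  shows "can_be_damped T f"
proof -
  obtain v c M where v: "v \<in> borel_measurable borel" "\<And>x. \<bar>v x\<bar> \<le> M" and per: "periodic_2pi v"
    and rep: "\<And>h. h \<in> profiles \<Longrightarrow> pairing f (dual_vec_of h) = Phi v c h"
    using pairing_profile_density[OF f] by metis
  obtain u U where u: "u \<in> borel_measurable borel" "\<And>x. \<bar>u x\<bar> \<le> U"
    and steer: "\<And>h. h \<in> profiles \<Longrightarrow> evolved v c u h T = 0"
    using exists_steering_control[OF v per T] by blast
  define g where "g = trajectory v u c"
  have gs: "g t \<in> states" for t
    unfolding g_def by (rule trajectory_states[OF v u T])
  have gp: "pairing (g t) \<xi> = evolved v c u (profile \<xi>) t" if "\<xi> \<in> dual_vecs" for t \<xi>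
    unfolding g_def by (rule trajectory_pairing[OF v u T that])
  have "g 0 = f"
  proof (rule state_eqI[OF gs Linfty_states_subset[OF f]])
    fix \<xi> assume \<xi>: "\<xi> \<in> dual_vecs"
    show "pairing (g 0) \<xi> = pairing f \<xi>"
      using rep[OF profile_in_profiles[OF \<xi>]] dual_vec_of_profile[OF \<xi>]
      by (simp add: gp[OF \<xi>] evolved_0)
  qed
  moreover have "g T = (zero_dist, zero_dist)"
    by (rule state_eqI[OF gs zero_state]) (simp add: gp pairing_zero_state steer profile_in_profiles)
  moreover have "controlled_string T u g"
    unfolding g_def by (rule trajectory_controlled_string[OF v u T])
  moreover have "bounded_load T u"
    using u by (auto simp: bounded_load_def)
  ultimately show ?thesis unfolding can_be_damped_def by blast
qed

theorem mainTheorem1: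
  fixes T :: real
  assumes "T > 2 * pi"
  shows "equivalent_norms (dual_norm T) (sobolev_norm T)
       \<and> (\<forall>T'>2 * pi. equivalent_norms (dual_norm T') (dual_norm T))
       \<and> (\<forall>\<iota> :: dual_vec \<Rightarrow> 'b::banach. isometric_embedding (dual_norm T) \<iota>
            \<longrightarrow> dual_coincides_with \<iota> Linfty_states)
       \<and> (\<forall>f\<in>Linfty_states. can_be_damped T f)"
  using dual_norm_equivalent_sobolev_norm[OF assms] dual_norms_equivalent[OF assms]
    dual_coincides_with_Linfty_states[OF assms] Linfty_states_can_be_damped[OF _ assms]
  by blast

end
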